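(* Let $\alpha>1/2$ and $c>0$, $\epsilon>0$. There is a distribution over matrices $A$ with $O(\frac{c}{\epsilon^2}k\log n)$ rows and a recovery algorithm running in $O(n\log n)$ time such that, for any $x\in\mathbb{R}^n$ that is sub-Zipfian with parameters $(k,\alpha)$, the algorithm recovers from $Ax$ a $k$-sparse $x'\in\mathbb{R}^n$ with \[ \|x'-x\|_2\le\left(1+\frac{\epsilon}{\sqrt{\log n}}\right)\mathrm{Err}_2^k(x) \] with probability at least $1-\frac{1}{k^c}$.
   Context: For $x\in\mathbb{R}^n$, let $r_i$ be the index of the $i$-th largest entry of $x$ in magnitude, so $|x_{r_i}|$ is non-increasing in $i$. $x$ is sub-Zipfian with parameters $(k,\alpha)$ if there is a non-increasing function $f$ with $|x_{r_i}|=\Theta(f(i)i^{-\alpha})$ for all $i\ge k$ (with fixed implied constants). A vector is $k$-sparse if it has at most $k$ non-zero coordinates, and $\mathrm{Err}_2^k(x)=\min_{\hat x\ k\text{-sparse}}\|\hat x-x\|_2$. *)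

theory Defs
  imports "HOL-Probability.Probability_Mass_Function" "Jordan_Normal_Form.Matrix"
begin

section \<open>Vectors\<close>

unbundle no vec_syntax

definition l2_norm :: "real vec \<Rightarrow> real" where
  "l2_norm v = L2_set (\<lambda>i. v $ i) {0..<dim_vec v}"

definition k_sparse :: "nat \<Rightarrow> real vec \<Rightarrow> bool" where
  "k_sparse k v \<longleftrightarrow> card {i. i < dim_vec v \<and> v $ i \<noteq> 0} \<le> k"

text \<open>The infimum is attained, at a vector keeping \<open>k\<close> largest entries of \<open>x\<close>; it is the
  minimum over all \<open>k\<close>-sparse vectors.\<close>

definition Err2 :: "nat \<Rightarrow> real vec \<Rightarrow> real" where
  "Err2 k x = (INF z \<in> {z \<in> carrier_vec (dim_vec x). k_sparse k z}. l2_norm (z - x))"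

text \<open>Ranks run over \<open>{1..n}\<close>, vector indices over \<open>{0..<n}\<close>; \<open>r i\<close> is the index of the
  \<open>i\<close>-th largest entry in magnitude. How ties are broken does not affect \<open>\<bar>x $ r i\<bar>\<close>.\<close>

definition magnitude_ranking :: "real vec \<Rightarrow> (nat \<Rightarrow> nat) \<Rightarrow> bool" where
  "magnitude_ranking x r \<longleftrightarrow>
     bij_betw r {1..dim_vec x} {0..<dim_vec x} \<and>
     (\<forall>i\<in>{1..dim_vec x}. \<forall>j\<in>{1..dim_vec x}. i \<le> j \<longrightarrow> \<bar>x $ r j\<bar> \<le> \<bar>x $ r i\<bar>)"

text \<open>\<open>a\<close> and \<open>b\<close> are the lower and upper constants of the \<open>\<Theta>\<close>.\<close>

definition sub_zipfian :: "real \<Rightarrow> real \<Rightarrow> nat \<Rightarrow> real \<Rightarrow> real vec \<Rightarrow> bool" where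
  "sub_zipfian a b k \<alpha> x \<longleftrightarrow>
     (\<exists>r f. magnitude_ranking x r \<and> antimono (f :: nat \<Rightarrow> real) \<and>
        (\<forall>i\<in>{1..dim_vec x}. k \<le> i \<longrightarrow>
           a * (f i * real i powr (- \<alpha>)) \<le> \<bar>x $ r i\<bar> \<and>
           \<bar>x $ r i\<bar> \<le> b * (f i * real i powr (- \<alpha>))))"

section \<open>Real-RAM programs and their running time\<close>

text \<open>A structured real RAM: scalar variables and zero-initialised arrays over the naturals and
  over the reals. Naturals, used for indexing and counting, only have addition and truncated
  subtraction; reals have the four field operations and comparison. There is no conversion from
  reals to naturals, and real literals are rational, so that no information can be packed into
  the constants of a program.\<close>

datatype nexp =
    NConst nat
  | NVar string
  | NArr string nexp
  | NAdd nexp nexp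
  | NSub nexp nexp

datatype rexp =
    RConst rat
  | RVar string
  | RArr string nexp
  | RAdd rexp rexp
  | RSub rexp rexp
  | RMul rexp rexp
  | RDiv rexp rexp

datatype bexp =
    NLess nexp nexp
  | RLess rexp rexp
  | BNot bexp
  | BAnd bexp bexp

datatype com =
    Skip
  | NAssign string nexp
  | RAssign string rexp
  | NArrAssign string nexp nexp
  | RArrAssign string nexp rexp
  | Seq com com
  | Cond bexp com com
  | While bexp com

record store =
  nvar :: "string \<Rightarrow> nat"
  rvar :: "string \<Rightarrow> real"
  narr :: "string \<Rightarrow> nat \<Rightarrow> nat"
  rarr :: "string \<Rightarrow> nat \<Rightarrow> real"

fun nval :: "nexp \<Rightarrow> store \<Rightarrow> nat" where
  "nval (NConst v) s = v"
| "nval (NVar z) s = nvar s z"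
| "nval (NArr z e) s = narr s z (nval e s)"
| "nval (NAdd e f) s = nval e s + nval f s"
| "nval (NSub e f) s = nval e s - nval f s"

fun rval :: "rexp \<Rightarrow> store \<Rightarrow> real" where
  "rval (RConst q) s = of_rat q"
| "rval (RVar z) s = rvar s z"
| "rval (RArr z e) s = rarr s z (nval e s)"
| "rval (RAdd e f) s = rval e s + rval f s"
| "rval (RSub e f) s = rval e s - rval f s"
| "rval (RMul e f) s = rval e s * rval f s"
| "rval (RDiv e f) s = rval e s / rval f s"

fun bval :: "bexp \<Rightarrow> store \<Rightarrow> bool" where
  "bval (NLess e f) s \<longleftrightarrow> nval e s < nval f s"
| "bval (RLess e f) s \<longleftrightarrow> rval e s < rval f s"
| "bval (BNot b) s \<longleftrightarrow> \<not> bval b s"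
| "bval (BAnd b d) s \<longleftrightarrow> bval b s \<and> bval d s"

text \<open>\<open>exec p s t s'\<close>: started in \<open>s\<close>, the program \<open>p\<close> halts in \<open>s'\<close> after executing \<open>t\<close>
  assignments and tests. Expressions of a fixed program have bounded size, so \<open>t\<close> agrees with
  the number of elementary operations up to a factor depending on \<open>p\<close> only.\<close>

inductive exec :: "com \<Rightarrow> store \<Rightarrow> nat \<Rightarrow> store \<Rightarrow> bool" where
  Skip: "exec Skip s 1 s"
| NAssign: "exec (NAssign z e) s 1 (s\<lparr>nvar := (nvar s)(z := nval e s)\<rparr>)"
| RAssign: "exec (RAssign z e) s 1 (s\<lparr>rvar := (rvar s)(z := rval e s)\<rparr>)"
| NArrAssign: "exec (NArrAssign z i e) s 1
    (s\<lparr>narr := (narr s)(z := (narr s z)(nval i s := nval e s))\<rparr>)"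
| RArrAssign: "exec (RArrAssign z i e) s 1
    (s\<lparr>rarr := (rarr s)(z := (rarr s z)(nval i s := rval e s))\<rparr>)"
| Seq: "exec p s t s' \<Longrightarrow> exec q s' u s'' \<Longrightarrow> exec (Seq p q) s (t + u) s''"
| CondTrue: "bval b s \<Longrightarrow> exec p s t s' \<Longrightarrow> exec (Cond b p q) s (t + 1) s'"
| CondFalse: "\<not> bval b s \<Longrightarrow> exec q s t s' \<Longrightarrow> exec (Cond b p q) s (t + 1) s'"
| WhileFalse: "\<not> bval b s \<Longrightarrow> exec (While b p) s 1 s"
| WhileTrue: "bval b s \<Longrightarrow> exec p s t s' \<Longrightarrow> exec (While b p) s' u s'' \<Longrightarrow>
    exec (While b p) s (t + u + 1) s''"

inductive_cases exec_SkipE: "exec Skip s t s'"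
inductive_cases exec_NAssignE: "exec (NAssign z e) s t s'"
inductive_cases exec_RAssignE: "exec (RAssign z e) s t s'"
inductive_cases exec_NArrAssignE: "exec (NArrAssign z i e) s t s'"
inductive_cases exec_RArrAssignE: "exec (RArrAssign z i e) s t s'"
inductive_cases exec_SeqE: "exec (Seq p q) s t s'"
inductive_cases exec_CondE: "exec (Cond b p q) s t s'"
inductive_cases exec_WhileE: "exec (While b p) s t s'"

lemma exec_deterministic:
  assumes "exec p s t s'" and "exec p s u s''"
  shows "u = t \<and> s'' = s'"
  using assms
proof (induction arbitrary: u s'' rule: exec.induct)
  case (Skip s)
  then show ?case by (auto elim: exec_SkipE)
next
  case (NAssign z e s)
  then show ?case by (auto elim: exec_NAssignE)
next
  case (RAssign z e s)
  then show ?case by (auto elim: exec_RAssignE)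
next
  case (NArrAssign z i e s)
  then show ?case by (auto elim: exec_NArrAssignE)
next
  case (RArrAssign z i e s)
  then show ?case by (auto elim: exec_RArrAssignE)
next
  case (Seq p s t s' q v s2)
  from Seq.prems show ?case
    by (rule exec_SeqE) (metis Seq.IH)
next
  case (CondTrue b s p t s' q)
  from CondTrue.prems show ?case
    by (rule exec_CondE) (use CondTrue.hyps CondTrue.IH in \<open>metis Suc_eq_plus1 One_nat_def\<close>)+
next
  case (CondFalse b s q t s' p)
  from CondFalse.prems show ?case
    by (rule exec_CondE) (use CondFalse.hyps CondFalse.IH in \<open>metis Suc_eq_plus1 One_nat_def\<close>)+
next
  case (WhileFalse b s p)
  from WhileFalse.prems show ?case
    by (rule exec_WhileE) (use WhileFalse.hyps in \<open>metis Suc_eq_plus1 One_nat_def\<close>)+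
next
  case (WhileTrue b s p t s' v s2)
  from WhileTrue.prems show ?case
    by (rule exec_WhileE) (use WhileTrue.hyps(1) WhileTrue.IH in \<open>metis Suc_eq_plus1 One_nat_def\<close>)+
qed

section \<open>Input and output of a recovery program\<close>

text \<open>The matrix is supplied in compressed sparse column format: the nonzero entries, as pairs of
  row index and value, listed column by column and by increasing row within a column. The entries
  of column \<open>j\<close> occupy the positions from \<open>col_start A j\<close> up to, excluding,
  \<open>col_start A (Suc j)\<close>.\<close>

definition column_entries :: "real mat \<Rightarrow> nat \<Rightarrow> (nat \<times> real) list" where
  "column_entries A j = map (\<lambda>i. (i, A $$ (i, j))) (filter (\<lambda>i. A $$ (i, j) \<noteq> 0) [0..<dim_row A])"

definition csc_entries :: "real mat \<Rightarrow> (nat \<times> real) list" where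
  "csc_entries A = concat (map (column_entries A) [0..<dim_col A])"

definition col_start :: "real mat \<Rightarrow> nat \<Rightarrow> nat" where
  "col_start A j = (\<Sum>i<j. length (column_entries A i))"

definition list_array :: "'a::zero list \<Rightarrow> nat \<Rightarrow> 'a" where
  "list_array xs i = (if i < length xs then xs ! i else 0)"

definition recovery_input :: "nat \<Rightarrow> real mat \<Rightarrow> real vec \<Rightarrow> store" where
  "recovery_input k A y = \<lparr>
     nvar = (\<lambda>_. 0)(''n'' := dim_col A, ''m'' := dim_row A, ''k'' := k),
     rvar = (\<lambda>_. 0),
     narr = (\<lambda>_ _. 0)(''start'' := list_array (map (col_start A) [0..<Suc (dim_col A)]),
                       ''row'' := list_array (map fst (csc_entries A))),
     rarr = (\<lambda>_ _. 0)(''val'' := list_array (map snd (csc_entries A)),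
                       ''y'' := list_array (list_of_vec y))\<rparr>"

definition recovers_within :: "com \<Rightarrow> nat \<Rightarrow> real mat \<Rightarrow> real vec \<Rightarrow> real \<Rightarrow> real vec \<Rightarrow> bool" where
  "recovers_within p k A y \<tau> x' \<longleftrightarrow>
     (\<exists>t s. exec p (recovery_input k A y) t s \<and> real t \<le> \<tau> \<and> x' = vec (dim_col A) (rarr s ''x''))"

end

theory Submission
  imports Defs "HOL-Probability.Product_PMF" "HOL-Library.Discrete_Functions" "HOL-Probability.Hoeffding"
begin

text \<open>The matrix has \<open>2 * L\<close> blocks of \<open>B = O(k)\<close> rows with \<open>L = O((c + 1) (1 + 1 / \<epsilon>\<^sup>2) log n)\<close>;
  each block hashes the coordinates into its rows with random signs. If \<open>\<theta>\<close> is the magnitude of the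
  \<open>k\<close>-th largest entry, the sub-Zipfian tail has energy \<open>O(k \<theta>\<^sup>2)\<close>, so in each block every coordinate
  is seen with error at most \<open>\<theta> / 4\<close> with probability \<open>15 / 16\<close>. Scanning the rows of the first half by
  decreasing magnitude and collecting the columns most of whose \<open>L\<close> rows have been met therefore yields a
  set \<open>S\<close> of \<open>O(k)\<close> columns containing the \<open>k\<close> largest.

  The second half is independent of \<open>S\<close>. Each \<open>i\<close> in \<open>S\<close> is estimated by the mean over the blocks
  in which it does not collide with the rest of \<open>S\<close>; the noise is then a sum of random signs with
  disjoint supports for distinct \<open>i\<close>, and the exponential moment of its square shows that the squared
  estimation error is \<open>O((c + 1) / L)\<close> times the energy outside \<open>S\<close>, up to probability \<open>k\<close> to the \<open>- (c + 2)\<close>.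
  Keeping the \<open>k\<close> largest estimates at most doubles the error. When \<open>L * B \<ge> n\<close>, two copies of the identity
  matrix are used instead.\<close>

unbundle no vec_syntax

section \<open>Verifying programs\<close>

text \<open>The target precision leaves no room for a further logarithm: bounding each estimate
  separately and taking a union bound over \<open>S\<close> would cost a factor of order log k. So
  the sum of squared errors is treated as one quadratic form in random signs. Its exponential moment
  may be taken at a rate governed by the largest noise energy of a single coordinate, not by the
  total. A Chernoff bound on the hashes brings that energy down to \<open>L * E / ln k\<close>, with
  \<open>E\<close> the energy outside \<open>S\<close>; the rate \<open>ln k / (8 * L * E)\<close>
  then turns a deviation of order \<open>(c + 3) * L * E\<close> into a probability k to the power
  -(c + 2).

  The running time shapes the selection. Instead of a median for every column, the at most
  \<open>n\<close> rows of the first half are sorted once, and it is counted how often each column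
  is met. No threshold is computed: the analysis fixes \<theta> afterwards and finds the heavy
  columns as a prefix of the list.

  Independence must hold for the set that the program really computes. It is obtained by
  noninterference: sorting and scanning only mention arrays that are filled from the first
  half.\<close>

definition runs :: "com \<Rightarrow> store \<Rightarrow> nat \<Rightarrow> (store \<Rightarrow> bool) \<Rightarrow> bool" where
  "runs p s T Q \<longleftrightarrow> (\<exists>t s'. exec p s t s' \<and> t \<le> T \<and> Q s')"

datatype var_kind = NV | RV | NA | RA

fun vars_written :: "com \<Rightarrow> (var_kind \<times> string) set" where
  "vars_written Skip = {}"
| "vars_written (NAssign z e) = {(NV, z)}"
| "vars_written (RAssign z e) = {(RV, z)}"
| "vars_written (NArrAssign z i e) = {(NA, z)}"
| "vars_written (RArrAssign z i e) = {(RA, z)}"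
| "vars_written (Seq p q) = vars_written p \<union> vars_written q"
| "vars_written (Cond b p q) = vars_written p \<union> vars_written q"
| "vars_written (While b p) = vars_written p"

definition agree_off :: "(var_kind \<times> string) set \<Rightarrow> store \<Rightarrow> store \<Rightarrow> bool" where
  "agree_off X s s' \<longleftrightarrow> (\<forall>z.
     ((NV, z) \<notin> X \<longrightarrow> nvar s' z = nvar s z) \<and> ((RV, z) \<notin> X \<longrightarrow> rvar s' z = rvar s z) \<and>
     ((NA, z) \<notin> X \<longrightarrow> narr s' z = narr s z) \<and> ((RA, z) \<notin> X \<longrightarrow> rarr s' z = rarr s z))"

lemma agree_offD:
  assumes "agree_off X s s'"
  shows "(NV, z) \<notin> X \<Longrightarrow> nvar s' z = nvar s z" "(RV, z) \<notin> X \<Longrightarrow> rvar s' z = rvar s z"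
    "(NA, z) \<notin> X \<Longrightarrow> narr s' z = narr s z" "(RA, z) \<notin> X \<Longrightarrow> rarr s' z = rarr s z"
  using assms by (auto simp: agree_off_def)

lemma agree_off_refl: "agree_off X s s"
  by (simp add: agree_off_def)

lemma agree_off_trans: "agree_off X s s' \<Longrightarrow> agree_off X s' s'' \<Longrightarrow> agree_off X s s''"
  by (simp add: agree_off_def)

lemma exec_agree_off: "exec p s t s' \<Longrightarrow> agree_off (vars_written p) s s'"
  by (induction rule: exec.induct) (simp_all add: agree_off_def)

text \<open>The frame fact is handed to the consequent for free, so postconditions need only speak
  of variables that the program changes.\<close>

lemma runs_mono:
  assumes "runs p s T Q" "T \<le> U" "\<And>s'. Q s' \<Longrightarrow> agree_off (vars_written p) s s' \<Longrightarrow> R s'"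
  shows "runs p s U R"
  using assms exec_agree_off unfolding runs_def by (meson le_trans)

lemma runs_Seq:
  assumes "runs p s T Q"
    and "\<And>s'. Q s' \<Longrightarrow> agree_off (vars_written p) s s' \<Longrightarrow> runs q s' U R"
  shows "runs (Seq p q) s (T + U) R"
proof -
  obtain t s' where 1: "exec p s t s'" "t \<le> T" "Q s'"
    using assms(1) unfolding runs_def by blast
  obtain u s'' where 2: "exec q s' u s''" "u \<le> U" "R s''"
    using assms(2)[OF 1(3) exec_agree_off[OF 1(1)]] unfolding runs_def by blast
  show ?thesis
    unfolding runs_def using exec.Seq[OF 1(1) 2(1)] 1 2 add_mono by blast
qed

lemma runs_Seq':
  assumes "runs p s T Q"
    and "\<And>s'. Q s' \<Longrightarrow> agree_off (vars_written p) s s' \<Longrightarrow> runs q s' U R"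
    and "T + U \<le> V"
  shows "runs (Seq p q) s V R"
  using runs_Seq[OF assms(1,2)] assms(3) runs_mono by blast

section \<open>Loop-free programs, executed symbolically\<close>

fun straight :: "com \<Rightarrow> bool" where
  "straight (Seq p q) \<longleftrightarrow> straight p \<and> straight q"
| "straight (Cond b p q) \<longleftrightarrow> straight p \<and> straight q"
| "straight (While b p) \<longleftrightarrow> False"
| "straight _ \<longleftrightarrow> True"

fun straight_result :: "com \<Rightarrow> store \<Rightarrow> store" where
  "straight_result (NAssign z e) s = s\<lparr>nvar := (nvar s)(z := nval e s)\<rparr>"
| "straight_result (RAssign z e) s = s\<lparr>rvar := (rvar s)(z := rval e s)\<rparr>"
| "straight_result (NArrAssign z i e) s =
    s\<lparr>narr := (narr s)(z := (narr s z)(nval i s := nval e s))\<rparr>"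
| "straight_result (RArrAssign z i e) s =
    s\<lparr>rarr := (rarr s)(z := (rarr s z)(nval i s := rval e s))\<rparr>"
| "straight_result (Seq p q) s = straight_result q (straight_result p s)"
| "straight_result (Cond b p q) s = (if bval b s then straight_result p s else straight_result q s)"
| "straight_result _ s = s"

text \<open>Both branches of a conditional are charged, which makes the bound independent of the
  store.\<close>

fun straight_time :: "com \<Rightarrow> nat" where
  "straight_time (Seq p q) = straight_time p + straight_time q"
| "straight_time (Cond b p q) = straight_time p + straight_time q + 1"
| "straight_time _ = 1"

lemma exec_straight:
  "straight p \<Longrightarrow> \<exists>t\<le>straight_time p. exec p s t (straight_result p s)"
proof (induction p arbitrary: s)
  case (Seq p q)
  then obtain t u where "t \<le> straight_time p" "exec p s t (straight_result p s)"
    "u \<le> straight_time q" "exec q (straight_result p s) u (straight_result (Seq p q) s)"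
    by fastforce
  then show ?case using exec.Seq add_mono by (metis straight_time.simps(1))
next
  case (Cond b p q)
  show ?case
  proof (cases "bval b s")
    case True
    obtain t where "t \<le> straight_time p" "exec p s t (straight_result p s)"
      using Cond by fastforce
    then show ?thesis using exec.CondTrue[OF True] True
      by (intro exI[of _ "t + 1"]) auto
  next
    case False
    obtain t where "t \<le> straight_time q" "exec q s t (straight_result q s)"
      using Cond by fastforce
    then show ?thesis using exec.CondFalse[OF False] False
      by (intro exI[of _ "t + 1"]) auto
  qed
qed (auto intro!: exI[of _ 1] exec.Skip exec.NAssign exec.RAssign exec.NArrAssign exec.RArrAssign
     simp del: One_nat_def)

lemma runs_straight:
  assumes "straight p" "straight_time p \<le> T" "Q (straight_result p s)"
  shows "runs p s T Q"
  using exec_straight[OF assms(1), of s] assms(2,3) unfolding runs_def by (meson le_trans)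

text \<open>One measure serves termination and cost. To get additive bounds from it, the nested
  traversals of the matrix below are written as single loops whose body is a conditional, with a
  potential that drops in either branch.\<close>

lemma runs_While:
  fixes \<mu> :: "store \<Rightarrow> nat"
  assumes "I s"
    and "\<And>s'. I s' \<Longrightarrow> agree_off (vars_written p) s s' \<Longrightarrow> bval b s' \<Longrightarrow>
       runs p s' c (\<lambda>s''. I s'' \<and> \<mu> s'' < \<mu> s')"
  shows "runs (While b p) s (\<mu> s * (c + 1) + 1)
    (\<lambda>s'. I s' \<and> \<not> bval b s' \<and> agree_off (vars_written p) s s')"
proof -
  have "runs (While b p) s' (\<mu> s' * (c + 1) + 1)
    (\<lambda>s''. I s'' \<and> \<not> bval b s'' \<and> agree_off (vars_written p) s s'')"
    if "I s'" "agree_off (vars_written p) s s'" for s'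
    using that
  proof (induction "\<mu> s'" arbitrary: s' rule: less_induct)
    case less
    show ?case
    proof (cases "bval b s'")
      case False
      then show ?thesis unfolding runs_def
        using exec.WhileFalse[OF False] less.prems by (intro exI[of _ 1] exI[of _ s']) auto
    next
      case True
      obtain t s1 where 1: "exec p s' t s1" "t \<le> c" "I s1" "\<mu> s1 < \<mu> s'"
        using assms(2)[OF less.prems True] unfolding runs_def by blast
      have a: "agree_off (vars_written p) s s1"
        using exec_agree_off[OF 1(1)] less.prems(2) agree_off_trans by blast
      obtain u s2 where 2: "exec (While b p) s1 u s2" "u \<le> \<mu> s1 * (c + 1) + 1"
        "I s2" "\<not> bval b s2" "agree_off (vars_written p) s s2"
        using less.hyps[OF 1(4) 1(3) a] unfolding runs_def by blast
      have "t + u + 1 \<le> Suc (\<mu> s1) * (c + 1) + 1"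
        using 1(2) 2(2) by simp
      also have "\<dots> \<le> \<mu> s' * (c + 1) + 1"
        using 1(4) by (intro add_mono mult_mono) auto
      finally show ?thesis
        unfolding runs_def using exec.WhileTrue[OF True 1(1) 2(1)] 2(3-5) by blast
    qed
  qed
  then show ?thesis using assms(1) agree_off_refl by blast
qed

section \<open>Noninterference: a run depends only on the variables that the program
  mentions\<close>

fun nexp_vars :: "nexp \<Rightarrow> string set" where
  "nexp_vars (NConst v) = {}"
| "nexp_vars (NVar z) = {z}"
| "nexp_vars (NArr z e) = insert z (nexp_vars e)"
| "nexp_vars (NAdd e f) = nexp_vars e \<union> nexp_vars f"
| "nexp_vars (NSub e f) = nexp_vars e \<union> nexp_vars f"

fun rexp_vars :: "rexp \<Rightarrow> string set" where
  "rexp_vars (RConst v) = {}"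
| "rexp_vars (RVar z) = {z}"
| "rexp_vars (RArr z e) = insert z (nexp_vars e)"
| "rexp_vars (RAdd e f) = rexp_vars e \<union> rexp_vars f"
| "rexp_vars (RSub e f) = rexp_vars e \<union> rexp_vars f"
| "rexp_vars (RMul e f) = rexp_vars e \<union> rexp_vars f"
| "rexp_vars (RDiv e f) = rexp_vars e \<union> rexp_vars f"

fun bexp_vars :: "bexp \<Rightarrow> string set" where
  "bexp_vars (NLess e f) = nexp_vars e \<union> nexp_vars f"
| "bexp_vars (RLess e f) = rexp_vars e \<union> rexp_vars f"
| "bexp_vars (BNot b) = bexp_vars b"
| "bexp_vars (BAnd b d) = bexp_vars b \<union> bexp_vars d"

fun com_vars :: "com \<Rightarrow> string set" where
  "com_vars Skip = {}"
| "com_vars (NAssign z e) = insert z (nexp_vars e)"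
| "com_vars (RAssign z e) = insert z (rexp_vars e)"
| "com_vars (NArrAssign z i e) = insert z (nexp_vars i \<union> nexp_vars e)"
| "com_vars (RArrAssign z i e) = insert z (nexp_vars i \<union> rexp_vars e)"
| "com_vars (Seq p q) = com_vars p \<union> com_vars q"
| "com_vars (Cond b p q) = bexp_vars b \<union> com_vars p \<union> com_vars q"
| "com_vars (While b p) = bexp_vars b \<union> com_vars p"

definition clear_off :: "string set \<Rightarrow> store \<Rightarrow> store" where
  "clear_off X s = \<lparr>nvar = (\<lambda>z. if z \<in> X then nvar s z else 0),
     rvar = (\<lambda>z. if z \<in> X then rvar s z else 0),
     narr = (\<lambda>z. if z \<in> X then narr s z else (\<lambda>_. 0)),
     rarr = (\<lambda>z. if z \<in> X then rarr s z else (\<lambda>_. 0))\<rparr>"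

lemma clear_off_simps:
  "nvar (clear_off X s) z = (if z \<in> X then nvar s z else 0)"
  "rvar (clear_off X s) z = (if z \<in> X then rvar s z else 0)"
  "narr (clear_off X s) z = (if z \<in> X then narr s z else (\<lambda>_. 0))"
  "rarr (clear_off X s) z = (if z \<in> X then rarr s z else (\<lambda>_. 0))"
  by (simp_all add: clear_off_def)

lemma nval_clear_off: "nexp_vars e \<subseteq> X \<Longrightarrow> nval e (clear_off X s) = nval e s"
  by (induction e) (auto simp: clear_off_simps)

lemma rval_clear_off: "rexp_vars e \<subseteq> X \<Longrightarrow> rval e (clear_off X s) = rval e s"
  by (induction e) (auto simp: clear_off_simps nval_clear_off)

lemma bval_clear_off: "bexp_vars b \<subseteq> X \<Longrightarrow> bval b (clear_off X s) = bval b s"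
  by (induction b) (auto simp: nval_clear_off rval_clear_off)

lemma clear_off_update:
  assumes "z \<in> X"
  shows "clear_off X (s\<lparr>nvar := (nvar s)(z := v)\<rparr>) =
      (clear_off X s)\<lparr>nvar := (nvar (clear_off X s))(z := v)\<rparr>"
    "clear_off X (s\<lparr>rvar := (rvar s)(z := w)\<rparr>) =
      (clear_off X s)\<lparr>rvar := (rvar (clear_off X s))(z := w)\<rparr>"
    "clear_off X (s\<lparr>narr := (narr s)(z := (narr s z)(i := v))\<rparr>) =
      (clear_off X s)\<lparr>narr := (narr (clear_off X s))(z := (narr (clear_off X s) z)(i := v))\<rparr>"
    "clear_off X (s\<lparr>rarr := (rarr s)(z := (rarr s z)(i := w))\<rparr>) =
      (clear_off X s)\<lparr>rarr := (rarr (clear_off X s))(z := (rarr (clear_off X s) z)(i := w))\<rparr>"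
  using assms by (auto simp: clear_off_def fun_eq_iff)

text \<open>A run neither reads nor writes an unmentioned variable, so it can be replayed, step for
  step, on a store in which these are zero. This is what later makes the selected columns a function
  of the first half of the measurements alone.\<close>

lemma exec_clear_off:
  "exec p s t s' \<Longrightarrow> com_vars p \<subseteq> X \<Longrightarrow> exec p (clear_off X s) t (clear_off X s')"
proof (induction rule: exec.induct)
  case (Skip s)
  show ?case by (rule exec.Skip)
next
  case (NAssign z e s)
  then show ?case using exec.NAssign[of z e "clear_off X s"]
    by (simp add: clear_off_update nval_clear_off)
next
  case (RAssign z e s)
  then show ?case using exec.RAssign[of z e "clear_off X s"]
    by (simp add: clear_off_update rval_clear_off)
next
  case (NArrAssign z i e s)
  then show ?case using exec.NArrAssign[of z i e "clear_off X s"]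
    by (simp add: clear_off_update nval_clear_off)
next
  case (RArrAssign z i e s)
  then show ?case using exec.RArrAssign[of z i e "clear_off X s"]
    by (simp add: clear_off_update rval_clear_off nval_clear_off)
next
  case Seq
  then show ?case by (auto intro: exec.Seq)
next
  case CondTrue
  then show ?case
    by (auto intro!: exec.CondTrue simp: bval_clear_off simp del: add_Suc_right One_nat_def)
next
  case CondFalse
  then show ?case
    by (auto intro!: exec.CondFalse simp: bval_clear_off simp del: add_Suc_right One_nat_def)
next
  case WhileFalse
  then show ?case by (auto intro!: exec.WhileFalse simp: bval_clear_off simp del: One_nat_def)
next
  case (WhileTrue b s p t s' u s'')
  then show ?case using exec.WhileTrue[of b "clear_off X s" p t "clear_off X s'" u "clear_off X s''"]
    by (simp add: bval_clear_off)
qed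

section \<open>Sorting with a tournament tree\<close>

text \<open>Node \<open>v\<close> has the children \<open>2 * v\<close> and \<open>2 * v + 1\<close>; node \<open>N + j\<close> is the leaf of item \<open>j\<close>.\<close>

definition wins :: "(nat \<Rightarrow> real) \<Rightarrow> (nat \<Rightarrow> nat) \<Rightarrow> nat \<Rightarrow> bool" where
  "wins key w v \<longleftrightarrow> w v \<in> {w (2 * v), w (2 * v + 1)} \<and>
     key (w (2 * v)) \<le> key (w v) \<and> key (w (2 * v + 1)) \<le> key (w v)"

definition better :: "(nat \<Rightarrow> real) \<Rightarrow> (nat \<Rightarrow> nat) \<Rightarrow> nat \<Rightarrow> nat" where
  "better key w v = (if key (w (2 * v)) < key (w (2 * v + 1)) then w (2 * v + 1) else w (2 * v))"

lemma wins_better: "1 \<le> v \<Longrightarrow> wins key (w(v := better key w v)) v"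
  by (auto simp: wins_def better_def)

lemma wins_upd_other: "u \<noteq> v \<Longrightarrow> u \<noteq> v div 2 \<Longrightarrow> wins key (w(v := a)) u = wins key w u"
  by (auto simp: wins_def)

text \<open>Descending along the child that supplied the winner ends at the winner's own leaf; so a
  node can hold only items whose leaf lies below it. This confines the damage of changing one key to
  a single path to the root.\<close>

lemma wins_leaf:
  assumes "\<forall>j<N. w (N + j) = j" "\<forall>v\<in>{1..<N}. wins key w v" "1 \<le> u" "u < 2 * N"
  shows "w u < N \<and> (\<exists>i. u = (N + w u) div 2 ^ i)"
  using assms(3,4)
proof (induction "2 * N - u" arbitrary: u rule: less_induct)
  case less
  show ?case
  proof (cases "N \<le> u")
    case True
    then have "w u = u - N" using assms(1) less.prems
      by (metis le_add_diff_inverse less_diff_conv2 mult_2)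
    then show ?thesis using True less.prems by (auto intro!: exI[of _ 0])
  next
    case False
    then have "wins key w u" using assms(2) less.prems by auto
    then obtain u' where u': "u' = 2 * u \<or> u' = 2 * u + 1" "w u = w u'"
      by (auto simp: wins_def)
    have "w u' < N \<and> (\<exists>i. u' = (N + w u') div 2 ^ i)"
      using less.hyps[of u'] u' False less.prems by auto
    then obtain i where i: "w u' < N" "u' = (N + w u') div 2 ^ i" by blast
    have "u = u' div 2" using u' by auto
    also have "\<dots> = (N + w u) div 2 ^ (Suc i)"
      using i(2) u'(2) div_mult2_eq[of "N + w u" "2 ^ i" 2] by (metis mult.commute power_Suc)
    finally show ?thesis using i u' by metis
  qed
qed

lemma wins_root_max:
  assumes "\<forall>v\<in>{1..<N}. wins key w v" "1 \<le> u" "u < 2 * N"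
  shows "key (w u) \<le> key (w 1)"
  using assms(2,3)
proof (induction u rule: less_induct)
  case (less u)
  show ?case
  proof (cases "u = 1")
    case False
    then have "1 \<le> u div 2" "u div 2 < N" "u div 2 < u" using less.prems by auto
    then have "key (w (u div 2)) \<le> key (w 1)" "wins key w (u div 2)"
      using less.IH[of "u div 2"] assms(1) by auto
    moreover have "u = 2 * (u div 2) \<or> u = 2 * (u div 2) + 1" by linarith
    ultimately show ?thesis unfolding wins_def by (metis order_trans)
  qed simp
qed

section \<open>The tournament tree as a program\<close>

definition tree_update :: com where
  "tree_update =
    Cond (RLess (RArr ''key'' (NArr ''win'' (NAdd (NVar ''v'') (NVar ''v''))))
                (RArr ''key'' (NArr ''win'' (NAdd (NAdd (NVar ''v'') (NVar ''v'')) (NConst 1)))))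
      (NArrAssign ''win'' (NVar ''v'') (NArr ''win'' (NAdd (NAdd (NVar ''v'') (NVar ''v'')) (NConst 1))))
      (NArrAssign ''win'' (NVar ''v'') (NArr ''win'' (NAdd (NVar ''v'') (NVar ''v''))))"

lemma tree_update_simps [simp]:
  "straight tree_update" "straight_time tree_update = 3" "vars_written tree_update = {(NA, ''win'')}"
  "straight_result tree_update s = s\<lparr>narr := (narr s)(''win'' := (narr s ''win'')
     (nvar s ''v'' := better (rarr s ''key'') (narr s ''win'') (nvar s ''v'')))\<rparr>"
  by (simp_all add: tree_update_def better_def mult_2)

text \<open>Parents are looked up in the array \<open>par\<close>, since the machine cannot halve an
  index.\<close>

definition tree_climb :: com where
  "tree_climb = While (NLess (NConst 1) (NVar ''v''))
     (Seq (NAssign ''v'' (NArr ''par'' (NVar ''v''))) tree_update)"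

text \<open>The invariant allows the tournament condition to fail only at proper ancestors of the
  current node. Each round moves up one level and repairs the node reached; at the root no proper
  ancestor with a positive index is left.\<close>

lemma runs_tree_climb:
  assumes N: "nvar s ''N'' = N" and key: "rarr s ''key'' = key"
    and par: "\<forall>u\<in>{1..<N}. narr s ''par'' (2 * u) = u \<and> narr s ''par'' (2 * u + 1) = u"
    and leaf: "\<forall>j<N. narr s ''win'' (N + j) = j"
    and v: "1 \<le> nvar s ''v''" "nvar s ''v'' < 2 * N"
    and tree: "\<forall>u\<in>{1..<N}. wins key (narr s ''win'') u \<or> (\<exists>i\<ge>1. u = nvar s ''v'' div 2 ^ i)"
  shows "runs tree_climb s (floor_log (nvar s ''v'') * 5 + 1)
    (\<lambda>s'. (\<forall>j<N. narr s' ''win'' (N + j) = j) \<and> (\<forall>u\<in>{1..<N}. wins key (narr s' ''win'') u))"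
proof -
  define I where "I s' \<longleftrightarrow> 1 \<le> nvar s' ''v'' \<and> nvar s' ''v'' < 2 * N \<and>
    (\<forall>j<N. narr s' ''win'' (N + j) = j) \<and>
    (\<forall>u\<in>{1..<N}. wins key (narr s' ''win'') u \<or> (\<exists>i\<ge>1. u = nvar s' ''v'' div 2 ^ i))" for s' :: store
  have "runs tree_climb s (floor_log (nvar s ''v'') * (4 + 1) + 1)
     (\<lambda>s'. I s' \<and> \<not> bval (NLess (NConst 1) (NVar ''v'')) s' \<and>
       agree_off (vars_written (Seq (NAssign ''v'' (NArr ''par'' (NVar ''v''))) tree_update)) s s')"
    unfolding tree_climb_def
  proof (rule runs_While[where \<mu> = "\<lambda>s. floor_log (nvar s ''v'')"])
    show "I s" using assms by (simp add: I_def)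
    fix s' :: store assume I: "I s'"
      and ag: "agree_off (vars_written (Seq (NAssign ''v'' (NArr ''par'' (NVar ''v''))) tree_update)) s s'"
      and b: "bval (NLess (NConst 1) (NVar ''v'')) s'"
    note fr = agree_offD[OF ag]
    have fr': "narr s' ''par'' = narr s ''par''" "rarr s' ''key'' = key"
      using fr[of "''par''"] fr[of "''key''"] key by simp_all
    define v where "v = nvar s' ''v''"
    define w where "w = narr s' ''win''"
    have v: "1 < v" "v < 2 * N" using I b by (auto simp: I_def v_def)
    define v' where "v' = v div 2"
    have v': "1 \<le> v'" "v' < N" "v = 2 * v' \<or> v = 2 * v' + 1" using v by (auto simp: v'_def)
    have p: "narr s' ''par'' v = v'" using par v' fr'(1) by auto
    have leaf': "\<forall>j<N. w (N + j) = j" using I by (simp add: I_def w_def)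
    have tr: "wins key w u \<or> (\<exists>i\<ge>1. u = v div 2 ^ i)" if "u \<in> {1..<N}" for u
      using I that by (simp add: I_def v_def w_def)
    have tr': "wins key (w(v' := better key w v')) u \<or> (\<exists>i\<ge>1. u = v' div 2 ^ i)"
      if u: "u \<in> {1..<N}" for u
    proof -
      consider "u = v'" | "u = v' div 2" | "u \<noteq> v'" "u \<noteq> v' div 2" by blast
      then show ?thesis
      proof cases
        case 1
        then show ?thesis using wins_better v'(1) by blast
      next
        case 2
        then have "u = v' div 2 ^ 1" by simp
        then show ?thesis by blast
      next
        case 3
        show ?thesis
        proof (cases "wins key w u")
          case True
          then show ?thesis using wins_upd_other 3 by blast
        next
          case False
          then obtain i where i: "i \<ge> 1" "u = v div 2 ^ i" using tr[OF u] by blast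
          then have "u = v' div 2 ^ (i - 1)"
            using div_mult2_eq[of v 2 "2 ^ (i - 1)"] by (metis Suc_diff_1 less_eq_Suc_le One_nat_def power_Suc v'_def)
          moreover have "i - 1 \<ge> 1" using calculation 3 i by (cases "i - 1") auto
          ultimately show ?thesis by blast
        qed
      qed
    qed
    have lg: "floor_log v' < floor_log v" using floor_log_rec[of v] v by (simp add: v'_def)
    show "runs (Seq (NAssign ''v'' (NArr ''par'' (NVar ''v''))) tree_update) s' 4
       (\<lambda>s''. I s'' \<and> floor_log (nvar s'' ''v'') < floor_log (nvar s' ''v''))"
      by (rule runs_straight)
        (use v' v p leaf' tr' lg in \<open>auto simp: I_def v_def[symmetric] w_def[symmetric] fr'(2)\<close>)
  qed
  then show ?thesis
  proof (rule runs_mono)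
    fix s' :: store assume a: "I s' \<and> \<not> bval (NLess (NConst 1) (NVar ''v'')) s' \<and>
       agree_off (vars_written (Seq (NAssign ''v'' (NArr ''par'' (NVar ''v''))) tree_update)) s s'"
    then have v1: "nvar s' ''v'' = 1" by (auto simp: I_def)
    have "\<not> (\<exists>i\<ge>1. u = (1::nat) div 2 ^ i)" if "1 \<le> u" for u
    proof -
      have "(1::nat) div 2 ^ i = 0" if "i \<ge> 1" for i
        using that one_less_power[of "2::nat" i] by simp
      then show ?thesis using that by (metis not_one_le_zero)
    qed
    then show "(\<forall>j<N. narr s' ''win'' (N + j) = j) \<and> (\<forall>u\<in>{1..<N}. wins key (narr s' ''win'') u)"
      using a v1 unfolding I_def by (metis atLeastLessThan_iff)
  qed simp
qed

definition tree_leaves :: com where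
  "tree_leaves = Seq (NAssign ''v'' (NConst 0)) (While (NLess (NVar ''v'') (NVar ''N''))
     (Seq (NArrAssign ''win'' (NAdd (NVar ''N'') (NVar ''v'')) (NVar ''v''))
       (NAssign ''v'' (NAdd (NVar ''v'') (NConst 1)))))"

lemma runs_tree_leaves:
  assumes N: "nvar s ''N'' = N"
  shows "runs tree_leaves s (N * 3 + 2) (\<lambda>s'. \<forall>j<N. narr s' ''win'' (N + j) = j)"
  unfolding tree_leaves_def
proof (rule runs_Seq'[where Q = "\<lambda>s'. nvar s' ''v'' = 0 \<and> nvar s' ''N'' = N" and T = 1])
  show "runs (NAssign ''v'' (NConst 0)) s 1 (\<lambda>s'. nvar s' ''v'' = 0 \<and> nvar s' ''N'' = N)"
    by (rule runs_straight) (simp_all add: N)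
  fix s0 :: store assume s0: "nvar s0 ''v'' = 0 \<and> nvar s0 ''N'' = N"
  let ?p = "Seq (NArrAssign ''win'' (NAdd (NVar ''N'') (NVar ''v'')) (NVar ''v''))
       (NAssign ''v'' (NAdd (NVar ''v'') (NConst 1)))"
  let ?b = "NLess (NVar ''v'') (NVar ''N'')"
  define I where "I s' \<longleftrightarrow> nvar s' ''N'' = N \<and> nvar s' ''v'' \<le> N \<and>
    (\<forall>j<nvar s' ''v''. narr s' ''win'' (N + j) = j)" for s' :: store
  have "runs (While ?b ?p) s0 ((N - nvar s0 ''v'') * (2 + 1) + 1)
     (\<lambda>s'. I s' \<and> \<not> bval ?b s' \<and> agree_off (vars_written ?p) s0 s')"
  proof (rule runs_While[where \<mu> = "\<lambda>s. N - nvar s ''v''"])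
    show "I s0" using s0 by (simp add: I_def)
    fix s' :: store assume "I s'" "bval ?b s'"
    then show "runs ?p s' 2 (\<lambda>s''. I s'' \<and> N - nvar s'' ''v'' < N - nvar s' ''v'')"
      by (intro runs_straight) (auto simp: I_def less_Suc_eq)
  qed
  then show "runs (While ?b ?p) s0 (N * 3 + 1) (\<lambda>s'. \<forall>j<N. narr s' ''win'' (N + j) = j)"
    by (rule runs_mono) (use s0 in \<open>auto simp: I_def\<close>)
qed simp

text \<open>With descending indices both children are final when their parent is computed.\<close>

definition tree_build :: com where
  "tree_build = Seq (NAssign ''v'' (NVar ''N'')) (While (NLess (NConst 1) (NVar ''v''))
     (Seq (NAssign ''v'' (NSub (NVar ''v'') (NConst 1)))
     (Seq tree_update
     (Seq (NArrAssign ''par'' (NAdd (NVar ''v'') (NVar ''v'')) (NVar ''v''))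
       (NArrAssign ''par'' (NAdd (NAdd (NVar ''v'') (NVar ''v'')) (NConst 1)) (NVar ''v''))))))"

lemma runs_tree_build:
  assumes N: "nvar s ''N'' = N" "1 \<le> N" and key: "rarr s ''key'' = key"
    and leaf: "\<forall>j<N. narr s ''win'' (N + j) = j"
  shows "runs tree_build s (N * 7 + 2) (\<lambda>s'. (\<forall>j<N. narr s' ''win'' (N + j) = j) \<and>
    (\<forall>u\<in>{1..<N}. wins key (narr s' ''win'') u \<and>
       narr s' ''par'' (2 * u) = u \<and> narr s' ''par'' (2 * u + 1) = u))"
  unfolding tree_build_def
proof (rule runs_Seq'[where Q = "\<lambda>s'. nvar s' ''v'' = N \<and> rarr s' ''key'' = key \<and>
     (\<forall>j<N. narr s' ''win'' (N + j) = j)" and T = 1])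
  show "runs (NAssign ''v'' (NVar ''N'')) s 1 (\<lambda>s'. nvar s' ''v'' = N \<and> rarr s' ''key'' = key \<and>
     (\<forall>j<N. narr s' ''win'' (N + j) = j))"
    by (rule runs_straight) (use assms in simp_all)
  fix s0 :: store assume s0: "nvar s0 ''v'' = N \<and> rarr s0 ''key'' = key \<and> (\<forall>j<N. narr s0 ''win'' (N + j) = j)"
  let ?p = "Seq (NAssign ''v'' (NSub (NVar ''v'') (NConst 1)))
     (Seq tree_update
     (Seq (NArrAssign ''par'' (NAdd (NVar ''v'') (NVar ''v'')) (NVar ''v''))
       (NArrAssign ''par'' (NAdd (NAdd (NVar ''v'') (NVar ''v'')) (NConst 1)) (NVar ''v''))))"
  let ?b = "NLess (NConst 1) (NVar ''v'')"
  define I where "I s' \<longleftrightarrow> rarr s' ''key'' = key \<and> 1 \<le> nvar s' ''v'' \<and> nvar s' ''v'' \<le> N \<and>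
    (\<forall>j<N. narr s' ''win'' (N + j) = j) \<and>
    (\<forall>u\<in>{nvar s' ''v''..<N}. wins key (narr s' ''win'') u \<and>
       narr s' ''par'' (2 * u) = u \<and> narr s' ''par'' (2 * u + 1) = u)" for s' :: store
  have "runs (While ?b ?p) s0 (nvar s0 ''v'' * (6 + 1) + 1)
     (\<lambda>s'. I s' \<and> \<not> bval ?b s' \<and> agree_off (vars_written ?p) s0 s')"
  proof (rule runs_While[where \<mu> = "\<lambda>s. nvar s ''v''"])
    show "I s0" using s0 N by (simp add: I_def)
    fix s' :: store assume I: "I s'" and b: "bval ?b s'"
    define v where "v = nvar s' ''v'' - 1"
    define w where "w = narr s' ''win''"
    define r where "r = narr s' ''par''"
    have v: "1 \<le> v" "v < N" "nvar s' ''v'' = Suc v" using I b by (auto simp: I_def v_def)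
    have k: "rarr s' ''key'' = key" and lf: "\<And>j. j < N \<Longrightarrow> w (N + j) = j" using I by (auto simp: I_def w_def)
    have tr: "wins key w u \<and> r (2 * u) = u \<and> r (2 * u + 1) = u" if "Suc v \<le> u" "u < N" for u
      using I that v by (auto simp: I_def w_def r_def)
    have tr': "wins key (w(v := better key w v)) u" if "v \<le> u" "u < N" for u
      using wins_better[OF v(1)] tr[of u] that v wins_upd_other[of u v key w "better key w v"]
      by (cases "u = v") auto
    have pr: "(r(2 * v := v, Suc (2 * v) := v)) (2 * u) = u \<and> (r(2 * v := v, Suc (2 * v) := v)) (Suc (2 * u)) = u"
      if "v \<le> u" "u < N" for u
    proof (cases "u = v")
      case False
      then have "2 * u \<noteq> Suc (2 * v)" "Suc (2 * u) \<noteq> 2 * v" by presburger+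
      then show ?thesis using tr[of u] that False by simp
    qed simp
    show "runs ?p s' 6 (\<lambda>s''. I s'' \<and> nvar s'' ''v'' < nvar s' ''v'')"
      by (rule runs_straight)
        (use v k lf tr' pr in \<open>simp_all add: I_def w_def[symmetric] r_def[symmetric] mult_2[symmetric]\<close>)
  qed
  then show "runs (While ?b ?p) s0 (N * 7 + 1) (\<lambda>s'. (\<forall>j<N. narr s' ''win'' (N + j) = j) \<and>
    (\<forall>u\<in>{1..<N}. wins key (narr s' ''win'') u \<and>
       narr s' ''par'' (2 * u) = u \<and> narr s' ''par'' (2 * u + 1) = u))"
    by (rule runs_mono) (use s0 in \<open>auto simp: I_def\<close>)
qed simp

text \<open>The key -1 marks an extracted item. It loses against all items still present because
  sorting is only applied to nonnegative keys; this is one reason for sorting by squares.\<close>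

definition tree_pop :: com where
  "tree_pop = Seq (NAssign ''j'' (NArr ''win'' (NConst 1)))
     (Seq (NArrAssign ''ord'' (NVar ''t'') (NVar ''j''))
     (Seq (RArrAssign ''key'' (NVar ''j'') (RConst (-1)))
     (NAssign ''v'' (NAdd (NVar ''N'') (NVar ''j'')))))"

definition tree_extract :: com where
  "tree_extract = Seq tree_pop (Seq tree_climb (NAssign ''t'' (NAdd (NVar ''t'') (NConst 1))))"

definition sort_prog :: com where
  "sort_prog = Seq tree_leaves (Seq tree_build (Seq (NAssign ''t'' (NConst 0))
     (While (NLess (NVar ''t'') (NVar ''N'')) tree_extract)))"

lemma vars_written_tree [simp]:
  "vars_written tree_leaves = {(NV, ''v''), (NA, ''win'')}"
  "vars_written tree_climb = {(NV, ''v''), (NA, ''win'')}"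
  "vars_written tree_build = {(NV, ''v''), (NA, ''win''), (NA, ''par'')}"
  "vars_written tree_pop = {(NV, ''j''), (NA, ''ord''), (RA, ''key''), (NV, ''v'')}"
  "vars_written tree_extract = {(NV, ''j''), (NA, ''ord''), (RA, ''key''), (NV, ''v''), (NA, ''win''), (NV, ''t'')}"
  "vars_written sort_prog = {(NV, ''j''), (NA, ''ord''), (RA, ''key''), (NV, ''v''), (NA, ''win''), (NV, ''t''), (NA, ''par'')}"
  by (auto simp: tree_leaves_def tree_climb_def tree_build_def tree_pop_def tree_extract_def sort_prog_def)

definition sort_inv :: "nat \<Rightarrow> (nat \<Rightarrow> real) \<Rightarrow> store \<Rightarrow> bool" where
  "sort_inv N key0 s \<longleftrightarrow> nvar s ''N'' = N \<and> nvar s ''t'' \<le> N \<and>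
     inj_on (narr s ''ord'') {..<nvar s ''t''} \<and> narr s ''ord'' ` {..<nvar s ''t''} \<subseteq> {..<N} \<and>
     (\<forall>j<N. rarr s ''key'' j = (if j \<in> narr s ''ord'' ` {..<nvar s ''t''} then -1 else key0 j)) \<and>
     (\<forall>j<N. j \<notin> narr s ''ord'' ` {..<nvar s ''t''} \<longrightarrow>
        (\<forall>u<nvar s ''t''. key0 j \<le> key0 (narr s ''ord'' u))) \<and>
     (\<forall>u t. u \<le> t \<longrightarrow> t < nvar s ''t'' \<longrightarrow> key0 (narr s ''ord'' t) \<le> key0 (narr s ''ord'' u)) \<and>
     (\<forall>j<N. narr s ''win'' (N + j) = j) \<and>
     (\<forall>u\<in>{1..<N}. wins (rarr s ''key'') (narr s ''win'') u) \<and>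
     (\<forall>u\<in>{1..<N}. narr s ''par'' (2 * u) = u \<and> narr s ''par'' (2 * u + 1) = u)"

lemma runs_tree_extract:
  assumes I: "sort_inv N key0 s" and t: "nvar s ''t'' < N" and pos: "\<forall>j<N. 0 \<le> key0 j"
  shows "runs tree_extract s (floor_log (2 * N) * 5 + 6)
    (\<lambda>s'. sort_inv N key0 s' \<and> nvar s' ''t'' = Suc (nvar s ''t''))"
proof -
  define t where "t = nvar s ''t''"
  define od where "od = narr s ''ord''"
  define w where "w = narr s ''win''"
  define key where "key = rarr s ''key''"
  define pr where "pr = narr s ''par''"
  define j where "j = w 1"
  have tN: "t < N" using t by (simp add: t_def)
  have Nv: "nvar s ''N'' = N" and inj: "inj_on od {..<t}" and rng: "od ` {..<t} \<subseteq> {..<N}"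
    and ky: "\<And>i. i < N \<Longrightarrow> key i = (if i \<in> od ` {..<t} then -1 else key0 i)"
    and rest: "\<And>i u. i < N \<Longrightarrow> i \<notin> od ` {..<t} \<Longrightarrow> u < t \<Longrightarrow> key0 i \<le> key0 (od u)"
    and srt: "\<And>u t'. u \<le> t' \<Longrightarrow> t' < t \<Longrightarrow> key0 (od t') \<le> key0 (od u)"
    and leaf: "\<forall>i<N. w (N + i) = i" and tree: "\<forall>u\<in>{1..<N}. wins key w u"
    and par: "\<forall>u\<in>{1..<N}. pr (2 * u) = u \<and> pr (2 * u + 1) = u"
    using I unfolding sort_inv_def t_def od_def w_def key_def pr_def by blast+
  have jN: "j < N" using wins_leaf[OF leaf tree, of 1] tN by (simp add: j_def)
  have max: "key i \<le> key j" if "i < N" for i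
    using wins_root_max[OF tree, of "N + i"] leaf that by (simp add: j_def)
  \<comment> \<open>Fewer than \<open>N\<close> items are out, so some item still has a nonnegative
    key and the winner at the root cannot be an extracted item.\<close>
  have "card (od ` {..<t}) = t" using inj card_image by fastforce
  then have "od ` {..<t} \<noteq> {..<N}" using tN by auto
  then obtain i0 where "i0 < N" "i0 \<notin> od ` {..<t}" using rng by blast
  then have "0 \<le> key j" using max[of i0] ky[of i0] pos by fastforce
  then have jn: "j \<notin> od ` {..<t}" and kj: "key j = key0 j" using ky[OF jN] by (auto split: if_splits)
  define od' where "od' = od(t := j)"
  define key' where "key' = key(j := -1)"
  have im: "od' ` {..<Suc t} = insert j (od ` {..<t})"
    by (auto simp: od'_def less_Suc_eq)
  have inj': "inj_on od' {..<Suc t}" using inj jn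
    by (auto simp: od'_def inj_on_def less_Suc_eq image_iff)
  have rng': "od' ` {..<Suc t} \<subseteq> {..<N}" using rng jN im by auto
  have ky': "key' i = (if i \<in> od' ` {..<Suc t} then -1 else key0 i)" if "i < N" for i
    using ky[OF that] unfolding im key'_def by auto
  have rest': "key0 i \<le> key0 (od' u)" if i: "i < N" "i \<notin> od' ` {..<Suc t}" "u < Suc t" for i u
  proof -
    have ni: "i \<notin> od ` {..<t}" "i \<noteq> j" using i(2) im by auto
    then have "key0 i \<le> key0 j" using max[OF i(1)] ky[OF i(1)] kj by simp
    then show ?thesis using rest[OF i(1) ni(1), of u] i(3) by (auto simp: od'_def less_Suc_eq)
  qed
  have srt': "key0 (od' t') \<le> key0 (od' u)" if "u \<le> t'" "t' < Suc t" for u t'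
    using that srt[of u t'] rest[OF jN jn, of u] by (auto simp: od'_def less_Suc_eq)
  \<comment> \<open>The new key of \<open>j\<close> matters only at nodes that hold \<open>j\<close>
    or have a child holding \<open>j\<close>. By \<open>wins_leaf\<close> these lie on the path from
    leaf \<open>N + j\<close> to the root, and being inner nodes they are proper ancestors of that
    leaf, as climbing requires.\<close>
  have tree': "wins key' w u \<or> (\<exists>i\<ge>1. u = (N + j) div 2 ^ i)" if u: "u \<in> {1..<N}" for u
  proof (cases "\<exists>u'. (u' = u \<or> u' = 2 * u \<or> u' = 2 * u + 1) \<and> w u' = j")
    case False
    then show ?thesis using tree u by (auto simp: wins_def key'_def)
  next
    case True
    then obtain u' where u': "u' = u \<or> u' = 2 * u \<or> u' = 2 * u + 1" "w u' = j" by blast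
    then obtain i where i: "u' = (N + j) div 2 ^ i"
      using wins_leaf[OF leaf tree, of u'] u by auto
    show ?thesis
    proof (cases "u' = u")
      case True
      then have "i \<noteq> 0" using i u by (intro notI) simp
      then show ?thesis using i True by (intro disjI2 exI[of _ i]) auto
    next
      case False
      then have "u = u' div 2" using u' by auto
      then have "u = (N + j) div 2 ^ Suc i"
        using i div_mult2_eq[of "N + j" "2 ^ i" 2] by (metis mult.commute power_Suc)
      then show ?thesis by (intro disjI2 exI[of _ "Suc i"]) auto
    qed
  qed
  have lg: "floor_log (N + j) \<le> floor_log (2 * N)" using jN by (intro floor_log_le_iff) auto
  show ?thesis
    unfolding tree_extract_def
  proof (rule runs_Seq'[where T = 4 and U = "floor_log (2 * N) * 5 + 2" and
        Q = "\<lambda>s'. nvar s' ''N'' = N \<and> nvar s' ''t'' = t \<and> nvar s' ''v'' = N + j \<and>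
          narr s' ''ord'' = od' \<and> rarr s' ''key'' = key' \<and> narr s' ''win'' = w \<and> narr s' ''par'' = pr"])
    show "runs tree_pop s 4 (\<lambda>s'. nvar s' ''N'' = N \<and> nvar s' ''t'' = t \<and> nvar s' ''v'' = N + j \<and>
        narr s' ''ord'' = od' \<and> rarr s' ''key'' = key' \<and> narr s' ''win'' = w \<and> narr s' ''par'' = pr)"
      unfolding tree_pop_def
      by (rule runs_straight)
        (simp_all add: Nv t_def[symmetric] od_def[symmetric] w_def[symmetric] key_def[symmetric]
          pr_def[symmetric] od'_def key'_def j_def of_rat_minus flip: One_nat_def)
  next
    fix s1 :: store assume s1: "nvar s1 ''N'' = N \<and> nvar s1 ''t'' = t \<and> nvar s1 ''v'' = N + j \<and>
        narr s1 ''ord'' = od' \<and> rarr s1 ''key'' = key' \<and> narr s1 ''win'' = w \<and> narr s1 ''par'' = pr"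
    show "runs (Seq tree_climb (NAssign ''t'' (NAdd (NVar ''t'') (NConst 1)))) s1
       (floor_log (2 * N) * 5 + 2) (\<lambda>s'. sort_inv N key0 s' \<and> nvar s' ''t'' = Suc (nvar s ''t''))"
    proof (rule runs_Seq')
      show "runs tree_climb s1 (floor_log (nvar s1 ''v'') * 5 + 1)
        (\<lambda>s'. (\<forall>j<N. narr s' ''win'' (N + j) = j) \<and> (\<forall>u\<in>{1..<N}. wins key' (narr s' ''win'') u))"
        by (rule runs_tree_climb) (use s1 par leaf jN tree' tN in auto)
      fix s2 :: store assume s2: "(\<forall>j<N. narr s2 ''win'' (N + j) = j) \<and> (\<forall>u\<in>{1..<N}. wins key' (narr s2 ''win'') u)"
        and ag: "agree_off (vars_written tree_climb) s1 s2"
      have fr: "nvar s2 ''N'' = N" "nvar s2 ''t'' = t" "narr s2 ''ord'' = od'" "rarr s2 ''key'' = key'"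
        "narr s2 ''par'' = pr"
        using agree_offD[OF ag, of "''N''"] agree_offD[OF ag, of "''t''"] agree_offD[OF ag, of "''ord''"]
          agree_offD[OF ag, of "''key''"] agree_offD[OF ag, of "''par''"] s1 by auto
      show "runs (NAssign ''t'' (NAdd (NVar ''t'') (NConst 1))) s2 1
         (\<lambda>s'. sort_inv N key0 s' \<and> nvar s' ''t'' = Suc (nvar s ''t''))"
      proof (rule runs_straight)
        let ?s3 = "straight_result (NAssign ''t'' (NAdd (NVar ''t'') (NConst 1))) s2"
        have v3: "nvar ?s3 ''N'' = N" "nvar ?s3 ''t'' = Suc t" "narr ?s3 ''ord'' = od'" "rarr ?s3 ''key'' = key'"
           "narr ?s3 ''par'' = pr" "narr ?s3 ''win'' = narr s2 ''win''"
          by (simp_all add: fr)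
        have "sort_inv N key0 ?s3"
          unfolding sort_inv_def v3
        proof (intro conjI)
          show "\<forall>i<N. key' i = (if i \<in> od' ` {..<Suc t} then -1 else key0 i)"
            using ky' by blast
          show "\<forall>i<N. i \<notin> od' ` {..<Suc t} \<longrightarrow> (\<forall>u<Suc t. key0 i \<le> key0 (od' u))"
            using rest' by blast
          show "\<forall>u t'. u \<le> t' \<longrightarrow> t' < Suc t \<longrightarrow> key0 (od' t') \<le> key0 (od' u)"
            using srt' by blast
        qed (use tN inj' rng' s2 par in simp_all)
        then show "sort_inv N key0 ?s3 \<and> nvar ?s3 ''t'' = Suc (nvar s ''t'')"
          using v3(2) t_def by simp
      qed simp_all
    qed (use s1 lg in simp)
  qed simp
qed

lemma runs_sort_prog:
  assumes N: "nvar s ''N'' = N" "1 \<le> N" and pos: "\<forall>j<N. 0 \<le> rarr s ''key'' j"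
  shows "runs sort_prog s (N * (5 * floor_log (2 * N) + 17) + 6)
    (\<lambda>s'. bij_betw (narr s' ''ord'') {..<N} {..<N} \<and>
      (\<forall>u t. u \<le> t \<longrightarrow> t < N \<longrightarrow>
         rarr s ''key'' (narr s' ''ord'' t) \<le> rarr s ''key'' (narr s' ''ord'' u)))"
    (is "runs _ _ _ ?Q")
  unfolding sort_prog_def
proof (rule runs_Seq')
  show "runs tree_leaves s (N * 3 + 2) (\<lambda>s'. \<forall>j<N. narr s' ''win'' (N + j) = j)"
    using runs_tree_leaves N by blast
  fix s1 :: store assume s1: "\<forall>j<N. narr s1 ''win'' (N + j) = j" and a1: "agree_off (vars_written tree_leaves) s s1"
  have f1: "nvar s1 ''N'' = N" "rarr s1 ''key'' = rarr s ''key''"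
    using agree_offD[OF a1, of "''N''"] agree_offD[OF a1, of "''key''"] N by auto
  show "runs (Seq tree_build (Seq (NAssign ''t'' (NConst 0))
     (While (NLess (NVar ''t'') (NVar ''N'')) tree_extract))) s1
     (N * (5 * floor_log (2 * N) + 14) + 4) ?Q"
  proof (rule runs_Seq'[OF runs_tree_build[OF f1(1) N(2) f1(2) s1]])
    fix s2 :: store assume s2: "(\<forall>j<N. narr s2 ''win'' (N + j) = j) \<and>
      (\<forall>u\<in>{1..<N}. wins (rarr s ''key'') (narr s2 ''win'') u \<and>
         narr s2 ''par'' (2 * u) = u \<and> narr s2 ''par'' (2 * u + 1) = u)"
      and a2: "agree_off (vars_written tree_build) s1 s2"
    have f2: "nvar s2 ''N'' = N" "rarr s2 ''key'' = rarr s ''key''"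
      using agree_offD[OF a2, of "''N''"] agree_offD[OF a2, of "''key''"] f1 by auto
    show "runs (Seq (NAssign ''t'' (NConst 0)) (While (NLess (NVar ''t'') (NVar ''N'')) tree_extract)) s2
      (N * (5 * floor_log (2 * N) + 7) + 2) ?Q"
    proof (rule runs_Seq'[where T = 1 and Q = "\<lambda>s'. sort_inv N (rarr s ''key'') s' \<and> nvar s' ''t'' = 0"])
      show "runs (NAssign ''t'' (NConst 0)) s2 1 (\<lambda>s'. sort_inv N (rarr s ''key'') s' \<and> nvar s' ''t'' = 0)"
        by (rule runs_straight) (use s2 f2 in \<open>simp_all add: sort_inv_def\<close>)
      fix s3 :: store assume s3: "sort_inv N (rarr s ''key'') s3 \<and> nvar s3 ''t'' = 0"
      have "runs (While (NLess (NVar ''t'') (NVar ''N'')) tree_extract) s3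
         ((N - nvar s3 ''t'') * ((floor_log (2 * N) * 5 + 6) + 1) + 1)
         (\<lambda>s'. sort_inv N (rarr s ''key'') s' \<and> \<not> bval (NLess (NVar ''t'') (NVar ''N'')) s' \<and>
            agree_off (vars_written tree_extract) s3 s')"
      proof (rule runs_While[where \<mu> = "\<lambda>s. N - nvar s ''t''"])
        show "sort_inv N (rarr s ''key'') s3" using s3 by simp
        fix s' :: store assume i: "sort_inv N (rarr s ''key'') s'" "bval (NLess (NVar ''t'') (NVar ''N'')) s'"
        then have "nvar s' ''t'' < N" by (simp add: sort_inv_def)
        then show "runs tree_extract s' (floor_log (2 * N) * 5 + 6)
          (\<lambda>s''. sort_inv N (rarr s ''key'') s'' \<and> N - nvar s'' ''t'' < N - nvar s' ''t'')"
          by (intro runs_mono[OF runs_tree_extract[OF i(1) _ pos]]) auto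
      qed
      then show "runs (While (NLess (NVar ''t'') (NVar ''N'')) tree_extract) s3
          (N * (5 * floor_log (2 * N) + 7) + 1) ?Q"
      proof (rule runs_mono)
        fix s' :: store assume a: "sort_inv N (rarr s ''key'') s' \<and> \<not> bval (NLess (NVar ''t'') (NVar ''N'')) s' \<and>
            agree_off (vars_written tree_extract) s3 s'"
        then have t: "nvar s' ''t'' = N" by (auto simp: sort_inv_def)
        have "inj_on (narr s' ''ord'') {..<N}" "narr s' ''ord'' ` {..<N} \<subseteq> {..<N}"
          using a t by (auto simp: sort_inv_def)
        then have "bij_betw (narr s' ''ord'') {..<N} {..<N}"
          by (simp add: bij_betw_def endo_inj_surj)
        then show "?Q s'" using a t by (auto simp: sort_inv_def)
      qed (use s3 in \<open>simp add: algebra_simps\<close>)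
    qed simp
  qed (simp add: algebra_simps)
qed (simp add: algebra_simps)

section \<open>Selecting columns by scanning the rows in decreasing order\<close>

text \<open>Pointer encoding of the linked list of a row: 0 is the end of the list and
  \<open>Suc x\<close> points to entry \<open>x\<close>, so zero-initialised arrays represent empty
  lists. Entries of a row are linked in decreasing order.\<close>

fun prev_entry :: "(nat \<Rightarrow> nat) \<Rightarrow> nat \<Rightarrow> nat \<Rightarrow> nat" where
  "prev_entry rf r 0 = 0"
| "prev_entry rf r (Suc e) = (if rf e = r then Suc e else prev_entry rf r e)"

lemma prev_entry_le: "prev_entry rf r e \<le> e"
  by (induction e) auto

lemma prev_entry_row: "0 < prev_entry rf r e \<Longrightarrow> rf (prev_entry rf r e - 1) = r"
  by (induction e) auto

lemma less_prev_entry: "x < e \<Longrightarrow> rf x = r \<Longrightarrow> x < prev_entry rf r e"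
  by (induction e) (auto simp: less_Suc_eq)

text \<open>In the application \<open>D = 2 * L\<close>, and just \<open>L\<close> entries of each
  column lie in rows below \<open>N\<close>. Four times the count reaching \<open>D\<close>
  therefore means that at least half of these \<open>L\<close> rows have a key above \<tau>.\<close>

definition heavy_columns_of ::
    "nat \<Rightarrow> nat \<Rightarrow> nat \<Rightarrow> (nat \<Rightarrow> nat) \<Rightarrow> (nat \<Rightarrow> real) \<Rightarrow> real \<Rightarrow> nat set" where
  "heavy_columns_of n D N rf ky \<tau> =
     {i. i < n \<and> D \<le> 4 * card {x. x < D * n \<and> rf x < N \<and> \<tau> < ky (rf x) \<and> x div D = i}}"

locale column_scan =
  fixes n D N :: nat and rf od :: "nat \<Rightarrow> nat" and ky :: "nat \<Rightarrow> real"
  assumes D: "1 \<le> D" and od: "bij_betw od {..<N} {..<N}"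
    and srt: "\<And>u t. u \<le> t \<Longrightarrow> t < N \<Longrightarrow> ky (od t) \<le> ky (od u)"
begin

text \<open>State of the scan: \<open>t\<close> rows have been opened, and the last of them is done
  from position \<open>p\<close> upwards. With \<open>p = 0\<close> all opened rows are
  finished.\<close>

definition scanned :: "nat \<Rightarrow> nat \<Rightarrow> nat set" where
  "scanned t p = {x. x < D * n \<and> (\<exists>u<t. rf x = od u \<and> (Suc u = t \<longrightarrow> p \<le> x))}"

abbreviation heavy_columns :: "real \<Rightarrow> nat set" where
  "heavy_columns \<equiv> heavy_columns_of n D N rf ky"

text \<open>The last conjunct ranges over all thresholds because the program knows none. For each
  \<tau>, either only keys above \<tau> have been met so far, or the columns heavy for \<tau>
  already form a prefix of \<open>sel\<close>, which later steps preserve.\<close>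

definition scan_inv :: "nat \<Rightarrow> nat \<Rightarrow> nat \<Rightarrow> (nat \<Rightarrow> nat) \<Rightarrow> (nat \<Rightarrow> nat) \<Rightarrow> bool" where
  "scan_inv t p q cnt sel \<longleftrightarrow> t \<le> N \<and> (0 < p \<longrightarrow> 0 < t \<and> p \<le> D * n \<and> rf (p - 1) = od (t - 1)) \<and>
     cnt = (\<lambda>i. card {x \<in> scanned t p. x div D = i}) \<and>
     inj_on sel {..<q} \<and> sel ` {..<q} = {i. i < n \<and> D \<le> 4 * cnt i} \<and>
     (\<forall>\<tau>. (\<forall>x\<in>scanned t p. \<tau> < ky (rf x)) \<or> (\<exists>q'\<le>q. sel ` {..<q'} = heavy_columns \<tau>))"

lemma finite_scanned: "finite (scanned t p)" "card (scanned t p) \<le> D * n"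
proof -
  have "scanned t p \<subseteq> {..<D * n}" by (auto simp: scanned_def)
  then show "finite (scanned t p)" "card (scanned t p) \<le> D * n"
    using finite_subset card_mono[of "{..<D * n}"] by auto
qed

lemma od_less: "u < N \<Longrightarrow> od u < N"
  using od by (auto simp: bij_betw_def)

lemma od_surj: "r < N \<Longrightarrow> \<exists>u<N. od u = r"
proof -
  assume "r < N"
  then have "r \<in> od ` {..<N}" using od by (simp add: bij_betw_def)
  then show ?thesis by auto
qed

lemma od_inj: "u < N \<Longrightarrow> u' < N \<Longrightarrow> od u = od u' \<Longrightarrow> u = u'"
  using od by (auto simp: bij_betw_def inj_on_def)

lemma scan_inv_init: "scan_inv 0 0 0 (\<lambda>_. 0) sel"
  using D by (auto simp: scan_inv_def scanned_def)

lemma scan_inv_next_row: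
  assumes I: "scan_inv t 0 q cnt sel" and t: "t < N"
  shows "scan_inv (Suc t) (prev_entry rf (od t) (D * n)) q cnt sel"
    "scanned (Suc t) (prev_entry rf (od t) (D * n)) = scanned t 0"
proof -
  let ?p = "prev_entry rf (od t) (D * n)"
  show eq: "scanned (Suc t) ?p = scanned t 0"
  proof (intro equalityI subsetI)
    fix x assume x: "x \<in> scanned (Suc t) ?p"
    then obtain u where u: "x < D * n" "u < Suc t" "rf x = od u" "Suc u = Suc t \<longrightarrow> ?p \<le> x"
      by (auto simp: scanned_def)
    have "u \<noteq> t" using u less_prev_entry[of x "D * n" rf "od t"] by auto
    then show "x \<in> scanned t 0" using u by (auto simp: scanned_def less_Suc_eq)
  qed (auto simp: scanned_def less_Suc_eq)
  show "scan_inv (Suc t) ?p q cnt sel"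
    using I t prev_entry_le[of rf "od t" "D * n"] prev_entry_row[of rf "od t" "D * n"]
    unfolding scan_inv_def eq by auto
qed

lemma scan_inv_next_entry:
  assumes I: "scan_inv t p q cnt sel" and p: "0 < p"
  defines "e \<equiv> p - 1"
  defines "i \<equiv> e div D"
  defines "c \<equiv> Suc (cnt i)"
  defines "new \<equiv> D \<le> 4 * c \<and> 4 * cnt i < D"
  shows "scan_inv t (prev_entry rf (rf e) e) (if new then Suc q else q) (cnt(i := c))
      (if new then sel(q := i) else sel)"
    "scanned t (prev_entry rf (rf e) e) = insert e (scanned t p)" "e \<notin> scanned t p"
    "e < D * n" "rf e < N"
proof -
  let ?p = "prev_entry rf (rf e) e"
  have t: "0 < t" "t \<le> N" "p \<le> D * n" "rf e = od (t - 1)" and ct: "cnt = (\<lambda>i. card {x \<in> scanned t p. x div D = i})"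
    and inj: "inj_on sel {..<q}" and ss: "sel ` {..<q} = {i. i < n \<and> D \<le> 4 * cnt i}"
    and hv: "\<And>\<tau>. (\<forall>x\<in>scanned t p. \<tau> < ky (rf x)) \<or> (\<exists>q'\<le>q. sel ` {..<q'} = heavy_columns \<tau>)"
    using I p by (auto simp: scan_inv_def e_def)
  have e: "e < D * n" "e < p" using t p by (auto simp: e_def)
  have rl: "rf e < N" using t od_less by simp
  show "e < D * n" "rf e < N" by fact+
  have lt: "u = t - 1" if "u < t" "od u = od (t - 1)" for u
    using od_inj[of u "t - 1"] that t by auto
  show ne: "e \<notin> scanned t p"
    using lt e t by (fastforce simp: scanned_def)
  show sc: "scanned t ?p = insert e (scanned t p)"
  proof (intro equalityI subsetI)
    fix x assume "x \<in> scanned t ?p"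
    then obtain u where u: "x < D * n" "u < t" "rf x = od u" "Suc u = t \<longrightarrow> ?p \<le> x"
      by (auto simp: scanned_def)
    show "x \<in> insert e (scanned t p)"
    proof (cases "Suc u = t")
      case True
      then have "rf x = rf e" using u t by auto
      then have "\<not> x < e" using less_prev_entry[of x e rf "rf e"] u True by auto
      then have "x = e \<or> p \<le> x" by (auto simp: e_def)
      then show ?thesis using u by (auto simp: scanned_def)
    qed (use u in \<open>auto simp: scanned_def\<close>)
  next
    have pe: "?p \<le> e" by (rule prev_entry_le)
    fix x assume "x \<in> insert e (scanned t p)"
    then consider "x = e" | "x \<in> scanned t p" by blast
    then show "x \<in> scanned t ?p"
    proof cases
      case 1
      then show ?thesis using pe e t by (auto simp: scanned_def intro!: exI[of _ "t - 1"])
    next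
      case 2
      then obtain u where "x < D * n" "u < t" "rf x = od u" "Suc u = t \<longrightarrow> p \<le> x"
        by (auto simp: scanned_def)
      then show ?thesis using pe e by (auto simp: scanned_def intro!: exI[of _ u])
    qed
  qed
  have i: "i < n" using e D by (simp add: i_def less_mult_imp_div_less mult.commute)
  have ct': "cnt(i := c) = (\<lambda>i'. card {x \<in> scanned t ?p. x div D = i'})"
  proof
    fix i'
    show "(cnt(i := c)) i' = card {x \<in> scanned t ?p. x div D = i'}"
    proof (cases "i' = i")
      case True
      then have "{x \<in> scanned t ?p. x div D = i'} = insert e {x \<in> scanned t p. x div D = i}"
        unfolding sc i_def by auto
      then show ?thesis using True ne finite_scanned by (simp add: c_def ct)
    next
      case False
      then have "{x \<in> scanned t ?p. x div D = i'} = {x \<in> scanned t p. x div D = i'}"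
        unfolding sc i_def by auto
      then show ?thesis using False by (simp add: ct)
    qed
  qed
  have ni: "i \<notin> sel ` {..<q}" if new using that ss by (auto simp: new_def)
  let ?q = "if new then Suc q else q" and ?sel = "if new then sel(q := i) else sel"
  have inj': "inj_on ?sel {..<?q}"
    using inj ni by (auto simp: inj_on_def less_Suc_eq image_iff)
  have im: "?sel ` {..<?q} = (if new then insert i (sel ` {..<q}) else sel ` {..<q})"
    by (auto simp: less_Suc_eq)
  have ss': "?sel ` {..<?q} = {i'. i' < n \<and> D \<le> 4 * (cnt(i := c)) i'}"
    unfolding im ss using i by (auto simp: new_def c_def)
  have hv': "(\<forall>x\<in>scanned t ?p. \<tau> < ky (rf x)) \<or> (\<exists>q'\<le>?q. ?sel ` {..<q'} = heavy_columns \<tau>)" for \<tau>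
  proof -
    have keep: "?sel ` {..<q'} = sel ` {..<q'}" if "q' \<le> q" for q'
      using that by (auto simp: image_iff)
    consider "\<exists>q'\<le>q. sel ` {..<q'} = heavy_columns \<tau>"
      | "\<forall>x\<in>scanned t p. \<tau> < ky (rf x)" "\<tau> < ky (rf e)"
      | "\<forall>x\<in>scanned t p. \<tau> < ky (rf x)" "ky (rf e) \<le> \<tau>"
      using hv[of \<tau>] by force
    then show ?thesis
    proof cases
      case 1
      then obtain q' where "q' \<le> q" "sel ` {..<q'} = heavy_columns \<tau>" by blast
      then show ?thesis using keep[of q'] by (intro disjI2 exI[of _ q']) auto
    next
      case 2
      then show ?thesis unfolding sc by auto
    next
      case 3
      \<comment> \<open>This is the moment when the scan first drops to a key of at most \<tau>.
        Rows come by decreasing key, so all entries with a key above \<tau> are already scanned, and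
        the list as it stands before this step is exactly the heavy set.\<close>
      have "x \<in> scanned t p" if x: "x < D * n" "rf x < N" "\<tau> < ky (rf x)" for x
      proof -
        obtain u where u: "u < N" "od u = rf x" using od_surj[OF x(2)] by blast
        have "u < t - 1"
        proof (rule ccontr)
          assume "\<not> u < t - 1"
          then have "ky (od u) \<le> ky (od (t - 1))" using srt[of "t - 1" u] u by auto
          then show False using x u t 3 by simp
        qed
        then show ?thesis using u x by (auto simp: scanned_def intro!: exI[of _ u])
      qed
      moreover have "rf x < N" if "x \<in> scanned t p" for x
        using that od_less t(2) by (auto simp: scanned_def)
      ultimately have "scanned t p = {x. x < D * n \<and> rf x < N \<and> \<tau> < ky (rf x)}"
        using 3(1) by (auto simp: scanned_def)
      then have "sel ` {..<q} = heavy_columns \<tau>"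
        unfolding ss heavy_columns_of_def ct by (simp add: conj_assoc)
      then show ?thesis using keep[of q] by (intro disjI2 exI[of _ q]) auto
    qed
  qed
  have "0 < ?p \<longrightarrow> 0 < t \<and> ?p \<le> D * n \<and> rf (?p - 1) = od (t - 1)"
    using prev_entry_le[of rf "rf e" e] prev_entry_row[of rf "rf e" e] e t by auto
  then show "scan_inv t ?p ?q (cnt(i := c)) ?sel"
    unfolding scan_inv_def using t(2) ct' inj' ss' hv' by blast
qed

text \<open>A heavy set is a prefix of a repetition-free list, so if it has at most \<open>M\<close>
  elements it survives cutting the list after \<open>M\<close> items. The cut needs only a bound on
  the size, never the threshold itself.\<close>

lemma scan_inv_final:
  assumes I: "scan_inv N 0 q cnt sel"
  shows "inj_on sel {..<q}" "sel ` {..<q} \<subseteq> {..<n}"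
    "card (heavy_columns \<tau>) \<le> M \<Longrightarrow> heavy_columns \<tau> \<subseteq> sel ` {..<min M q}"
proof -
  have ct: "cnt = (\<lambda>i. card {x \<in> scanned N 0. x div D = i})" and ss: "sel ` {..<q} = {i. i < n \<and> D \<le> 4 * cnt i}"
    and inj: "inj_on sel {..<q}"
    and hv: "(\<forall>x\<in>scanned N 0. \<tau> < ky (rf x)) \<or> (\<exists>q'\<le>q. sel ` {..<q'} = heavy_columns \<tau>)"
    using I by (auto simp: scan_inv_def)
  show "inj_on sel {..<q}" by fact
  show "sel ` {..<q} \<subseteq> {..<n}" using ss by auto
  have sc: "scanned N 0 = {x. x < D * n \<and> rf x < N}"
  proof -
    have "(\<exists>u<N. r = od u) \<longleftrightarrow> r < N" for r
      using od_surj od_less by metis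
    then show ?thesis by (auto simp: scanned_def)
  qed
  have "\<exists>q'\<le>q. sel ` {..<q'} = heavy_columns \<tau>"
  proof (cases "\<forall>x\<in>scanned N 0. \<tau> < ky (rf x)")
    case True
    then have "scanned N 0 = {x. x < D * n \<and> rf x < N \<and> \<tau> < ky (rf x)}" using sc by blast
    then have "sel ` {..<q} = heavy_columns \<tau>"
      unfolding ss heavy_columns_of_def ct by (simp add: conj_assoc)
    then show ?thesis by blast
  qed (use hv in blast)
  then obtain q' where q': "q' \<le> q" "sel ` {..<q'} = heavy_columns \<tau>" by blast
  assume "card (heavy_columns \<tau>) \<le> M"
  moreover have "card (heavy_columns \<tau>) = q'"
    using q' inj card_image[of sel "{..<q'}"] inj_on_subset[OF inj, of "{..<q'}"] by auto
  ultimately have "{..<q'} \<subseteq> {..<min M q}" using q' by auto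
  then show "heavy_columns \<tau> \<subseteq> sel ` {..<min M q}" unfolding q'(2)[symmetric] by (rule image_mono)
qed

end

section \<open>The scan as a program\<close>

text \<open>After quadrupling, \<open>c\<close> is four times the new count. The test that it lies
  in the interval from \<open>D\<close> to \<open>D + 3\<close> holds exactly at the increment that
  crosses the bound, so every column is appended at most once.\<close>

definition scan_entry :: com where
  "scan_entry = Seq (NAssign ''e'' (NSub (NVar ''p'') (NConst 1)))
    (Seq (NAssign ''i'' (NArr ''col'' (NVar ''e'')))
    (Seq (NArrAssign ''cnt'' (NVar ''i'') (NAdd (NArr ''cnt'' (NVar ''i'')) (NConst 1)))
    (Seq (NAssign ''c'' (NArr ''cnt'' (NVar ''i'')))
    (Seq (NAssign ''c'' (NAdd (NAdd (NVar ''c'') (NVar ''c'')) (NAdd (NVar ''c'') (NVar ''c''))))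
    (Seq (Cond (BAnd (BNot (NLess (NVar ''c'') (NVar ''D'')))
                     (NLess (NVar ''c'') (NAdd (NVar ''D'') (NConst 4))))
       (Seq (NArrAssign ''sel'' (NVar ''q'') (NVar ''i'')) (NAssign ''q'' (NAdd (NVar ''q'') (NConst 1))))
       Skip)
    (NAssign ''p'' (NArr ''nxt'' (NVar ''e''))))))))"

definition scan_row :: com where
  "scan_row = Seq (NAssign ''p'' (NArr ''head'' (NArr ''ord'' (NVar ''t''))))
     (NAssign ''t'' (NAdd (NVar ''t'') (NConst 1)))"

definition scan_prog :: com where
  "scan_prog = Seq (Seq (NAssign ''t'' (NConst 0)) (Seq (NAssign ''p'' (NConst 0)) (NAssign ''q'' (NConst 0))))
     (While (BNot (BAnd (BNot (NLess (NVar ''t'') (NVar ''N''))) (BNot (NLess (NConst 0) (NVar ''p'')))))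
       (Cond (NLess (NConst 0) (NVar ''p'')) scan_entry scan_row))"

lemma vars_written_scan [simp]:
  "vars_written scan_entry = {(NV, ''e''), (NV, ''i''), (NA, ''cnt''), (NV, ''c''), (NA, ''sel''), (NV, ''q''), (NV, ''p'')}"
  "vars_written scan_row = {(NV, ''p''), (NV, ''t'')}"
  "vars_written scan_prog = {(NV, ''e''), (NV, ''i''), (NA, ''cnt''), (NV, ''c''), (NA, ''sel''), (NV, ''q''), (NV, ''p''), (NV, ''t'')}"
  by (auto simp: scan_entry_def scan_row_def scan_prog_def)

lemma scan_entry_result:
  assumes "nvar s ''p'' = Suc e" "narr s ''col'' e = i"
  defines "c \<equiv> Suc (narr s ''cnt'' i)"
  defines "new \<equiv> nvar s ''D'' \<le> 4 * c \<and> 4 * narr s ''cnt'' i < nvar s ''D''"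
  defines "s' \<equiv> straight_result scan_entry s"
  shows "nvar s' ''t'' = nvar s ''t''" "nvar s' ''p'' = narr s ''nxt'' e"
    "nvar s' ''q'' = (if new then Suc (nvar s ''q'') else nvar s ''q'')"
    "narr s' ''cnt'' = (narr s ''cnt'')(i := c)"
    "narr s' ''sel'' = (if new then (narr s ''sel'')(nvar s ''q'' := i) else narr s ''sel'')"
  using assms(1,2) unfolding s'_def scan_entry_def new_def c_def by simp_all

lemma (in column_scan) runs_scan_prog:
  assumes "nvar s ''N'' = N" "nvar s ''D'' = D" "narr s ''ord'' = od"
    and hd: "\<And>r. r < N \<Longrightarrow> narr s ''head'' r = prev_entry rf r (D * n)"
    and nx: "\<And>x. x < D * n \<Longrightarrow> rf x < N \<Longrightarrow> narr s ''nxt'' x = prev_entry rf (rf x) x"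
    and cl: "\<And>x. x < D * n \<Longrightarrow> rf x < N \<Longrightarrow> narr s ''col'' x = x div D"
    and ct: "narr s ''cnt'' = (\<lambda>_. 0)"
  shows "runs scan_prog s ((N + D * n) * 14 + 4)
    (\<lambda>s'. \<exists>cnt. scan_inv N 0 (nvar s' ''q'') cnt (narr s' ''sel''))"
  unfolding scan_prog_def
proof (rule runs_Seq'[where T = 3])
  define inp where "inp s' \<longleftrightarrow> nvar s' ''N'' = N \<and> nvar s' ''D'' = D \<and> narr s' ''ord'' = od \<and>
    narr s' ''head'' = narr s ''head'' \<and> narr s' ''nxt'' = narr s ''nxt'' \<and>
    narr s' ''col'' = narr s ''col''" for s' :: store
  define I where "I s' \<longleftrightarrow> inp s' \<and>
    scan_inv (nvar s' ''t'') (nvar s' ''p'') (nvar s' ''q'') (narr s' ''cnt'') (narr s' ''sel'')" for s' :: store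
  \<comment> \<open>Each round either opens a row or scans one new entry, so the total cost is
    linear in rows plus entries.\<close>
  define \<mu> where "\<mu> s' = (N - nvar s' ''t'') + (D * n - card (scanned (nvar s' ''t'') (nvar s' ''p'')))" for s' :: store
  show "runs (Seq (NAssign ''t'' (NConst 0)) (Seq (NAssign ''p'' (NConst 0)) (NAssign ''q'' (NConst 0)))) s 3
    (\<lambda>s'. I s' \<and> nvar s' ''t'' = 0)"
    by (rule runs_straight) (use assms scan_inv_init in \<open>simp_all add: I_def inp_def\<close>)
  fix s0 :: store assume s0: "I s0 \<and> nvar s0 ''t'' = 0"
  let ?b = "BNot (BAnd (BNot (NLess (NVar ''t'') (NVar ''N''))) (BNot (NLess (NConst 0) (NVar ''p''))))"
  let ?p = "Cond (NLess (NConst 0) (NVar ''p'')) scan_entry scan_row"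
  have st: "straight ?p" "straight_time ?p \<le> 13" by (simp_all add: scan_entry_def scan_row_def)
  have "runs (While ?b ?p) s0 (\<mu> s0 * (13 + 1) + 1)
      (\<lambda>s'. I s' \<and> \<not> bval ?b s' \<and> agree_off (vars_written ?p) s0 s')"
  proof (rule runs_While)
    show "I s0" using s0 by simp
    fix s' :: store assume I: "I s'" and b: "bval ?b s'"
    have inp: "inp s'" and si: "scan_inv (nvar s' ''t'') (nvar s' ''p'') (nvar s' ''q'') (narr s' ''cnt'') (narr s' ''sel'')"
      using I by (auto simp: I_def)
    have tN: "nvar s' ''t'' \<le> N" using si by (simp add: scan_inv_def)
    show "runs ?p s' 13 (\<lambda>s''. I s'' \<and> \<mu> s'' < \<mu> s')"
    proof (rule runs_straight)
      show "I (straight_result ?p s') \<and> \<mu> (straight_result ?p s') < \<mu> s'"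
      proof (cases "0 < nvar s' ''p''")
        case True
        define e where "e = nvar s' ''p'' - 1"
        note nxt = scan_inv_next_entry[OF si True, folded e_def]
        have e: "nvar s' ''p'' = Suc e" using True by (simp add: e_def)
        have cc: "narr s' ''col'' e = e div D" "narr s' ''nxt'' e = prev_entry rf (rf e) e"
          using inp nxt(4,5) cl nx by (auto simp: inp_def)
        have DD: "nvar s' ''D'' = D" using inp by (simp add: inp_def)
        let ?s = "straight_result scan_entry s'"
        have res: "straight_result ?p s' = ?s" using True by simp
        note er = scan_entry_result[OF e cc(1)]
        have "inp ?s" using inp by (simp add: inp_def scan_entry_def)
        moreover have "scan_inv (nvar ?s ''t'') (nvar ?s ''p'') (nvar ?s ''q'') (narr ?s ''cnt'') (narr ?s ''sel'')"
          using nxt(1) unfolding er cc(2) DD by simp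
        moreover have "\<mu> ?s < \<mu> s'"
        proof -
          have "card (insert e (scanned (nvar s' ''t'') (nvar s' ''p''))) = Suc (card (scanned (nvar s' ''t'') (nvar s' ''p'')))"
            using nxt(3) finite_scanned by simp
          moreover have "card (insert e (scanned (nvar s' ''t'') (nvar s' ''p''))) \<le> D * n"
            using finite_scanned nxt(2) by metis
          ultimately show ?thesis unfolding \<mu>_def er cc(2) nxt(2) by linarith
        qed
        ultimately show ?thesis unfolding res by (simp add: I_def)
      next
        case False
        then have p: "nvar s' ''p'' = 0" and t: "nvar s' ''t'' < N" using b inp by (auto simp: inp_def)
        note nxt = scan_inv_next_row[OF si[unfolded p] t]
        have hh: "narr s' ''head'' (od (nvar s' ''t'')) = prev_entry rf (od (nvar s' ''t'')) (D * n)"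
          using inp hd od_less[OF t] by (simp add: inp_def)
        let ?s = "straight_result scan_row s'"
        have res: "straight_result ?p s' = ?s" using False by simp
        have er: "nvar ?s ''t'' = Suc (nvar s' ''t'')" "nvar ?s ''p'' = prev_entry rf (od (nvar s' ''t'')) (D * n)"
          "nvar ?s ''q'' = nvar s' ''q''" "narr ?s ''cnt'' = narr s' ''cnt''" "narr ?s ''sel'' = narr s' ''sel''"
          using hh inp by (simp_all add: scan_row_def inp_def)
        have "inp ?s" using inp by (simp add: inp_def scan_row_def)
        moreover have "\<mu> ?s < \<mu> s'" unfolding \<mu>_def er nxt(2) p using t by linarith
        ultimately show ?thesis unfolding res using nxt(1) unfolding er I_def by simp
      qed
    qed (use st in auto)
  qed
  then show "runs (While ?b ?p) s0 ((N + D * n) * 14 + 1)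
     (\<lambda>s'. \<exists>cnt. scan_inv N 0 (nvar s' ''q'') cnt (narr s' ''sel''))"
  proof (rule runs_mono)
    have "\<mu> s0 \<le> N + D * n" using s0 by (simp add: \<mu>_def)
    then show "\<mu> s0 * (13 + 1) + 1 \<le> (N + D * n) * 14 + 1" by simp
    fix s' :: store assume a: "I s' \<and> \<not> bval ?b s' \<and> agree_off (vars_written ?p) s0 s'"
    then have "nvar s' ''t'' = N" "nvar s' ''p'' = 0" by (auto simp: I_def inp_def scan_inv_def)
    then show "\<exists>cnt. scan_inv N 0 (nvar s' ''q'') cnt (narr s' ''sel'')" using a by (auto simp: I_def)
  qed
qed simp

section \<open>Row lists for the first half, and the complete selection program\<close>

text \<open>Halves \<open>m\<close> by counting, for lack of division on naturals. Squares order the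
  rows by magnitude and are nonnegative, as the sorting program demands.\<close>

definition half_prog :: com where
  "half_prog = Seq (NAssign ''N'' (NConst 0))
     (While (NLess (NAdd (NVar ''N'') (NVar ''N'')) (NVar ''m''))
       (Seq (RArrAssign ''key'' (NVar ''N'') (RMul (RArr ''y'' (NVar ''N'')) (RArr ''y'' (NVar ''N''))))
         (NAssign ''N'' (NAdd (NVar ''N'') (NConst 1)))))"

lemma runs_half_prog:
  assumes m: "nvar s ''m'' = 2 * h" and key: "rarr s ''key'' = (\<lambda>_. 0)"
  shows "runs half_prog s (h * 3 + 2) (\<lambda>s'. nvar s' ''N'' = h \<and>
    rarr s' ''key'' = (\<lambda>r. if r < h then (rarr s ''y'' r)\<^sup>2 else 0))"
  unfolding half_prog_def
proof (rule runs_Seq'[where T = 1])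
  define I where "I s' \<longleftrightarrow> nvar s' ''m'' = 2 * h \<and> rarr s' ''y'' = rarr s ''y'' \<and> nvar s' ''N'' \<le> h \<and>
    rarr s' ''key'' = (\<lambda>r. if r < nvar s' ''N'' then (rarr s ''y'' r)\<^sup>2 else 0)" for s' :: store
  show "runs (NAssign ''N'' (NConst 0)) s 1 (\<lambda>s'. I s' \<and> nvar s' ''N'' = 0)"
    by (rule runs_straight) (use assms in \<open>simp_all add: I_def\<close>)
  fix s0 :: store assume s0: "I s0 \<and> nvar s0 ''N'' = 0"
  let ?b = "NLess (NAdd (NVar ''N'') (NVar ''N'')) (NVar ''m'')"
  let ?p = "Seq (RArrAssign ''key'' (NVar ''N'') (RMul (RArr ''y'' (NVar ''N'')) (RArr ''y'' (NVar ''N''))))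
         (NAssign ''N'' (NAdd (NVar ''N'') (NConst 1)))"
  have "runs (While ?b ?p) s0 ((h - nvar s0 ''N'') * (2 + 1) + 1)
     (\<lambda>s'. I s' \<and> \<not> bval ?b s' \<and> agree_off (vars_written ?p) s0 s')"
  proof (rule runs_While)
    show "I s0" using s0 by simp
    fix s' :: store assume i: "I s'" "bval ?b s'"
    then show "runs ?p s' 2 (\<lambda>s''. I s'' \<and> h - nvar s'' ''N'' < h - nvar s' ''N'')"
      by (intro runs_straight) (auto simp: I_def fun_eq_iff power2_eq_square)
  qed
  then show "runs (While ?b ?p) s0 (h * 3 + 1) (\<lambda>s'. nvar s' ''N'' = h \<and>
      rarr s' ''key'' = (\<lambda>r. if r < h then (rarr s ''y'' r)\<^sup>2 else 0))"
  proof (rule runs_mono)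
    fix s' :: store assume a: "I s' \<and> \<not> bval ?b s' \<and> agree_off (vars_written ?p) s0 s'"
    then have "nvar s' ''N'' = h" by (auto simp: I_def)
    then show "nvar s' ''N'' = h \<and> rarr s' ''key'' = (\<lambda>r. if r < h then (rarr s ''y'' r)\<^sup>2 else 0)"
      using a by (simp add: I_def)
  qed (use s0 in simp)
qed simp

text \<open>Row \<open>h\<close> is a sentinel. All entries outside the first half are mapped to it,
  so the function carries no trace of where they lie.\<close>

definition first_rows :: "nat \<Rightarrow> nat \<Rightarrow> (nat \<Rightarrow> nat) \<Rightarrow> nat \<Rightarrow> nat" where
  "first_rows nn h rw x = (if x < nn \<and> rw x < h then rw x else h)"

definition link_prog :: com where
  "link_prog = Seq (Seq (NAssign ''e'' (NConst 0)) (NAssign ''i'' (NConst 0)))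
     (While (NLess (NVar ''i'') (NVar ''n''))
       (Cond (NLess (NVar ''e'') (NArr ''start'' (NAdd (NVar ''i'') (NConst 1))))
         (Seq (Cond (NLess (NArr ''row'' (NVar ''e'')) (NVar ''N''))
            (Seq (NArrAssign ''nxt'' (NVar ''e'') (NArr ''head'' (NArr ''row'' (NVar ''e''))))
            (Seq (NArrAssign ''head'' (NArr ''row'' (NVar ''e'')) (NAdd (NVar ''e'') (NConst 1)))
              (NArrAssign ''col'' (NVar ''e'') (NVar ''i''))))
            Skip)
           (NAssign ''e'' (NAdd (NVar ''e'') (NConst 1))))
         (NAssign ''i'' (NAdd (NVar ''i'') (NConst 1)))))"

text \<open>The arrays are fixed as total functions, zeros outside the used range included: the
  later run is identified through its whole input store, not just through the cells it
  reads.\<close>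

definition linked :: "nat \<Rightarrow> nat \<Rightarrow> (nat \<Rightarrow> nat) \<Rightarrow> nat \<Rightarrow> store \<Rightarrow> bool" where
  "linked D h rf e s \<longleftrightarrow>
     narr s ''head'' = (\<lambda>r. if r < h then prev_entry rf r e else 0) \<and>
     narr s ''nxt'' = (\<lambda>x. if x < e \<and> rf x < h then prev_entry rf (rf x) x else 0) \<and>
     narr s ''col'' = (\<lambda>x. if x < e \<and> rf x < h then x div D else 0)"

lemma runs_link_prog:
  assumes s: "nvar s ''n'' = n" "nvar s ''N'' = h" "narr s ''row'' = rw" "\<And>i. i \<le> n \<Longrightarrow> narr s ''start'' i = D * i"
    "narr s ''head'' = (\<lambda>_. 0)" "narr s ''nxt'' = (\<lambda>_. 0)" "narr s ''col'' = (\<lambda>_. 0)"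
  shows "runs link_prog s ((n + D * n) * 9 + 3)
    (\<lambda>s'. nvar s' ''e'' = D * n \<and> nvar s' ''i'' = n \<and> linked D h (first_rows (D * n) h rw) (D * n) s')"
  unfolding link_prog_def
proof (rule runs_Seq'[where T = 2])
  define rf where "rf = first_rows (D * n) h rw"
  define I where "I s' \<longleftrightarrow> nvar s' ''n'' = n \<and> nvar s' ''N'' = h \<and> narr s' ''row'' = rw \<and>
    narr s' ''start'' = narr s ''start'' \<and>
    nvar s' ''i'' \<le> n \<and> D * nvar s' ''i'' \<le> nvar s' ''e'' \<and> nvar s' ''e'' \<le> D * n \<and>
    (nvar s' ''i'' < n \<longrightarrow> nvar s' ''e'' \<le> D * Suc (nvar s' ''i'')) \<and> linked D h rf (nvar s' ''e'') s'" for s' :: store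
  show "runs (Seq (NAssign ''e'' (NConst 0)) (NAssign ''i'' (NConst 0))) s 2
     (\<lambda>s'. I s' \<and> nvar s' ''i'' = 0 \<and> nvar s' ''e'' = 0)"
    by (rule runs_straight) (use s in \<open>simp_all add: I_def linked_def fun_eq_iff\<close>)
  fix s0 :: store assume s0: "I s0 \<and> nvar s0 ''i'' = 0 \<and> nvar s0 ''e'' = 0"
  let ?b = "NLess (NVar ''i'') (NVar ''n'')"
  let ?p = "Cond (NLess (NVar ''e'') (NArr ''start'' (NAdd (NVar ''i'') (NConst 1))))
         (Seq (Cond (NLess (NArr ''row'' (NVar ''e'')) (NVar ''N''))
            (Seq (NArrAssign ''nxt'' (NVar ''e'') (NArr ''head'' (NArr ''row'' (NVar ''e''))))
            (Seq (NArrAssign ''head'' (NArr ''row'' (NVar ''e'')) (NAdd (NVar ''e'') (NConst 1)))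
              (NArrAssign ''col'' (NVar ''e'') (NVar ''i''))))
            Skip)
           (NAssign ''e'' (NAdd (NVar ''e'') (NConst 1))))
         (NAssign ''i'' (NAdd (NVar ''i'') (NConst 1)))"
  \<comment> \<open>Columns left plus entries left; every round advances exactly one of the two
    counters.\<close>
  define \<mu> where "\<mu> s' = (n - nvar s' ''i'') + (D * n - nvar s' ''e'')" for s' :: store
  have "runs (While ?b ?p) s0 (\<mu> s0 * (8 + 1) + 1)
     (\<lambda>s'. I s' \<and> \<not> bval ?b s' \<and> agree_off (vars_written ?p) s0 s')"
  proof (rule runs_While)
    show "I s0" using s0 by simp
    fix s' :: store assume i: "I s'" and b: "bval ?b s'"
    define i where "i = nvar s' ''i''"
    define e where "e = nvar s' ''e''"
    have v: "nvar s' ''n'' = n" "nvar s' ''N'' = h" "narr s' ''row'' = rw" "i < n" "D * i \<le> e" "e \<le> D * Suc i"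
      "e \<le> D * n" "narr s' ''start'' (Suc i) = D * Suc i" "narr s' ''start'' = narr s ''start''"
      and l: "linked D h rf e s'"
      using i b s(4)[of "Suc i"] by (simp_all add: I_def i_def e_def)
    have n': "D * Suc i \<le> D * n" using v(4) by (intro mult_le_mono2) simp
    show "runs ?p s' 8 (\<lambda>s''. I s'' \<and> \<mu> s'' < \<mu> s')"
    proof (rule runs_straight)
      show "I (straight_result ?p s') \<and> \<mu> (straight_result ?p s') < \<mu> s'"
      proof (cases "e < D * Suc i")
        case False
        then have "e = D * Suc i" using v by simp
        then show ?thesis using v l
          by (auto simp: I_def \<mu>_def i_def[symmetric] e_def[symmetric] linked_def)
      next
        case True
        then have en: "e < D * n" using n' by linarith
        have dv: "e div D = i" using True v(5) by (intro div_nat_eqI) (auto simp: mult.commute)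
        show ?thesis
        proof (cases "rw e < h")
          case False
          then have "rf e = h" by (simp add: rf_def first_rows_def)
          then show ?thesis using v l True False en
            by (auto simp: I_def \<mu>_def i_def[symmetric] e_def[symmetric] linked_def fun_eq_iff less_Suc_eq)
        next
          case r: True
          then have "rf e = rw e" using en by (simp add: rf_def first_rows_def)
          then show ?thesis using v l True r en dv
            by (auto simp: I_def \<mu>_def i_def[symmetric] e_def[symmetric] linked_def fun_eq_iff less_Suc_eq)
        qed
      qed
    qed simp_all
  qed
  then show "runs (While ?b ?p) s0 ((n + D * n) * 9 + 1) (\<lambda>s'. nvar s' ''e'' = D * n \<and> nvar s' ''i'' = n \<and>
      linked D h (first_rows (D * n) h rw) (D * n) s')"
    by (rule runs_mono) (use s0 in \<open>auto simp: I_def \<mu>_def rf_def\<close>)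
qed simp

definition rank_prog :: com where
  "rank_prog = Seq sort_prog scan_prog"

definition rank_input :: "nat \<Rightarrow> nat \<Rightarrow> nat \<Rightarrow> (nat \<Rightarrow> nat) \<Rightarrow> (nat \<Rightarrow> real) \<Rightarrow> store" where
  "rank_input n D h rf key = \<lparr>
     nvar = (\<lambda>_. 0)(''N'' := h, ''D'' := D, ''e'' := D * n, ''i'' := n),
     rvar = (\<lambda>_. 0),
     narr = (\<lambda>_ _. 0)(''head'' := (\<lambda>r. if r < h then prev_entry rf r (D * n) else 0),
       ''nxt'' := (\<lambda>x. if x < D * n \<and> rf x < h then prev_entry rf (rf x) x else 0),
       ''col'' := (\<lambda>x. if x < D * n \<and> rf x < h then x div D else 0)),
     rarr = (\<lambda>_ _. 0)(''key'' := key)\<rparr>"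

text \<open>The final store is unique by determinism. Describing it through the canonical input,
  instead of taking it from an actual run on the full data, makes it a function of \<open>rf\<close>
  and \<open>key\<close> on which one can condition.\<close>

definition rank_output :: "nat \<Rightarrow> nat \<Rightarrow> nat \<Rightarrow> (nat \<Rightarrow> nat) \<Rightarrow> (nat \<Rightarrow> real) \<Rightarrow> store" where
  "rank_output n D h rf key = (SOME s'. \<exists>t. exec rank_prog (rank_input n D h rf key) t s')"

text \<open>Only the first half of the rows enters here, so the selected columns do not depend on the
  randomness of the other half.\<close>

definition candidates :: "nat \<Rightarrow> nat \<Rightarrow> nat \<Rightarrow> nat \<Rightarrow> (nat \<Rightarrow> nat) \<Rightarrow> (nat \<Rightarrow> real) \<Rightarrow> nat set" where
  "candidates M n D h rf key = narr (rank_output n D h rf key) ''sel'' `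
     {..<min M (nvar (rank_output n D h rf key) ''q'')}"

lemma com_vars_rank_prog: "com_vars rank_prog =
  {''N'', ''key'', ''win'', ''v'', ''par'', ''t'', ''j'', ''ord'', ''D'', ''head'', ''nxt'', ''col'',
   ''cnt'', ''sel'', ''p'', ''q'', ''e'', ''i'', ''c''}"
  by (auto simp: rank_prog_def sort_prog_def scan_prog_def scan_entry_def scan_row_def tree_leaves_def
      tree_build_def tree_extract_def tree_pop_def tree_climb_def tree_update_def)

definition select_prog :: com where
  "select_prog = Seq half_prog (Seq (NAssign ''D'' (NArr ''start'' (NConst 1))) (Seq link_prog rank_prog))"

definition csc_store :: "nat \<Rightarrow> nat \<Rightarrow> nat \<Rightarrow> nat \<Rightarrow> (nat \<Rightarrow> nat) \<Rightarrow> (nat \<Rightarrow> real) \<Rightarrow> (nat \<Rightarrow> real) \<Rightarrow> store \<Rightarrow> bool" where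
  "csc_store n m k D rw vl y s \<longleftrightarrow>
     nvar s = (\<lambda>_. 0)(''n'' := n, ''m'' := m, ''k'' := k) \<and> rvar s = (\<lambda>_. 0) \<and>
     (\<exists>st. narr s = (\<lambda>_ _. 0)(''start'' := st, ''row'' := rw) \<and> (\<forall>i\<le>n. st i = D * i)) \<and>
     rarr s = (\<lambda>_ _. 0)(''val'' := vl, ''y'' := y)"

definition select_written :: "(var_kind \<times> string) set" where
  "select_written = {(NV, ''N''), (RA, ''key''), (NA, ''win''), (NV, ''v''), (NA, ''par''), (NV, ''t''), (NV, ''j''), (NA, ''ord''), (NV, ''D''), (NA, ''head''), (NA, ''nxt''), (NA, ''col''), (NA, ''cnt''), (NA, ''sel''), (NV, ''p''), (NV, ''q''), (NV, ''e''), (NV, ''i''), (NV, ''c'')}"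

lemma vars_written_select [simp]:
  "vars_written half_prog = {(NV, ''N''), (RA, ''key'')}"
  "vars_written link_prog = {(NV, ''e''), (NV, ''i''), (NA, ''nxt''), (NA, ''head''), (NA, ''col'')}"
  "vars_written rank_prog = {(NV, ''j''), (NA, ''ord''), (RA, ''key''), (NV, ''v''), (NA, ''win''), (NV, ''t''), (NA, ''par''), (NV, ''e''), (NV, ''i''), (NA, ''cnt''), (NV, ''c''), (NA, ''sel''), (NV, ''q''), (NV, ''p'')}"
  "vars_written select_prog = select_written"
  by (auto simp: half_prog_def link_prog_def rank_prog_def select_prog_def select_written_def)

lemma runs_select_prog:
  assumes cs: "csc_store n m k D rw vl y s" and m: "m = 2 * h" "1 \<le> h" and n: "1 \<le> n" and D: "1 \<le> D"
  defines "rf \<equiv> first_rows (D * n) h rw"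
  defines "key \<equiv> (\<lambda>r. if r < h then (y r)\<^sup>2 else 0)"
  shows "runs select_prog s (h * (5 * floor_log (2 * h) + 34) + (n + D * n) * 23 + 20)
    (\<lambda>s'. nvar s' ''N'' = h \<and> nvar s' ''D'' = D \<and>
       narr s' ''sel'' = narr (rank_output n D h rf key) ''sel'' \<and>
       nvar s' ''q'' = nvar (rank_output n D h rf key) ''q'' \<and>
       inj_on (narr s' ''sel'') {..<nvar s' ''q''} \<and> narr s' ''sel'' ` {..<nvar s' ''q''} \<subseteq> {..<n} \<and>
       (\<forall>M \<tau>. card (heavy_columns_of n D h rf key \<tau>) \<le> M \<longrightarrow>
          heavy_columns_of n D h rf key \<tau> \<subseteq> candidates M n D h rf key))"
    (is "runs _ _ _ ?Q")
proof -
  obtain st where nv: "nvar s = (\<lambda>_. 0)(''n'' := n, ''m'' := m, ''k'' := k)" and rv: "rvar s = (\<lambda>_. 0)"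
    and na: "narr s = (\<lambda>_ _. 0)(''start'' := st, ''row'' := rw)" and st: "\<And>i. i \<le> n \<Longrightarrow> st i = D * i"
    and ra: "rarr s = (\<lambda>_ _. 0)(''val'' := vl, ''y'' := y)"
    using cs unfolding csc_store_def by blast
  have *: "runs rank_prog s3 (h * (5 * floor_log (2 * h) + 17) + 6 + ((h + D * n) * 14 + 4)) ?Q"
    if ag: "agree_off {(NV, ''N''), (RA, ''key''), (NV, ''D''), (NV, ''e''), (NV, ''i''), (NA, ''nxt''), (NA, ''head''), (NA, ''col'')} s s3"
      and s3: "nvar s3 ''N'' = h" "nvar s3 ''D'' = D" "nvar s3 ''e'' = D * n" "nvar s3 ''i'' = n"
        "rarr s3 ''key'' = key" "linked D h rf (D * n) s3"
    for s3
  proof -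
    \<comment> \<open>After clearing what \<open>rank_prog\<close> does not mention, in particular
      the measurements, the values and the row indices, the store is literally the canonical input.
      Hence \<open>sel\<close> and \<open>q\<close> of the actual run agree with
      \<open>rank_output\<close>.\<close>
    have cl: "clear_off (com_vars rank_prog) s3 = rank_input n D h rf key"
    proof (rule store.equality)
      show "nvar (clear_off (com_vars rank_prog) s3) = nvar (rank_input n D h rf key)"
        unfolding com_vars_rank_prog
        using s3 agree_offD(1)[OF ag] by (auto simp: clear_off_simps rank_input_def fun_eq_iff nv)
      show "rvar (clear_off (com_vars rank_prog) s3) = rvar (rank_input n D h rf key)"
        using agree_offD(2)[OF ag] by (auto simp: rv clear_off_simps rank_input_def fun_eq_iff)
      show "narr (clear_off (com_vars rank_prog) s3) = narr (rank_input n D h rf key)"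
        unfolding com_vars_rank_prog
        using s3(6) agree_offD(3)[OF ag] by (auto simp: clear_off_simps rank_input_def fun_eq_iff na linked_def)
      show "rarr (clear_off (com_vars rank_prog) s3) = rarr (rank_input n D h rf key)"
        unfolding com_vars_rank_prog
        using s3(5) agree_offD(4)[OF ag] by (auto simp: clear_off_simps rank_input_def fun_eq_iff ra)
    qed simp
    have out: "narr s4 ''sel'' = narr (rank_output n D h rf key) ''sel''"
      "nvar s4 ''q'' = nvar (rank_output n D h rf key) ''q''" if ex: "exec rank_prog s3 t s4" for t s4
    proof -
      have e: "exec rank_prog (rank_input n D h rf key) t (clear_off (com_vars rank_prog) s4)"
        using exec_clear_off[OF ex order_refl] cl by simp
      have "rank_output n D h rf key = clear_off (com_vars rank_prog) s4"
        unfolding rank_output_def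
        by (rule some_equality) (use e exec_deterministic in blast)+
      then show "narr s4 ''sel'' = narr (rank_output n D h rf key) ''sel''"
        "nvar s4 ''q'' = nvar (rank_output n D h rf key) ''q''"
        by (simp_all add: clear_off_simps com_vars_rank_prog)
    qed
    have "runs rank_prog s3 (h * (5 * floor_log (2 * h) + 17) + 6 + ((h + D * n) * 14 + 4))
      (\<lambda>s'. inj_on (narr s' ''sel'') {..<nvar s' ''q''} \<and> narr s' ''sel'' ` {..<nvar s' ''q''} \<subseteq> {..<n} \<and>
       (\<forall>M \<tau>. card (heavy_columns_of n D h rf key \<tau>) \<le> M \<longrightarrow>
          heavy_columns_of n D h rf key \<tau> \<subseteq> narr s' ''sel'' ` {..<min M (nvar s' ''q'')}))"
      unfolding rank_prog_def
    proof (rule runs_Seq)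
      show "runs sort_prog s3 (h * (5 * floor_log (2 * h) + 17) + 6)
        (\<lambda>s'. bij_betw (narr s' ''ord'') {..<h} {..<h} \<and>
          (\<forall>u t. u \<le> t \<longrightarrow> t < h \<longrightarrow>
            rarr s3 ''key'' (narr s' ''ord'' t) \<le> rarr s3 ''key'' (narr s' ''ord'' u)))"
        by (rule runs_sort_prog) (use s3 m in \<open>simp_all add: key_def\<close>)
      fix s4 assume s4: "bij_betw (narr s4 ''ord'') {..<h} {..<h} \<and>
          (\<forall>u t. u \<le> t \<longrightarrow> t < h \<longrightarrow>
            rarr s3 ''key'' (narr s4 ''ord'' t) \<le> rarr s3 ''key'' (narr s4 ''ord'' u))"
        and a4: "agree_off (vars_written sort_prog) s3 s4"
      interpret column_scan n D h rf "narr s4 ''ord''" key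
        by unfold_locales (use D s4 s3(5) in auto)
      have f: "nvar s4 ''N'' = h" "nvar s4 ''D'' = D" "narr s4 ''head'' = narr s3 ''head''"
        "narr s4 ''nxt'' = narr s3 ''nxt''" "narr s4 ''col'' = narr s3 ''col''" "narr s4 ''cnt'' = (\<lambda>_. 0)"
        using agree_offD[OF a4, of "''N''"] agree_offD[OF a4, of "''D''"] agree_offD[OF a4, of "''head''"]
          agree_offD[OF a4, of "''nxt''"] agree_offD[OF a4, of "''col''"] agree_offD[OF a4, of "''cnt''"]
          agree_offD[OF ag, of "''cnt''"] s3 na by auto
      have "runs scan_prog s4 ((h + D * n) * 14 + 4)
          (\<lambda>s'. \<exists>cnt. scan_inv h 0 (nvar s' ''q'') cnt (narr s' ''sel''))"
        by (rule runs_scan_prog) (use f s3(6) in \<open>auto simp: linked_def\<close>)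
      then show "runs scan_prog s4 ((h + D * n) * 14 + 4) (\<lambda>s'. inj_on (narr s' ''sel'') {..<nvar s' ''q''} \<and>
          narr s' ''sel'' ` {..<nvar s' ''q''} \<subseteq> {..<n} \<and>
         (\<forall>M \<tau>. card (heavy_columns \<tau>) \<le> M \<longrightarrow>
          heavy_columns \<tau> \<subseteq> narr s' ''sel'' ` {..<min M (nvar s' ''q'')}))"
        by (rule runs_mono) (use scan_inv_final in blast)+
    qed
    then obtain t s4 where ex: "exec rank_prog s3 t s4" "t \<le> h * (5 * floor_log (2 * h) + 17) + 6 + ((h + D * n) * 14 + 4)"
      and q4: "inj_on (narr s4 ''sel'') {..<nvar s4 ''q''} \<and> narr s4 ''sel'' ` {..<nvar s4 ''q''} \<subseteq> {..<n} \<and>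
       (\<forall>M \<tau>. card (heavy_columns_of n D h rf key \<tau>) \<le> M \<longrightarrow>
          heavy_columns_of n D h rf key \<tau> \<subseteq> narr s4 ''sel'' ` {..<min M (nvar s4 ''q'')})"
      unfolding runs_def by blast
    have f: "nvar s4 ''N'' = h" "nvar s4 ''D'' = D"
      using agree_offD[OF exec_agree_off[OF ex(1)], of "''N''"] agree_offD[OF exec_agree_off[OF ex(1)], of "''D''"] s3 by auto
    have "?Q s4" using f q4 unfolding out[OF ex(1)] candidates_def by blast
    then show ?thesis unfolding runs_def using ex by blast
  qed
  show ?thesis
    unfolding select_prog_def
  proof (rule runs_Seq')
    show "runs half_prog s (h * 3 + 2) (\<lambda>s'. nvar s' ''N'' = h \<and>
      rarr s' ''key'' = (\<lambda>r. if r < h then (rarr s ''y'' r)\<^sup>2 else 0))"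
      by (rule runs_half_prog) (simp_all add: nv m ra)
    fix s1 assume s1: "nvar s1 ''N'' = h \<and> rarr s1 ''key'' = (\<lambda>r. if r < h then (rarr s ''y'' r)\<^sup>2 else 0)"
      and a1: "agree_off (vars_written half_prog) s s1"
    show "runs (Seq (NAssign ''D'' (NArr ''start'' (NConst 1))) (Seq link_prog rank_prog)) s1
      (1 + ((n + D * n) * 9 + 3 + (h * (5 * floor_log (2 * h) + 17) + 6 + ((h + D * n) * 14 + 4)))) ?Q"
    proof (rule runs_Seq)
      show "runs (NAssign ''D'' (NArr ''start'' (NConst 1))) s1 1
        (\<lambda>s'. s' = s1\<lparr>nvar := (nvar s1)(''D'' := D)\<rparr>)"
        by (rule runs_straight) (use agree_offD(3)[OF a1, of "''start''"] st[of 1] n in \<open>simp_all add: na\<close>)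
      fix s2 assume s2: "s2 = s1\<lparr>nvar := (nvar s1)(''D'' := D)\<rparr>"
      note f1 = agree_offD[OF a1]
      have f2: "nvar s2 ''n'' = n" "nvar s2 ''N'' = h" "narr s2 ''row'' = rw" "\<And>i. i \<le> n \<Longrightarrow> narr s2 ''start'' i = D * i"
         "narr s2 ''head'' = (\<lambda>_. 0)" "narr s2 ''nxt'' = (\<lambda>_. 0)" "narr s2 ''col'' = (\<lambda>_. 0)"
        "nvar s2 ''D'' = D" "rarr s2 ''key'' = key"
        using s1 f1(1)[of "''n''"] f1(3)[of "''row''"] f1(3)[of "''start''"] f1(3)[of "''head''"]
          f1(3)[of "''nxt''"] f1(3)[of "''col''"] st by (simp_all add: s2 nv na ra key_def fun_eq_iff)
      show "runs (Seq link_prog rank_prog) s2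
        ((n + D * n) * 9 + 3 + (h * (5 * floor_log (2 * h) + 17) + 6 + ((h + D * n) * 14 + 4))) ?Q"
      proof (rule runs_Seq[OF runs_link_prog[OF f2(1-7)]])
        fix s3 assume s3: "nvar s3 ''e'' = D * n \<and> nvar s3 ''i'' = n \<and> linked D h (first_rows (D * n) h rw) (D * n) s3"
          and a3: "agree_off (vars_written link_prog) s2 s3"
        note f3 = agree_offD[OF a3]
        show "runs rank_prog s3 (h * (5 * floor_log (2 * h) + 17) + 6 + ((h + D * n) * 14 + 4)) ?Q"
        proof (rule *)
          have "agree_off {(NV, ''D'')} s1 s2" by (simp add: s2 agree_off_def)
          then show "agree_off {(NV, ''N''), (RA, ''key''), (NV, ''D''), (NV, ''e''), (NV, ''i''), (NA, ''nxt''), (NA, ''head''), (NA, ''col'')} s s3"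
            using a1 a3 by (auto simp: agree_off_def)
        qed (use s3 f3(1)[of "''N''"] f3(1)[of "''D''"] f3(4)[of "''key''"] f2 in \<open>auto simp: rf_def\<close>)
      qed
    qed
  qed (simp add: algebra_simps)
qed

section \<open>Estimating the selected entries\<close>

text \<open>Multiplication by a constant is unrolled into additions, so the factor becomes part of
  the program text.\<close>

fun nscale :: "nat \<Rightarrow> nexp \<Rightarrow> nexp" where
  "nscale 0 e = NConst 0"
| "nscale (Suc c) e = NAdd (nscale c e) e"

lemma nval_nscale [simp]: "nval (nscale c e) s = c * nval e s"
  by (induction c) auto

definition cap_prog :: "nat \<Rightarrow> com" where
  "cap_prog C = Cond (NLess (nscale C (NVar ''k'')) (NVar ''q''))
     (NAssign ''Q'' (nscale C (NVar ''k''))) (NAssign ''Q'' (NVar ''q''))"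

text \<open>Index pairs already visited by a double loop that is written as one loop with counters
  \<open>u\<close> and \<open>d\<close>.\<close>

definition lex_below :: "nat \<Rightarrow> nat \<Rightarrow> nat \<Rightarrow> (nat \<times> nat) set" where
  "lex_below D u d = {..<u} \<times> {..<D} \<union> {u} \<times> {..<d}"

lemma lex_below_simps:
  "lex_below D 0 0 = {}" "lex_below D (Suc u) 0 = lex_below D u D"
  "lex_below D u (Suc d) = insert (u, d) (lex_below D u d)" "(u, d) \<notin> lex_below D u d"
  "finite (lex_below D u d)" "lex_below D u 0 = {..<u} \<times> {..<D}"
  by (auto simp: lex_below_def less_Suc_eq)

text \<open>The counters allow the next pass to decide in constant time whether a row is shared by
  selected columns; comparing the columns pairwise would be too slow.\<close>

definition occ_prog :: com where
  "occ_prog = Seq (Seq (NAssign ''u'' (NConst 0)) (NAssign ''d'' (NConst 0)))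
    (While (NLess (NVar ''u'') (NVar ''Q''))
      (Cond (NLess (NVar ''d'') (NVar ''D''))
        (Seq (NAssign ''e'' (NAdd (NArr ''start'' (NArr ''sel'' (NVar ''u''))) (NVar ''d'')))
        (Seq (Cond (NLess (NArr ''row'' (NVar ''e'')) (NVar ''N'')) Skip
              (NArrAssign ''occ'' (NArr ''row'' (NVar ''e'')) (NAdd (NArr ''occ'' (NArr ''row'' (NVar ''e''))) (NConst 1))))
          (NAssign ''d'' (NAdd (NVar ''d'') (NConst 1)))))
        (Seq (NAssign ''u'' (NAdd (NVar ''u'') (NConst 1))) (NAssign ''d'' (NConst 0)))))"

lemma runs_occ_prog:
  assumes s: "nvar s ''Q'' = Q" "nvar s ''D'' = D" "nvar s ''N'' = h" "narr s ''sel'' = sel"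
    "narr s ''row'' = rw" "\<And>u. u < Q \<Longrightarrow> narr s ''start'' (sel u) = D * sel u" "narr s ''occ'' = (\<lambda>_. 0)"
  shows "runs occ_prog s (Q * (D + 1) * 9 + 3) (\<lambda>s'. narr s' ''occ'' =
    (\<lambda>r. card {z. z \<in> {..<Q} \<times> {..<D} \<and> rw (D * sel (fst z) + snd z) = r \<and> h \<le> r}))"
  unfolding occ_prog_def
proof (rule runs_Seq'[where T = 2])
  define oc where "oc u d = (\<lambda>r. card {z. z \<in> lex_below D u d \<and> rw (D * sel (fst z) + snd z) = r \<and> h \<le> r})" for u d
  have oc0: "oc 0 0 = (\<lambda>_. 0)" by (simp add: oc_def lex_below_simps)
  have ocD: "oc u D = oc (Suc u) 0" for u by (simp add: oc_def lex_below_simps(2))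
  have ocS: "oc u (Suc d) = (if h \<le> rw (D * sel u + d) then (oc u d)(rw (D * sel u + d) := Suc (oc u d (rw (D * sel u + d))))
      else oc u d)" for u d
  proof
    fix r
    define A where "A = {z. z \<in> lex_below D u d \<and> rw (D * sel (fst z) + snd z) = r \<and> h \<le> r}"
    have fin: "finite A" "(u, d) \<notin> A"
      unfolding A_def by (simp_all add: lex_below_simps(4,5))
    have *: "{z. z \<in> lex_below D u (Suc d) \<and> rw (D * sel (fst z) + snd z) = r \<and> h \<le> r} =
      (if rw (D * sel u + d) = r \<and> h \<le> r then insert (u, d) A else A)"
      by (auto simp: lex_below_simps A_def)
    show "oc u (Suc d) r = (if h \<le> rw (D * sel u + d) then (oc u d)(rw (D * sel u + d) := Suc (oc u d (rw (D * sel u + d))))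
      else oc u d) r"
    proof (cases "rw (D * sel u + d) = r")
      case True
      then show ?thesis using fin * by (auto simp: oc_def A_def)
    next
      case False
      then show ?thesis using fin * by (auto simp: oc_def A_def)
    qed
  qed
  define I where "I s' \<longleftrightarrow> nvar s' ''Q'' = Q \<and> nvar s' ''D'' = D \<and> nvar s' ''N'' = h \<and> narr s' ''sel'' = sel \<and>
    narr s' ''row'' = rw \<and> narr s' ''start'' = narr s ''start'' \<and> nvar s' ''u'' \<le> Q \<and> nvar s' ''d'' \<le> D \<and>
    (nvar s' ''u'' = Q \<longrightarrow> nvar s' ''d'' = 0) \<and> narr s' ''occ'' = oc (nvar s' ''u'') (nvar s' ''d'')" for s' :: store
  show "runs (Seq (NAssign ''u'' (NConst 0)) (NAssign ''d'' (NConst 0))) s 2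
     (\<lambda>s'. I s' \<and> nvar s' ''u'' = 0 \<and> nvar s' ''d'' = 0)"
    by (rule runs_straight) (use s oc0 in \<open>simp_all add: I_def\<close>)
  fix s0 :: store assume s0: "I s0 \<and> nvar s0 ''u'' = 0 \<and> nvar s0 ''d'' = 0"
  let ?b = "NLess (NVar ''u'') (NVar ''Q'')"
  let ?p = "Cond (NLess (NVar ''d'') (NVar ''D''))
        (Seq (NAssign ''e'' (NAdd (NArr ''start'' (NArr ''sel'' (NVar ''u''))) (NVar ''d'')))
        (Seq (Cond (NLess (NArr ''row'' (NVar ''e'')) (NVar ''N'')) Skip
              (NArrAssign ''occ'' (NArr ''row'' (NVar ''e'')) (NAdd (NArr ''occ'' (NArr ''row'' (NVar ''e''))) (NConst 1))))
          (NAssign ''d'' (NAdd (NVar ''d'') (NConst 1)))))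
        (Seq (NAssign ''u'' (NAdd (NVar ''u'') (NConst 1))) (NAssign ''d'' (NConst 0)))"
  define \<mu> where "\<mu> s' = (Q - nvar s' ''u'') * (D + 1) - nvar s' ''d''" for s' :: store
  have "runs (While ?b ?p) s0 (\<mu> s0 * (8 + 1) + 1)
     (\<lambda>s'. I s' \<and> \<not> bval ?b s' \<and> agree_off (vars_written ?p) s0 s')"
  proof (rule runs_While)
    show "I s0" using s0 by simp
    fix s' :: store assume i: "I s'" and b: "bval ?b s'"
    define u where "u = nvar s' ''u''"
    define d where "d = nvar s' ''d''"
    have v: "nvar s' ''Q'' = Q" "nvar s' ''D'' = D" "nvar s' ''N'' = h" "narr s' ''sel'' = sel"
      "narr s' ''row'' = rw" "narr s' ''start'' = narr s ''start''" "u < Q" "d \<le> D" "narr s' ''occ'' = oc u d"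
      "narr s ''start'' (sel u) = D * sel u"
      using i b s(6)[of u] by (simp_all add: I_def u_def d_def)
    have q: "(Q - u) * (D + 1) = (Q - Suc u) * (D + 1) + (D + 1)"
      using v(7) by (metis Suc_diff_Suc add.commute mult_Suc)
    show "runs ?p s' 8 (\<lambda>s''. I s'' \<and> \<mu> s'' < \<mu> s')"
    proof (rule runs_straight)
      show "I (straight_result ?p s') \<and> \<mu> (straight_result ?p s') < \<mu> s'"
      proof (cases "d < D")
        case False
        then have "d = D" using v by simp
        then show ?thesis using v q ocD
          by (simp add: I_def \<mu>_def u_def[symmetric] d_def[symmetric])
      next
        case True
        then show ?thesis using v q ocS
          by (simp add: I_def \<mu>_def u_def[symmetric] d_def[symmetric])
      qed
    qed simp_all
  qed
  then show "runs (While ?b ?p) s0 (Q * (D + 1) * 9 + 1) (\<lambda>s'. narr s' ''occ'' =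
      (\<lambda>r. card {z. z \<in> {..<Q} \<times> {..<D} \<and> rw (D * sel (fst z) + snd z) = r \<and> h \<le> r}))"
    by (rule runs_mono) (use s0 in \<open>auto simp: I_def \<mu>_def oc_def lex_below_simps\<close>)
qed simp

definition est_prog :: com where
  "est_prog = Seq (Seq (Seq (NAssign ''u'' (NConst 0)) (NAssign ''d'' (NConst 0)))
      (Seq (RAssign ''z'' (RConst 0)) (RAssign ''w'' (RConst 0))))
    (While (NLess (NVar ''u'') (NVar ''Q''))
      (Cond (NLess (NVar ''d'') (NVar ''D''))
        (Seq (NAssign ''e'' (NAdd (NArr ''start'' (NArr ''sel'' (NVar ''u''))) (NVar ''d'')))
        (Seq (Cond (BAnd (BNot (NLess (NArr ''row'' (NVar ''e'')) (NVar ''N'')))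
                (NLess (NArr ''occ'' (NArr ''row'' (NVar ''e''))) (NConst 2)))
              (Seq (RAssign ''z'' (RAdd (RVar ''z'') (RMul (RArr ''val'' (NVar ''e'')) (RArr ''y'' (NArr ''row'' (NVar ''e''))))))
                (RAssign ''w'' (RAdd (RVar ''w'') (RConst 1))))
              Skip)
          (NAssign ''d'' (NAdd (NVar ''d'') (NConst 1)))))
        (Seq (RArrAssign ''xh'' (NArr ''sel'' (NVar ''u'')) (RDiv (RVar ''z'') (RVar ''w'')))
          (Seq (Seq (NAssign ''u'' (NAdd (NVar ''u'') (NConst 1))) (NAssign ''d'' (NConst 0)))
            (Seq (RAssign ''z'' (RConst 0)) (RAssign ''w'' (RConst 0)))))))"

definition clean :: "nat \<Rightarrow> nat \<Rightarrow> (nat \<Rightarrow> nat) \<Rightarrow> (nat \<Rightarrow> nat) \<Rightarrow> nat \<Rightarrow> nat \<Rightarrow> nat set" where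
  "clean D h rw oc i d = {d'. d' < d \<and> h \<le> rw (D * i + d') \<and> oc (rw (D * i + d')) < 2}"

text \<open>For a column without clean rows this is 0, by division by zero; the machine's division
  has the same convention, so the program needs no test.\<close>

definition clean_mean where
  "clean_mean D h rw oc vl y i = (\<Sum>d\<in>clean D h rw oc i D. vl (D * i + d) * y (rw (D * i + d))) /
     real (card (clean D h rw oc i D))"

lemma runs_est_prog:
  assumes s: "nvar s ''Q'' = Q" "nvar s ''D'' = D" "nvar s ''N'' = h" "narr s ''sel'' = sel"
    "narr s ''row'' = rw" "\<And>u. u < Q \<Longrightarrow> narr s ''start'' (sel u) = D * sel u" "narr s ''occ'' = oc"
    "rarr s ''val'' = vl" "rarr s ''y'' = y" "rarr s ''xh'' = (\<lambda>_. 0)"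
  shows "runs est_prog s (Q * (D + 1) * 13 + 5) (\<lambda>s'. rarr s' ''xh'' =
    (\<lambda>i. if i \<in> sel ` {..<Q} then clean_mean D h rw oc vl y i else 0))"
  unfolding est_prog_def
proof (rule runs_Seq'[where T = 4])
  let ?cl = "clean D h rw oc"
  have fin: "finite (?cl i d)" "d \<notin> ?cl i d" for i d by (auto simp: clean_def)
  have clS: "?cl i (Suc d) = (if h \<le> rw (D * i + d) \<and> oc (rw (D * i + d)) < 2 then insert d (?cl i d) else ?cl i d)" for i d
    by (auto simp: clean_def less_Suc_eq)
  define zz where "zz i d = (\<Sum>d\<in>?cl i d. vl (D * i + d) * y (rw (D * i + d)))" for i d
  define ww where "ww i d = real (card (?cl i d))" for i d
  have z0: "zz i 0 = 0" "ww i 0 = 0" for i by (simp_all add: zz_def ww_def clean_def)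
  have zS: "h \<le> rw (D * i + d) \<Longrightarrow> oc (rw (D * i + d)) < 2 \<Longrightarrow> zz i (Suc d) = zz i d + vl (D * i + d) * y (rw (D * i + d))"
    "h \<le> rw (D * i + d) \<Longrightarrow> oc (rw (D * i + d)) < 2 \<Longrightarrow> ww i (Suc d) = ww i d + 1"
    "\<not> (h \<le> rw (D * i + d) \<and> oc (rw (D * i + d)) < 2) \<Longrightarrow> zz i (Suc d) = zz i d \<and> ww i (Suc d) = ww i d" for i d
    using fin by (auto simp: zz_def ww_def clS)
  have zD: "zz i D / ww i D = clean_mean D h rw oc vl y i" for i by (simp add: zz_def ww_def clean_mean_def)
  define xx where "xx u = (\<lambda>i. if i \<in> sel ` {..<u} then clean_mean D h rw oc vl y i else 0)" for u
  have xS: "xx (Suc u) = (xx u)(sel u := clean_mean D h rw oc vl y (sel u))" for u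
    by (auto simp: xx_def fun_eq_iff less_Suc_eq)
  define I where "I s' \<longleftrightarrow> nvar s' ''Q'' = Q \<and> nvar s' ''D'' = D \<and> nvar s' ''N'' = h \<and> narr s' ''sel'' = sel \<and>
    narr s' ''row'' = rw \<and> narr s' ''start'' = narr s ''start'' \<and> narr s' ''occ'' = oc \<and> rarr s' ''val'' = vl \<and>
    rarr s' ''y'' = y \<and> nvar s' ''u'' \<le> Q \<and> nvar s' ''d'' \<le> D \<and>
    rvar s' ''z'' = zz (sel (nvar s' ''u'')) (nvar s' ''d'') \<and> rvar s' ''w'' = ww (sel (nvar s' ''u'')) (nvar s' ''d'') \<and>
    rarr s' ''xh'' = xx (nvar s' ''u'')" for s' :: store
  show "runs (Seq (Seq (NAssign ''u'' (NConst 0)) (NAssign ''d'' (NConst 0)))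
      (Seq (RAssign ''z'' (RConst 0)) (RAssign ''w'' (RConst 0)))) s 4
     (\<lambda>s'. I s' \<and> nvar s' ''u'' = 0 \<and> nvar s' ''d'' = 0)"
    by (rule runs_straight) (use s z0 in \<open>simp_all add: I_def xx_def\<close>)
  fix s0 :: store assume s0: "I s0 \<and> nvar s0 ''u'' = 0 \<and> nvar s0 ''d'' = 0"
  let ?b = "NLess (NVar ''u'') (NVar ''Q'')"
  let ?p = "Cond (NLess (NVar ''d'') (NVar ''D''))
        (Seq (NAssign ''e'' (NAdd (NArr ''start'' (NArr ''sel'' (NVar ''u''))) (NVar ''d'')))
        (Seq (Cond (BAnd (BNot (NLess (NArr ''row'' (NVar ''e'')) (NVar ''N'')))
                (NLess (NArr ''occ'' (NArr ''row'' (NVar ''e''))) (NConst 2)))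
              (Seq (RAssign ''z'' (RAdd (RVar ''z'') (RMul (RArr ''val'' (NVar ''e'')) (RArr ''y'' (NArr ''row'' (NVar ''e''))))))
                (RAssign ''w'' (RAdd (RVar ''w'') (RConst 1))))
              Skip)
          (NAssign ''d'' (NAdd (NVar ''d'') (NConst 1)))))
        (Seq (RArrAssign ''xh'' (NArr ''sel'' (NVar ''u'')) (RDiv (RVar ''z'') (RVar ''w'')))
          (Seq (Seq (NAssign ''u'' (NAdd (NVar ''u'') (NConst 1))) (NAssign ''d'' (NConst 0)))
            (Seq (RAssign ''z'' (RConst 0)) (RAssign ''w'' (RConst 0)))))"
  define \<mu> where "\<mu> s' = (Q - nvar s' ''u'') * (D + 1) - nvar s' ''d''" for s' :: store
  have "runs (While ?b ?p) s0 (\<mu> s0 * (12 + 1) + 1)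
     (\<lambda>s'. I s' \<and> \<not> bval ?b s' \<and> agree_off (vars_written ?p) s0 s')"
  proof (rule runs_While)
    show "I s0" using s0 by simp
    fix s' :: store assume i: "I s'" and b: "bval ?b s'"
    define u where "u = nvar s' ''u''"
    define d where "d = nvar s' ''d''"
    have v: "nvar s' ''Q'' = Q" "nvar s' ''D'' = D" "nvar s' ''N'' = h" "narr s' ''sel'' = sel"
      "narr s' ''row'' = rw" "narr s' ''start'' = narr s ''start''" "u < Q" "d \<le> D" "narr s' ''occ'' = oc"
      "narr s ''start'' (sel u) = D * sel u" "rarr s' ''val'' = vl" "rarr s' ''y'' = y"
      "rvar s' ''z'' = zz (sel u) d" "rvar s' ''w'' = ww (sel u) d" "rarr s' ''xh'' = xx u"
      using i b s(6)[of u] by (simp_all add: I_def u_def d_def)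
    have q: "(Q - u) * (D + 1) = (Q - Suc u) * (D + 1) + (D + 1)"
      using v(7) by (metis Suc_diff_Suc add.commute mult_Suc)
    show "runs ?p s' 12 (\<lambda>s''. I s'' \<and> \<mu> s'' < \<mu> s')"
    proof (rule runs_straight)
      show "I (straight_result ?p s') \<and> \<mu> (straight_result ?p s') < \<mu> s'"
      proof (cases "d < D")
        case False
        then have "d = D" using v by simp
        then show ?thesis using v q z0 zD xS
          by (simp add: I_def \<mu>_def u_def[symmetric] d_def[symmetric])
      next
        case True
        show ?thesis
        proof (cases "h \<le> rw (D * sel u + d) \<and> oc (rw (D * sel u + d)) < 2")
          case c: True
          then show ?thesis using v q zS(1,2)[of "sel u" d] True
            by (simp add: I_def \<mu>_def u_def[symmetric] d_def[symmetric])
        next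
          case c: False
          then show ?thesis using v q zS(3)[of "sel u" d] True
            by (auto simp: I_def \<mu>_def u_def[symmetric] d_def[symmetric])
        qed
      qed
    qed simp_all
  qed
  then show "runs (While ?b ?p) s0 (Q * (D + 1) * 13 + 1) (\<lambda>s'. rarr s' ''xh'' =
      (\<lambda>i. if i \<in> sel ` {..<Q} then clean_mean D h rw oc vl y i else 0))"
    by (rule runs_mono) (use s0 in \<open>auto simp: I_def \<mu>_def xx_def\<close>)
qed simp

section \<open>Output of the largest estimates\<close>

definition out_prog :: com where
  "out_prog = Seq (NAssign ''N'' (NVar ''n'')) (Seq (Seq (NAssign ''i'' (NConst 0))
      (While (NLess (NVar ''i'') (NVar ''N''))
        (Seq (RArrAssign ''key'' (NVar ''i'') (RMul (RArr ''xh'' (NVar ''i'')) (RArr ''xh'' (NVar ''i''))))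
          (NAssign ''i'' (NAdd (NVar ''i'') (NConst 1))))))
    (Seq sort_prog (Seq (NAssign ''t'' (NConst 0))
      (While (BAnd (NLess (NVar ''t'') (NVar ''n'')) (NLess (NVar ''t'') (NVar ''k'')))
        (Seq (RArrAssign ''x'' (NArr ''ord'' (NVar ''t'')) (RArr ''xh'' (NArr ''ord'' (NVar ''t''))))
          (NAssign ''t'' (NAdd (NVar ''t'') (NConst 1))))))))"

lemma runs_out_prog:
  assumes s: "nvar s ''n'' = n" "nvar s ''k'' = k" "rarr s ''xh'' = xh" "rarr s ''x'' = (\<lambda>_. 0)" and n: "1 \<le> n"
  shows "runs out_prog s (n * (5 * floor_log (2 * n) + 23) + 11) (\<lambda>s'. \<exists>T\<subseteq>{..<n}. card T = min n k \<and>
    rarr s' ''x'' = (\<lambda>i. if i \<in> T then xh i else 0) \<and>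
    (\<forall>i\<in>T. \<forall>l\<in>{..<n} - T. (xh l)\<^sup>2 \<le> (xh i)\<^sup>2))" (is "runs _ _ _ ?Q")
proof -
  have 1: "runs (Seq (NAssign ''i'' (NConst 0))
      (While (NLess (NVar ''i'') (NVar ''N''))
        (Seq (RArrAssign ''key'' (NVar ''i'') (RMul (RArr ''xh'' (NVar ''i'')) (RArr ''xh'' (NVar ''i''))))
          (NAssign ''i'' (NAdd (NVar ''i'') (NConst 1)))))) s1 (n * 3 + 2)
      (\<lambda>s'. \<forall>i<n. rarr s' ''key'' i = (xh i)\<^sup>2)" if s1: "nvar s1 ''N'' = n" "rarr s1 ''xh'' = xh" for s1
  proof (rule runs_Seq'[where T = 1])
    define I where "I s' \<longleftrightarrow> nvar s' ''N'' = n \<and> rarr s' ''xh'' = xh \<and> nvar s' ''i'' \<le> n \<and>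
      (\<forall>i<nvar s' ''i''. rarr s' ''key'' i = (xh i)\<^sup>2)" for s' :: store
    show "runs (NAssign ''i'' (NConst 0)) s1 1 (\<lambda>s'. I s' \<and> nvar s' ''i'' = 0)"
      by (rule runs_straight) (use s1 in \<open>simp_all add: I_def\<close>)
    fix s0 :: store assume s0: "I s0 \<and> nvar s0 ''i'' = 0"
    let ?b = "NLess (NVar ''i'') (NVar ''N'')"
    let ?p = "Seq (RArrAssign ''key'' (NVar ''i'') (RMul (RArr ''xh'' (NVar ''i'')) (RArr ''xh'' (NVar ''i''))))
          (NAssign ''i'' (NAdd (NVar ''i'') (NConst 1)))"
    have "runs (While ?b ?p) s0 ((n - nvar s0 ''i'') * (2 + 1) + 1)
       (\<lambda>s'. I s' \<and> \<not> bval ?b s' \<and> agree_off (vars_written ?p) s0 s')"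
    proof (rule runs_While)
      show "I s0" using s0 by simp
      fix s' :: store assume i: "I s'" "bval ?b s'"
      then show "runs ?p s' 2 (\<lambda>s''. I s'' \<and> n - nvar s'' ''i'' < n - nvar s' ''i'')"
        by (intro runs_straight) (auto simp: I_def power2_eq_square less_Suc_eq)
    qed
    then show "runs (While ?b ?p) s0 (n * 3 + 1) (\<lambda>s'. \<forall>i<n. rarr s' ''key'' i = (xh i)\<^sup>2)"
      by (rule runs_mono) (use s0 in \<open>auto simp: I_def\<close>)
  qed simp
  have 2: "runs (Seq (NAssign ''t'' (NConst 0))
      (While (BAnd (NLess (NVar ''t'') (NVar ''n'')) (NLess (NVar ''t'') (NVar ''k'')))
        (Seq (RArrAssign ''x'' (NArr ''ord'' (NVar ''t'')) (RArr ''xh'' (NArr ''ord'' (NVar ''t''))))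
          (NAssign ''t'' (NAdd (NVar ''t'') (NConst 1)))))) s1 (n * 3 + 2)
      (\<lambda>s'. rarr s' ''x'' = (\<lambda>i. if i \<in> narr s1 ''ord'' ` {..<min n k} then xh i else 0))"
    if s1: "nvar s1 ''n'' = n" "nvar s1 ''k'' = k" "rarr s1 ''xh'' = xh" "rarr s1 ''x'' = (\<lambda>_. 0)" for s1
  proof (rule runs_Seq'[where T = 1])
    define I where "I s' \<longleftrightarrow> nvar s' ''n'' = n \<and> nvar s' ''k'' = k \<and> rarr s' ''xh'' = xh \<and> nvar s' ''t'' \<le> min n k \<and>
      narr s' ''ord'' = narr s1 ''ord'' \<and>
      rarr s' ''x'' = (\<lambda>i. if i \<in> narr s1 ''ord'' ` {..<nvar s' ''t''} then xh i else 0)" for s' :: store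
    show "runs (NAssign ''t'' (NConst 0)) s1 1 (\<lambda>s'. I s' \<and> nvar s' ''t'' = 0)"
      by (rule runs_straight) (use s1 in \<open>simp_all add: I_def\<close>)
    fix s0 :: store assume s0: "I s0 \<and> nvar s0 ''t'' = 0"
    let ?b = "BAnd (NLess (NVar ''t'') (NVar ''n'')) (NLess (NVar ''t'') (NVar ''k''))"
    let ?p = "Seq (RArrAssign ''x'' (NArr ''ord'' (NVar ''t'')) (RArr ''xh'' (NArr ''ord'' (NVar ''t''))))
          (NAssign ''t'' (NAdd (NVar ''t'') (NConst 1)))"
    have "runs (While ?b ?p) s0 ((n - nvar s0 ''t'') * (2 + 1) + 1)
       (\<lambda>s'. I s' \<and> \<not> bval ?b s' \<and> agree_off (vars_written ?p) s0 s')"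
    proof (rule runs_While)
      show "I s0" using s0 by simp
      fix s' :: store assume i: "I s'" "bval ?b s'"
      then show "runs ?p s' 2 (\<lambda>s''. I s'' \<and> n - nvar s'' ''t'' < n - nvar s' ''t'')"
        by (intro runs_straight) (auto simp: I_def fun_eq_iff less_Suc_eq)
    qed
    then show "runs (While ?b ?p) s0 (n * 3 + 1)
       (\<lambda>s'. rarr s' ''x'' = (\<lambda>i. if i \<in> narr s1 ''ord'' ` {..<min n k} then xh i else 0))"
    proof (rule runs_mono)
      fix s' :: store assume a: "I s' \<and> \<not> bval ?b s' \<and> agree_off (vars_written ?p) s0 s'"
      then have "nvar s' ''t'' = min n k" by (auto simp: I_def)
      then show "rarr s' ''x'' = (\<lambda>i. if i \<in> narr s1 ''ord'' ` {..<min n k} then xh i else 0)"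
        using a by (simp add: I_def)
    qed (use s0 in simp)
  qed simp
  show ?thesis
    unfolding out_prog_def
  proof (rule runs_Seq'[where T = 1])
    show "runs (NAssign ''N'' (NVar ''n'')) s 1 (\<lambda>s'. s' = s\<lparr>nvar := (nvar s)(''N'' := n)\<rparr>)"
      by (rule runs_straight) (simp_all add: s)
    fix s1 assume s1: "s1 = s\<lparr>nvar := (nvar s)(''N'' := n)\<rparr>"
    have f1: "nvar s1 ''N'' = n" "rarr s1 ''xh'' = xh" by (simp_all add: s1 s)
    show "runs (Seq (Seq (NAssign ''i'' (NConst 0))
      (While (NLess (NVar ''i'') (NVar ''N''))
        (Seq (RArrAssign ''key'' (NVar ''i'') (RMul (RArr ''xh'' (NVar ''i'')) (RArr ''xh'' (NVar ''i''))))
          (NAssign ''i'' (NAdd (NVar ''i'') (NConst 1))))))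
     (Seq sort_prog (Seq (NAssign ''t'' (NConst 0))
      (While (BAnd (NLess (NVar ''t'') (NVar ''n'')) (NLess (NVar ''t'') (NVar ''k'')))
        (Seq (RArrAssign ''x'' (NArr ''ord'' (NVar ''t'')) (RArr ''xh'' (NArr ''ord'' (NVar ''t''))))
          (NAssign ''t'' (NAdd (NVar ''t'') (NConst 1)))))))) s1
      (n * 3 + 2 + ((n * (5 * floor_log (2 * n) + 17) + 6) + (n * 3 + 2))) ?Q"
    proof (rule runs_Seq[OF 1[OF f1]])
      fix s2 assume s2: "\<forall>i<n. rarr s2 ''key'' i = (xh i)\<^sup>2"
        and a2: "agree_off (vars_written (Seq (NAssign ''i'' (NConst 0))
          (While (NLess (NVar ''i'') (NVar ''N''))
            (Seq (RArrAssign ''key'' (NVar ''i'') (RMul (RArr ''xh'' (NVar ''i'')) (RArr ''xh'' (NVar ''i''))))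
              (NAssign ''i'' (NAdd (NVar ''i'') (NConst 1))))))) s1 s2"
      note a2' = agree_offD[OF a2]
      have f2: "nvar s2 ''N'' = n" "rarr s2 ''xh'' = xh" "nvar s2 ''n'' = n" "nvar s2 ''k'' = k" "rarr s2 ''x'' = (\<lambda>_. 0)"
        using a2'(1)[of "''N''"] a2'(4)[of "''xh''"] a2'(1)[of "''n''"] a2'(1)[of "''k''"] a2'(4)[of "''x''"]
        by (simp_all add: s1 s)
      show "runs (Seq sort_prog (Seq (NAssign ''t'' (NConst 0))
      (While (BAnd (NLess (NVar ''t'') (NVar ''n'')) (NLess (NVar ''t'') (NVar ''k'')))
        (Seq (RArrAssign ''x'' (NArr ''ord'' (NVar ''t'')) (RArr ''xh'' (NArr ''ord'' (NVar ''t''))))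
          (NAssign ''t'' (NAdd (NVar ''t'') (NConst 1))))))) s2
          ((n * (5 * floor_log (2 * n) + 17) + 6) + (n * 3 + 2)) ?Q"
      proof (rule runs_Seq[OF runs_sort_prog[OF f2(1) n]])
        show "\<forall>j<n. 0 \<le> rarr s2 ''key'' j" using s2 by simp
        fix s3 assume s3: "bij_betw (narr s3 ''ord'') {..<n} {..<n} \<and>
           (\<forall>u t. u \<le> t \<longrightarrow> t < n \<longrightarrow> rarr s2 ''key'' (narr s3 ''ord'' t) \<le> rarr s2 ''key'' (narr s3 ''ord'' u))"
          and a3: "agree_off (vars_written sort_prog) s2 s3"
        note a3' = agree_offD[OF a3]
        have f3: "nvar s3 ''n'' = n" "nvar s3 ''k'' = k" "rarr s3 ''xh'' = xh" "rarr s3 ''x'' = (\<lambda>_. 0)"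
          using a3'(4)[of "''xh''"] a3'(1)[of "''n''"] a3'(1)[of "''k''"] a3'(4)[of "''x''"] f2 by simp_all
        define od where "od = narr s3 ''ord''"
        have inj: "inj_on od {..<n}" and surj: "od ` {..<n} = {..<n}" using s3 by (auto simp: bij_betw_def od_def)
        define T where "T = od ` {..<min n k}"
        have T: "T \<subseteq> {..<n}" using surj by (auto simp: T_def)
        have cT: "card T = min n k" unfolding T_def
          using card_image[OF inj_on_subset[OF inj, of "{..<min n k}"]] by auto
        have le: "(xh l)\<^sup>2 \<le> (xh i)\<^sup>2" if i: "i \<in> T" and l: "l \<in> {..<n} - T" for i l
        proof -
          obtain u where u: "u < min n k" "i = od u" using i unfolding T_def by blast
          obtain t where t: "t < n" "l = od t" using l surj by (metis DiffD1 imageE lessThan_iff)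
          have "\<not> t < min n k" using l t by (auto simp: T_def)
          then have "u \<le> t" using u by linarith
          then have "rarr s2 ''key'' l \<le> rarr s2 ''key'' i" using s3 t u by (simp add: od_def)
          moreover have "l < n" "i < n" using i l T by auto
          ultimately show ?thesis using s2 by simp
        qed
        show "runs (Seq (NAssign ''t'' (NConst 0))
          (While (BAnd (NLess (NVar ''t'') (NVar ''n'')) (NLess (NVar ''t'') (NVar ''k'')))
            (Seq (RArrAssign ''x'' (NArr ''ord'' (NVar ''t'')) (RArr ''xh'' (NArr ''ord'' (NVar ''t''))))
              (NAssign ''t'' (NAdd (NVar ''t'') (NConst 1)))))) s3 (n * 3 + 2) ?Q"
          by (rule runs_mono[OF 2[OF f3]])
            (use T cT le in \<open>auto simp: T_def[symmetric] od_def[symmetric] intro!: exI[of _ T]\<close>)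
      qed
    qed
  qed (simp add: algebra_simps)
qed


section \<open>The composed program, with its counters eliminated\<close>

definition isolated :: "nat set \<Rightarrow> nat \<Rightarrow> nat \<Rightarrow> (nat \<Rightarrow> nat) \<Rightarrow> nat \<Rightarrow> nat set" where
  "isolated S D h rw i = {d. d < D \<and> h \<le> rw (D * i + d) \<and>
     (\<forall>i'\<in>S. \<forall>d'<D. rw (D * i' + d') = rw (D * i + d) \<longrightarrow> i' = i \<and> d' = d)}"

definition isolated_mean where
  "isolated_mean S D h rw vl y i = (\<Sum>d\<in>isolated S D h rw i. vl (D * i + d) * y (rw (D * i + d))) /
     real (card (isolated S D h rw i))"

text \<open>Each entry of a selected column is itself counted once, so a counter below 2 says that
  nothing else in the selected columns hits the row. Injectivity of \<open>sel\<close> identifies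
  list positions with columns.\<close>

lemma clean_eq_isolated:
  fixes sel :: "nat \<Rightarrow> nat"
  assumes inj: "inj_on sel {..<Q}" and i: "i \<in> sel ` {..<Q}"
    and oc: "oc = (\<lambda>r. card {z. z \<in> {..<Q} \<times> {..<D} \<and> rw (D * sel (fst z) + snd z) = r \<and> h \<le> r})"
  shows "clean D h rw oc i D = isolated (sel ` {..<Q}) D h rw i"
proof -
  obtain u where u: "u < Q" "i = sel u" using i by blast
  have "oc (rw (D * i + d)) < 2 \<longleftrightarrow>
     (\<forall>i'\<in>sel ` {..<Q}. \<forall>d'<D. rw (D * i' + d') = rw (D * i + d) \<longrightarrow> i' = i \<and> d' = d)"
    if d: "d < D" "h \<le> rw (D * i + d)" for d
  proof -
    define A where "A = {z. z \<in> {..<Q} \<times> {..<D} \<and> rw (D * sel (fst z) + snd z) = rw (D * i + d) \<and> h \<le> rw (D * i + d)}"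
    have fin: "finite A" unfolding A_def by (rule finite_subset[of _ "{..<Q} \<times> {..<D}"]) auto
    have ud: "(u, d) \<in> A" using u d by (simp add: A_def)
    have "oc (rw (D * i + d)) < 2 \<longleftrightarrow> card A \<le> Suc 0" by (auto simp: oc A_def)
    also have "\<dots> \<longleftrightarrow> (\<forall>a\<in>A. \<forall>b\<in>A. a = b)" by (rule card_le_Suc0_iff_eq[OF fin])
    also have "\<dots> \<longleftrightarrow> (\<forall>a\<in>A. a = (u, d))" using ud by metis
    also have "\<dots> \<longleftrightarrow> (\<forall>u'<Q. \<forall>d'<D. rw (D * sel u' + d') = rw (D * i + d) \<longrightarrow> u' = u \<and> d' = d)"
      using d(2) by (auto simp: A_def)
    also have "\<dots> \<longleftrightarrow> (\<forall>i'\<in>sel ` {..<Q}. \<forall>d'<D. rw (D * i' + d') = rw (D * i + d) \<longrightarrow> i' = i \<and> d' = d)"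
    proof -
      have "u' = u \<longleftrightarrow> sel u' = i" if "u' < Q" for u'
        using inj u that by (auto simp: inj_on_def)
      then show ?thesis by auto
    qed
    finally show ?thesis .
  qed
  then show ?thesis unfolding clean_def isolated_def by blast
qed

definition main_prog :: "nat \<Rightarrow> com" where
  "main_prog C = Seq select_prog (Seq (cap_prog C) (Seq occ_prog (Seq est_prog out_prog)))"

lemma vars_written_estimate [simp]:
  "vars_written (cap_prog C) = {(NV, ''Q'')}"
  "vars_written occ_prog = {(NV, ''u''), (NV, ''d''), (NV, ''e''), (NA, ''occ'')}"
  "vars_written est_prog = {(NV, ''u''), (NV, ''d''), (NV, ''e''), (RV, ''z''), (RV, ''w''), (RA, ''xh'')}"
  by (auto simp: cap_prog_def occ_prog_def est_prog_def)

lemma runs_main_prog: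
  fixes C :: nat
  assumes cs: "csc_store n m k D rw vl y s" and m: "m = 2 * h" "1 \<le> h" and n: "1 \<le> n" and D: "1 \<le> D"
  defines "rf \<equiv> first_rows (D * n) h rw"
  defines "key \<equiv> (\<lambda>r. if r < h then (y r)\<^sup>2 else 0)"
  defines "S \<equiv> candidates (C * k) n D h rf key"
  shows "runs (main_prog C) s
     (h * (5 * floor_log (2 * h) + 34) + n * (5 * floor_log (2 * n) + 23) + (n + D * n) * 45 + 42)
    (\<lambda>s'. S \<subseteq> {..<n} \<and> card S \<le> C * k \<and>
       (\<forall>\<tau>. card (heavy_columns_of n D h rf key \<tau>) \<le> C * k \<longrightarrow>
          heavy_columns_of n D h rf key \<tau> \<subseteq> S) \<and>
       (\<exists>xh. xh = (\<lambda>i. if i \<in> S then isolated_mean S D h rw vl y i else 0) \<and>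
         (\<exists>T\<subseteq>{..<n}. card T = min n k \<and> rarr s' ''x'' = (\<lambda>i. if i \<in> T then xh i else 0) \<and>
           (\<forall>i\<in>T. \<forall>l\<in>{..<n} - T. (xh l)\<^sup>2 \<le> (xh i)\<^sup>2))))"
    (is "runs _ _ _ ?Q")
proof -
  obtain st where nv: "nvar s = (\<lambda>_. 0)(''n'' := n, ''m'' := m, ''k'' := k)" and rv: "rvar s = (\<lambda>_. 0)"
    and na: "narr s = (\<lambda>_ _. 0)(''start'' := st, ''row'' := rw)" and st: "\<And>i. i \<le> n \<Longrightarrow> st i = D * i"
    and ra: "rarr s = (\<lambda>_ _. 0)(''val'' := vl, ''y'' := y)"
    using cs unfolding csc_store_def by blast
  have "runs (main_prog C) s ((h * (5 * floor_log (2 * h) + 34) + (n + D * n) * 23 + 20) +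
     (3 + ((n * (D + 1) * 9 + 3) + ((n * (D + 1) * 13 + 5) + (n * (5 * floor_log (2 * n) + 23) + 11))))) ?Q"
    unfolding main_prog_def
  proof (rule runs_Seq[OF runs_select_prog[OF cs m n D, folded rf_def key_def]])
    fix s1 assume s1: "nvar s1 ''N'' = h \<and> nvar s1 ''D'' = D \<and>
       narr s1 ''sel'' = narr (rank_output n D h rf key) ''sel'' \<and>
       nvar s1 ''q'' = nvar (rank_output n D h rf key) ''q'' \<and>
       inj_on (narr s1 ''sel'') {..<nvar s1 ''q''} \<and> narr s1 ''sel'' ` {..<nvar s1 ''q''} \<subseteq> {..<n} \<and>
       (\<forall>M \<tau>. card (heavy_columns_of n D h rf key \<tau>) \<le> M \<longrightarrow>
          heavy_columns_of n D h rf key \<tau> \<subseteq> candidates M n D h rf key)"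
      and a1: "agree_off (vars_written select_prog) s s1"
    note a1' = agree_offD[OF a1, unfolded vars_written_select select_written_def]
    define sel where "sel = narr s1 ''sel''"
    define q where "q = nvar s1 ''q''"
    define Q where "Q = min (C * k) q"
    have S: "S = sel ` {..<Q}" using s1 by (simp add: S_def candidates_def sel_def Q_def q_def)
    have inj: "inj_on sel {..<q}" and sn: "sel ` {..<q} \<subseteq> {..<n}" using s1 unfolding sel_def q_def by blast+
    have injQ: "inj_on sel {..<Q}" using inj_on_subset[OF inj] by (auto simp: Q_def)
    have "sel ` {..<Q} \<subseteq> sel ` {..<q}" by (rule image_mono) (auto simp: Q_def)
    then have Sn: "S \<subseteq> {..<n}" using sn S by blast
    have cS: "card S = Q" using card_image[OF injQ] S by simp
    have Qn: "Q \<le> n" using card_mono[OF _ Sn] cS by simp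
    have f1: "nvar s1 ''n'' = n" "nvar s1 ''k'' = k" "narr s1 ''row'' = rw" "narr s1 ''start'' = st"
      "rarr s1 ''val'' = vl" "rarr s1 ''y'' = y" "narr s1 ''occ'' = (\<lambda>_. 0)" "rarr s1 ''xh'' = (\<lambda>_. 0)"
      "rarr s1 ''x'' = (\<lambda>_. 0)"
      using a1'(1)[of "''n''"] a1'(1)[of "''k''"] a1'(3)[of "''row''"] a1'(3)[of "''start''"] a1'(4)[of "''val''"]
        a1'(4)[of "''y''"] a1'(3)[of "''occ''"] a1'(4)[of "''xh''"] a1'(4)[of "''x''"] by (simp_all add: nv na ra)
    have sts: "st (sel u) = D * sel u" if "u < Q" for u
      using Sn that by (intro st) (auto simp: S intro: less_imp_le)
    have QD: "Q * (D + 1) \<le> n * (D + 1)" using Qn by (rule mult_le_mono1)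
    show "runs (Seq (cap_prog C) (Seq occ_prog (Seq est_prog out_prog))) s1
      (3 + ((n * (D + 1) * 9 + 3) + ((n * (D + 1) * 13 + 5) + (n * (5 * floor_log (2 * n) + 23) + 11)))) ?Q"
    proof (rule runs_Seq)
      show "runs (cap_prog C) s1 3 (\<lambda>s'. s' = s1\<lparr>nvar := (nvar s1)(''Q'' := Q)\<rparr>)"
        by (rule runs_straight) (simp_all add: cap_prog_def f1 Q_def q_def min_def)
      fix s2 assume s2: "s2 = s1\<lparr>nvar := (nvar s1)(''Q'' := Q)\<rparr>"
      have f2: "nvar s2 ''Q'' = Q" "nvar s2 ''D'' = D" "nvar s2 ''N'' = h" "narr s2 ''sel'' = sel"
        "narr s2 ''row'' = rw" "\<And>u. u < Q \<Longrightarrow> narr s2 ''start'' (sel u) = D * sel u" "narr s2 ''occ'' = (\<lambda>_. 0)"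
        using s1 f1 sts by (simp_all add: s2 sel_def)
      show "runs (Seq occ_prog (Seq est_prog out_prog)) s2
        ((n * (D + 1) * 9 + 3) + ((n * (D + 1) * 13 + 5) + (n * (5 * floor_log (2 * n) + 23) + 11))) ?Q"
      proof (rule runs_Seq'[OF runs_occ_prog[OF f2]])
        fix s3 assume s3: "narr s3 ''occ'' =
          (\<lambda>r. card {z. z \<in> {..<Q} \<times> {..<D} \<and> rw (D * sel (fst z) + snd z) = r \<and> h \<le> r})"
          and a3: "agree_off (vars_written occ_prog) s2 s3"
        define oc where "oc = narr s3 ''occ''"
        note a3' = agree_offD[OF a3]
        have f3: "nvar s3 ''Q'' = Q" "nvar s3 ''D'' = D" "nvar s3 ''N'' = h" "narr s3 ''sel'' = sel"
          "narr s3 ''row'' = rw" "\<And>u. u < Q \<Longrightarrow> narr s3 ''start'' (sel u) = D * sel u" "narr s3 ''occ'' = oc"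
          "rarr s3 ''val'' = vl" "rarr s3 ''y'' = y" "rarr s3 ''xh'' = (\<lambda>_. 0)"
          using a3'(1)[of "''Q''"] a3'(1)[of "''D''"] a3'(1)[of "''N''"] a3'(3)[of "''sel''"] a3'(3)[of "''row''"]
            a3'(3)[of "''start''"] a3'(4)[of "''val''"] a3'(4)[of "''y''"] a3'(4)[of "''xh''"] f2
          by (simp_all add: oc_def, simp_all add: s2 f1)
        have f3': "nvar s3 ''n'' = n" "nvar s3 ''k'' = k" "rarr s3 ''x'' = (\<lambda>_. 0)"
          using a3'(1)[of "''n''"] a3'(1)[of "''k''"] a3'(4)[of "''x''"] by (simp_all add: s2 f1)
        show "runs (Seq est_prog out_prog) s3
          ((n * (D + 1) * 13 + 5) + (n * (5 * floor_log (2 * n) + 23) + 11)) ?Q"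
        proof (rule runs_Seq'[OF runs_est_prog[OF f3]])
          fix s4 assume s4: "rarr s4 ''xh'' =
            (\<lambda>i. if i \<in> sel ` {..<Q} then clean_mean D h rw oc vl y i else 0)"
            and a4: "agree_off (vars_written est_prog) s3 s4"
          note a4' = agree_offD[OF a4]
          have xh: "rarr s4 ''xh'' = (\<lambda>i. if i \<in> S then isolated_mean S D h rw vl y i else 0)"
            unfolding s4 S[symmetric]
            using clean_eq_isolated[OF injQ _ s3, folded oc_def S]
            by (auto simp: fun_eq_iff clean_mean_def isolated_mean_def)
          have f4: "nvar s4 ''n'' = n" "nvar s4 ''k'' = k" "rarr s4 ''x'' = (\<lambda>_. 0)"
            using a4'(1)[of "''n''"] a4'(1)[of "''k''"] a4'(4)[of "''x''"] f3' by simp_all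
          have hv: "\<forall>\<tau>. card (heavy_columns_of n D h rf key \<tau>) \<le> C * k \<longrightarrow>
             heavy_columns_of n D h rf key \<tau> \<subseteq> S" using s1 unfolding S_def by blast
          show "runs out_prog s4 (n * (5 * floor_log (2 * n) + 23) + 11) ?Q"
            by (rule runs_mono[OF runs_out_prog[OF f4(1,2) xh f4(3) n]])
              (use Sn cS hv in \<open>auto simp: Q_def\<close>)
        qed (assumption | intro add_mono mult_le_mono1 QD order_refl)+
      qed (assumption | intro add_mono mult_le_mono1 QD order_refl)+
    qed
  qed
  then show ?thesis by (rule runs_mono) (simp_all add: algebra_simps)
qed

section \<open>Hashing matrices\<close>

text \<open>Row \<open>j * B + b\<close> is bucket \<open>b\<close> of block \<open>j\<close>; the
  hash value of a column in a block is its bucket there.\<close>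

definition hash_matrix :: "nat \<Rightarrow> nat \<Rightarrow> nat \<Rightarrow> (nat \<Rightarrow> nat \<Rightarrow> nat) \<Rightarrow> (nat \<Rightarrow> nat \<Rightarrow> real) \<Rightarrow> real mat" where
  "hash_matrix n D B H sg = mat (D * B) n (\<lambda>(r, i). if r mod B = H (r div B) i then sg (r div B) i else 0)"

lemma div_mod_block: "b < B \<Longrightarrow> (j * B + b) div B = j" "b < B \<Longrightarrow> (j * B + b) mod B = b" for b :: nat
  by auto

lemma block_less: "j < D \<Longrightarrow> b < B \<Longrightarrow> j * B + b < D * B" for j :: nat
proof -
  assume "j < D" "b < B"
  then have "j * B + b < Suc j * B" by simp
  also have "\<dots> \<le> D * B" using \<open>j < D\<close> by (intro mult_le_mono1) simp
  finally show ?thesis .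
qed

text \<open>If every column contributes exactly \<open>D\<close> entries, the entry of block
  \<open>j\<close> in column \<open>i\<close> sits at position \<open>D * i + j\<close> of the
  compressed format, so division and remainder by \<open>D\<close> recover column and block.\<close>

lemma concat_map_upt:
  assumes "0 < D"
  shows "concat (map (\<lambda>i. map (f i) [0..<D]) [0..<n]) = map (\<lambda>x. f (x div D) (x mod D)) [0..<D * n]"
proof (induction n)
  case (Suc n)
  have "map (f n) [0..<D] = map (\<lambda>x. f (x div D) (x mod D)) [D * n..<D * n + D]"
    using assms by (intro nth_equalityI) auto
  moreover have "[0..<D * Suc n] = [0..<D * n] @ [D * n..<D * n + D]"
    using upt_add_eq_append[of 0 "D * n" D] by (simp add: add.commute)
  ultimately show ?case using Suc by simp
qed simp

locale hashing =
  fixes n D B :: nat and H :: "nat \<Rightarrow> nat \<Rightarrow> nat" and sg :: "nat \<Rightarrow> nat \<Rightarrow> real"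
  assumes H: "\<And>j i. j < D \<Longrightarrow> i < n \<Longrightarrow> H j i < B" and sg: "\<And>j i. j < D \<Longrightarrow> i < n \<Longrightarrow> sg j i \<in> {-1, 1}"
    and D_pos: "0 < D"
begin

abbreviation A where "A \<equiv> hash_matrix n D B H sg"

lemma dim_A [simp]: "dim_row A = D * B" "dim_col A = n"
  by (simp_all add: hash_matrix_def)

lemma A_entry: "j < D \<Longrightarrow> b < B \<Longrightarrow> i < n \<Longrightarrow> A $$ (j * B + b, i) = (if b = H j i then sg j i else 0)"
  using block_less[of j D b B] by (simp add: hash_matrix_def div_mod_block)

text \<open>Each block contributes one nonzero entry, signs being nonzero, and blocks occupy
  consecutive ranges of rows; so the order by blocks is the order by rows.\<close>

lemma column_entries_A:
  assumes i: "i < n"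
  shows "column_entries A i = map (\<lambda>j. (j * B + H j i, sg j i)) [0..<D]"
proof -
  have B: "0 < B" using H[OF D_pos i] by simp
  have "filter (\<lambda>r. A $$ (r, i) \<noteq> 0) [0..<D * B] = map (\<lambda>j. j * B + H j i) [0..<D]"
  proof (rule sorted_distinct_set_unique)
    have lt: "j * B + H j i < j' * B + H j' i" if "j < j'" "j' < D" for j j'
    proof -
      have "j * B + H j i < j' * B" using block_less[of j j' "H j i" B] H[of j i] i that by simp
      then show ?thesis by simp
    qed
    show "sorted (map (\<lambda>j. j * B + H j i) [0..<D])"
      by (auto simp: sorted_iff_nth_mono_less intro!: less_imp_le[OF lt])
    show "distinct (map (\<lambda>j. j * B + H j i) [0..<D])"
      unfolding distinct_map
      by (auto simp: inj_on_def) (metis lt less_irrefl nat_neq_iff)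
    have "r < D * B \<and> A $$ (r, i) \<noteq> 0 \<longleftrightarrow> (\<exists>j<D. r = j * B + H j i)" for r
    proof
      assume r: "r < D * B \<and> A $$ (r, i) \<noteq> 0"
      have "r div B < D" using r B by (simp add: less_mult_imp_div_less)
      moreover have "r mod B = H (r div B) i" using r i by (auto simp: hash_matrix_def split: if_splits)
      ultimately show "\<exists>j<D. r = j * B + H j i" by (metis div_mult_mod_eq)
    next
      assume "\<exists>j<D. r = j * B + H j i"
      then obtain j where j: "j < D" "r = j * B + H j i" by blast
      then show "r < D * B \<and> A $$ (r, i) \<noteq> 0"
        using A_entry[of j "H j i" i] H[of j i] sg[of j i] i block_less[of j D "H j i" B] by auto
    qed
    then show "set (filter (\<lambda>r. A $$ (r, i) \<noteq> 0) [0..<D * B]) = set (map (\<lambda>j. j * B + H j i) [0..<D])"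
      by auto
  qed (auto simp: sorted_wrt_filter)
  then show ?thesis
    unfolding column_entries_def dim_A using A_entry i H by (auto simp: o_def)
qed

definition entry_row :: "nat \<Rightarrow> nat" where
  "entry_row x = (if x < D * n then (x mod D) * B + H (x mod D) (x div D) else 0)"

definition entry_val :: "nat \<Rightarrow> real" where
  "entry_val x = (if x < D * n then sg (x mod D) (x div D) else 0)"

lemma entry_row_block: "j < D \<Longrightarrow> i < n \<Longrightarrow> entry_row (D * i + j) = j * B + H j i"
  "j < D \<Longrightarrow> i < n \<Longrightarrow> entry_val (D * i + j) = sg j i"
  using block_less[of i n j D] by (simp_all add: entry_row_def entry_val_def mult.commute)

lemma csc_store_input:
  "csc_store n (D * B) k D entry_row entry_val (list_array (list_of_vec y)) (recovery_input k A y)"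
proof -
  have cs: "csc_entries A = map (\<lambda>x. ((x mod D) * B + H (x mod D) (x div D), sg (x mod D) (x div D))) [0..<D * n]"
  proof -
    have "csc_entries A = concat (map (\<lambda>i. map (\<lambda>j. (j * B + H j i, sg j i)) [0..<D]) [0..<n])"
      unfolding csc_entries_def dim_A by (intro arg_cong[of _ _ concat] map_cong) (auto simp: column_entries_A)
    then show ?thesis using concat_map_upt[OF D_pos, of "\<lambda>i j. (j * B + H j i, sg j i)" n] by simp
  qed
  have st: "list_array (map (col_start A) [0..<Suc n]) i = D * i" if "i \<le> n" for i
  proof -
    have "col_start A i = (\<Sum>i<i. D)"
      unfolding col_start_def using that by (intro sum.cong) (auto simp: column_entries_A)
    moreover have "list_array (map (col_start A) [0..<Suc n]) i = col_start A i"
      using that by (simp add: list_array_def nth_append del: upt_Suc)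
    ultimately show ?thesis by simp
  qed
  have "list_array (map fst (csc_entries A)) = entry_row" "list_array (map snd (csc_entries A)) = entry_val"
    by (auto simp: fun_eq_iff list_array_def cs entry_row_def entry_val_def)
  then show ?thesis
    unfolding csc_store_def recovery_input_def using st by (auto simp: fun_eq_iff del: ext)
qed

lemma measure_A:
  assumes x: "x \<in> carrier_vec n" and j: "j < D" "b < B"
  shows "(A *\<^sub>v x) $ (j * B + b) = (\<Sum>l<n. if H j l = b then sg j l * x $ l else 0)"
proof -
  have "(A *\<^sub>v x) $ (j * B + b) = (\<Sum>l\<in>{0..<n}. A $$ (j * B + b, l) * x $ l)"
    using block_less[of j D b B] j x by (auto simp: scalar_prod_def intro!: sum.cong)
  also have "\<dots> = (\<Sum>l<n. if H j l = b then sg j l * x $ l else 0)"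
    using j by (intro sum.cong) (auto simp: A_entry)
  finally show ?thesis .
qed

end

section \<open>The program's result in terms of hash functions and signs\<close>

definition decode :: "com \<Rightarrow> nat \<Rightarrow> real mat \<Rightarrow> real vec \<Rightarrow> real vec" where
  "decode p k A y = (SOME x'. \<exists>\<tau>. recovers_within p k A y \<tau> x')"

lemma decode_eq: "recovers_within p k A y \<tau> x' \<Longrightarrow> decode p k A y = x'"
  unfolding decode_def recovers_within_def
  by (rule some_equality) (use exec_deterministic in blast)+

text \<open>The candidate set spelled out for a hashing matrix. It reads only the blocks below
  \<open>L\<close> of \<open>H\<close> and the coordinates below \<open>L * B\<close> of
  \<open>y\<close>; everything else is replaced by the sentinel \<open>L * B\<close> or by
  0.\<close>

definition picked :: "nat \<Rightarrow> nat \<Rightarrow> nat \<Rightarrow> nat \<Rightarrow> (nat \<Rightarrow> nat \<Rightarrow> nat) \<Rightarrow> (nat \<Rightarrow> real) \<Rightarrow> nat set" where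
  "picked M n L B H y = candidates M n (2 * L) (L * B)
     (\<lambda>x. if x < 2 * L * n \<and> x mod (2 * L) < L
        then (x mod (2 * L)) * B + H (x mod (2 * L)) (x div (2 * L)) else L * B)
     (\<lambda>r. if r < L * B then (y r)\<^sup>2 else 0)"

definition alone :: "nat set \<Rightarrow> nat \<Rightarrow> (nat \<Rightarrow> nat \<Rightarrow> nat) \<Rightarrow> nat \<Rightarrow> nat set" where
  "alone S L H i = {j \<in> {L..<2 * L}. \<forall>l\<in>S. H j l = H j i \<longrightarrow> l = i}"

definition alone_mean :: "nat set \<Rightarrow> nat \<Rightarrow> nat \<Rightarrow> (nat \<Rightarrow> nat \<Rightarrow> nat) \<Rightarrow> (nat \<Rightarrow> nat \<Rightarrow> real) \<Rightarrow> (nat \<Rightarrow> real) \<Rightarrow> nat \<Rightarrow> real" where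
  "alone_mean S L B H sg y i =
     (\<Sum>j\<in>alone S L H i. sg j i * y (j * B + H j i)) / real (card (alone S L H i))"

text \<open>Interface between program and probability: the error analysis below uses the program
  only through these five facts.\<close>

lemma decode_hash_matrix:
  fixes C k :: nat
  assumes hs: "hashing n (2 * L) B H sg" and L: "1 \<le> L" and B: "1 \<le> B" and n: "1 \<le> n"
    and y: "y \<in> carrier_vec (2 * L * B)"
  defines "A \<equiv> hash_matrix n (2 * L) B H sg"
  defines "x' \<equiv> decode (main_prog C) k A y"
  defines "S \<equiv> picked (C * k) n L B H (\<lambda>r. y $ r)"
  defines "xh \<equiv> (\<lambda>i. if i \<in> S then alone_mean S L B H sg (\<lambda>r. y $ r) i else 0)"
  shows "recovers_within (main_prog C) k A y
      (real (L * B * (5 * floor_log (2 * (L * B)) + 34) + n * (5 * floor_log (2 * n) + 23) + (n + 2 * L * n) * 45 + 42)) x'"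
    "S \<subseteq> {..<n}" "card S \<le> C * k"
    "card {i. i < n \<and> L \<le> 2 * card {j. j < L \<and> \<tau> < (y $ (j * B + H j i))\<^sup>2}} \<le> C * k \<Longrightarrow>
       {i. i < n \<and> L \<le> 2 * card {j. j < L \<and> \<tau> < (y $ (j * B + H j i))\<^sup>2}} \<subseteq> S"
    "\<exists>T\<subseteq>{..<n}. card T = min n k \<and> x' = vec n (\<lambda>i. if i \<in> T then xh i else 0) \<and>
       (\<forall>i\<in>T. \<forall>l\<in>{..<n} - T. (xh l)\<^sup>2 \<le> (xh i)\<^sup>2)"
proof -
  interpret hashing n "2 * L" B H sg by fact
  define yv where "yv = list_array (list_of_vec y)"
  define h where "h = L * B"
  have yv: "yv r = y $ r" if "r < 2 * h" for r
    using that y by (simp add: yv_def list_array_def h_def)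
  have m: "2 * L * B = 2 * h" "1 \<le> h" "1 \<le> 2 * L" using L B by (simp_all add: h_def)
  define rf where "rf = first_rows (2 * L * n) h entry_row"
  define key where "key = (\<lambda>r. if r < h then (yv r)\<^sup>2 else 0)"
  have low: "j * B + H j i < h \<longleftrightarrow> j < L" if "j < 2 * L" "i < n" for i j
  proof
    assume "j * B + H j i < h"
    then have "j * B < L * B" unfolding h_def by (rule le_less_trans[OF le_add1])
    then show "j < L" by simp
  next
    assume "j < L"
    then show "j * B + H j i < h" unfolding h_def using H[OF that] by (intro block_less)
  qed
  have rf: "rf = (\<lambda>x. if x < 2 * L * n \<and> x mod (2 * L) < L
        then (x mod (2 * L)) * B + H (x mod (2 * L)) (x div (2 * L)) else h)"
  proof
    fix x
    have "x mod (2 * L) < 2 * L" using L by simp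
    moreover have "x div (2 * L) < n" if "x < 2 * L * n" using that L
      by (metis less_mult_imp_div_less mult.commute)
    ultimately show "rf x = (if x < 2 * L * n \<and> x mod (2 * L) < L
        then (x mod (2 * L)) * B + H (x mod (2 * L)) (x div (2 * L)) else h)"
      using low[of "x mod (2 * L)" "x div (2 * L)"] by (auto simp: rf_def first_rows_def entry_row_def)
  qed
  have key: "key = (\<lambda>r. if r < L * B then (y $ r)\<^sup>2 else 0)"
    using yv by (auto simp: key_def fun_eq_iff h_def)
  have S: "S = candidates (C * k) n (2 * L) h rf key"
    unfolding S_def picked_def rf key h_def ..
  have rfb: "rf (2 * L * i + j) = j * B + H j i" if "j < L" "i < n" for i j
    using block_less[of i n j "2 * L"] that by (simp add: rf mult.commute[of n] mult.commute[of i])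
  \<comment> \<open>Of the \<open>2 * L\<close> consecutive positions of a column, the first
    \<open>L\<close> are those in rows below \<open>h\<close>; the bijection sends block
    \<open>j\<close> to position \<open>2 * L * i + j\<close>.\<close>
  have heavy: "heavy_columns_of n (2 * L) h rf key \<tau> =
    {i. i < n \<and> L \<le> 2 * card {j. j < L \<and> \<tau> < (y $ (j * B + H j i))\<^sup>2}}" for \<tau>
  proof -
    have "card {x. x < 2 * L * n \<and> rf x < h \<and> \<tau> < key (rf x) \<and> x div (2 * L) = i} =
       card {j. j < L \<and> \<tau> < (y $ (j * B + H j i))\<^sup>2}" if i: "i < n" for i
    proof (rule bij_betw_same_card[symmetric], rule bij_betwI[where g = "\<lambda>x. x mod (2 * L)"])
      show "(\<lambda>j. 2 * L * i + j) \<in> {j. j < L \<and> \<tau> < (y $ (j * B + H j i))\<^sup>2} \<rightarrow>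
        {x. x < 2 * L * n \<and> rf x < h \<and> \<tau> < key (rf x) \<and> x div (2 * L) = i}"
      proof
        fix j assume j: "j \<in> {j. j < L \<and> \<tau> < (y $ (j * B + H j i))\<^sup>2}"
        then have "rf (2 * L * i + j) = j * B + H j i" "j * B + H j i < h"
          using rfb[of j i] low[of j i] i by auto
        moreover have "2 * L * i + j < 2 * L * n"
          using block_less[of i n j "2 * L"] j i by (simp add: mult.commute)
        moreover have "(2 * L * i + j) div (2 * L) = i" using j by simp
        ultimately show "2 * L * i + j \<in> {x. x < 2 * L * n \<and> rf x < h \<and> \<tau> < key (rf x) \<and> x div (2 * L) = i}"
          using j by (simp add: key h_def)
      qed
      show "(\<lambda>x. x mod (2 * L)) \<in> {x. x < 2 * L * n \<and> rf x < h \<and> \<tau> < key (rf x) \<and> x div (2 * L) = i} \<rightarrow>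
        {j. j < L \<and> \<tau> < (y $ (j * B + H j i))\<^sup>2}"
      proof
        fix x assume x: "x \<in> {x. x < 2 * L * n \<and> rf x < h \<and> \<tau> < key (rf x) \<and> x div (2 * L) = i}"
        then have "x mod (2 * L) < L" "rf x = (x mod (2 * L)) * B + H (x mod (2 * L)) i"
          by (auto simp: rf split: if_splits)
        then show "x mod (2 * L) \<in> {j. j < L \<and> \<tau> < (y $ (j * B + H j i))\<^sup>2}"
          using x by (auto simp: key h_def)
      qed
    qed (auto simp: mult.commute)
    then show ?thesis unfolding heavy_columns_of_def
      by auto
  qed
  \<comment> \<open>Rows of different blocks differ, so entries can only collide within one block,
    and there the row equality is equality of hash values.\<close>
  have iso: "isolated S (2 * L) h entry_row i = alone S L H i" if S: "S \<subseteq> {..<n}" and i: "i < n" for i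
  proof -
    have "(h \<le> entry_row (2 * L * i + d) \<and>
       (\<forall>i'\<in>S. \<forall>d'<2 * L. entry_row (2 * L * i' + d') = entry_row (2 * L * i + d) \<longrightarrow> i' = i \<and> d' = d)) \<longleftrightarrow>
       L \<le> d \<and> (\<forall>l\<in>S. H d l = H d i \<longrightarrow> l = i)" if d: "d < 2 * L" for d
    proof -
      have "d' = d" if "d' < 2 * L" "i' < n" "d' * B + H d' i' = d * B + H d i" for d' i'
        using that H[OF that(1,2)] H[OF d i] div_mod_block(1)[of "H d' i'" B d'] div_mod_block(1)[of "H d i" B d] by metis
      then have "(entry_row (2 * L * i' + d') = entry_row (2 * L * i + d) \<longrightarrow> i' = i \<and> d' = d) \<longleftrightarrow>
         (d' = d \<longrightarrow> H d i' = H d i \<longrightarrow> i' = i)" if "d' < 2 * L" "i' \<in> S" for d' i'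
        using that S entry_row_block(1)[of d' i'] entry_row_block(1)[OF d i] by auto
      then show ?thesis using low[OF d i] entry_row_block(1)[OF d i] d by (auto simp: not_less[symmetric])
    qed
    then show ?thesis unfolding isolated_def alone_def by auto
  qed
  have mean: "isolated_mean S (2 * L) h entry_row entry_val yv i = alone_mean S L B H sg (\<lambda>r. y $ r) i"
    if S: "S \<subseteq> {..<n}" and i: "i < n" for i
    unfolding isolated_mean_def alone_mean_def iso[OF that]
  proof (intro arg_cong2[of _ _ _ _ "(/)"] sum.cong refl)
    fix d assume "d \<in> alone S L H i"
    then have d: "d < 2 * L" by (simp add: alone_def)
    have "d * B + H d i < 2 * h" using block_less[OF d H[OF d i]] by (simp add: h_def)
    then show "entry_val (2 * L * i + d) * yv (entry_row (2 * L * i + d)) = sg d i * y $ (d * B + H d i)"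
      using entry_row_block[OF d i] yv by simp
  qed
  let ?T = "h * (5 * floor_log (2 * h) + 34) + n * (5 * floor_log (2 * n) + 23) + (n + 2 * L * n) * 45 + 42"
  obtain t s where ex: "exec (main_prog C) (recovery_input k A y) t s" "t \<le> ?T"
    and Sn: "S \<subseteq> {..<n}" and cS: "card S \<le> C * k"
    and hv: "\<And>\<tau>. card (heavy_columns_of n (2 * L) h rf key \<tau>) \<le> C * k \<Longrightarrow>
          heavy_columns_of n (2 * L) h rf key \<tau> \<subseteq> S"
    and ou: "\<exists>xh. xh = (\<lambda>i. if i \<in> S then isolated_mean S (2 * L) h entry_row entry_val yv i else 0) \<and>
         (\<exists>T\<subseteq>{..<n}. card T = min n k \<and> rarr s ''x'' = (\<lambda>i. if i \<in> T then xh i else 0) \<and>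
           (\<forall>i\<in>T. \<forall>l\<in>{..<n} - T. (xh l)\<^sup>2 \<le> (xh i)\<^sup>2))"
    using runs_main_prog[OF csc_store_input[of k y, folded yv_def] m(1,2) n m(3), of C,
        folded rf_def key_def, folded S] unfolding runs_def A_def by blast
  have rec: "recovers_within (main_prog C) k A y (real ?T) (vec n (rarr s ''x''))"
    unfolding recovers_within_def
  proof (intro exI conjI)
    show "exec (main_prog C) (recovery_input k A y) t s" by fact
    show "real t \<le> real ?T" using ex(2) by (simp only: of_nat_le_iff)
  qed (simp add: A_def)
  then have x': "x' = vec n (rarr s ''x'')" unfolding x'_def by (rule decode_eq)
  show "recovers_within (main_prog C) k A y (real (L * B * (5 * floor_log (2 * (L * B)) + 34) +
     n * (5 * floor_log (2 * n) + 23) + (n + 2 * L * n) * 45 + 42)) x'"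
    using rec by (simp add: x' h_def)
  show "S \<subseteq> {..<n}" "card S \<le> C * k" by fact+
  show "card {i. i < n \<and> L \<le> 2 * card {j. j < L \<and> \<tau> < (y $ (j * B + H j i))\<^sup>2}} \<le> C * k \<Longrightarrow>
       {i. i < n \<and> L \<le> 2 * card {j. j < L \<and> \<tau> < (y $ (j * B + H j i))\<^sup>2}} \<subseteq> S"
    using hv[of \<tau>] unfolding heavy .
  have "(\<lambda>i. if i \<in> S then isolated_mean S (2 * L) h entry_row entry_val yv i else 0) = xh"
    unfolding xh_def using mean[OF Sn] Sn by (auto simp: fun_eq_iff)
  then show "\<exists>T\<subseteq>{..<n}. card T = min n k \<and> x' = vec n (\<lambda>i. if i \<in> T then xh i else 0) \<and>
       (\<forall>i\<in>T. \<forall>l\<in>{..<n} - T. (xh l)\<^sup>2 \<le> (xh i)\<^sup>2)"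
    using ou unfolding x' by auto
qed

section \<open>Sub-Zipfian vectors and top coordinates\<close>

text \<open>Comparison with an integral, done by the mean value theorem for the power 1 - 2 \<alpha>
  on an interval of length one. The right-hand side telescopes, and \<alpha> > 1/2 makes the
  denominator positive.\<close>

lemma powr_tail_step:
  fixes \<alpha> :: real
  assumes "\<alpha> > 1/2" "2 \<le> i"
  shows "real i powr (- 2 * \<alpha>) \<le> (real (i - 1) powr (1 - 2 * \<alpha>) - real i powr (1 - 2 * \<alpha>)) / (2 * \<alpha> - 1)"
proof -
  have i: "real (i - 1) = real i - 1" "1 \<le> real i - 1" using assms(2) by auto
  have "\<exists>z::real. z > real i - 1 \<and> z < real i \<and>
     real i powr (1 - 2 * \<alpha>) - (real i - 1) powr (1 - 2 * \<alpha>) = (real i - (real i - 1)) * ((1 - 2 * \<alpha>) * z powr (1 - 2 * \<alpha> - 1))"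
  proof (rule MVT2)
    fix x :: real assume "real i - 1 \<le> x"
    then show "((\<lambda>x. x powr (1 - 2 * \<alpha>)) has_real_derivative (1 - 2 * \<alpha>) * x powr (1 - 2 * \<alpha> - 1)) (at x)"
      using i by (intro has_real_derivative_powr) linarith
  qed simp
  then obtain z where z: "real i - 1 < z" "z < real i"
    "real i powr (1 - 2 * \<alpha>) - (real i - 1) powr (1 - 2 * \<alpha>) = (1 - 2 * \<alpha>) * z powr (- 2 * \<alpha>)"
    by auto
  have "real i powr (- 2 * \<alpha>) \<le> z powr (- 2 * \<alpha>)"
    using z i assms by (intro powr_mono2') auto
  also have "\<dots> = ((real i - 1) powr (1 - 2 * \<alpha>) - real i powr (1 - 2 * \<alpha>)) / (2 * \<alpha> - 1)"
  proof -
    have "(real i - 1) powr (1 - 2 * \<alpha>) - real i powr (1 - 2 * \<alpha>) = (2 * \<alpha> - 1) * z powr (- 2 * \<alpha>)"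
      using z(3) by (simp add: algebra_simps)
    then show ?thesis using assms by (simp add: nonzero_eq_divide_eq mult.commute)
  qed
  finally show ?thesis using i by simp
qed

lemma powr_tail_sum:
  fixes \<alpha> :: real
  assumes "\<alpha> > 1/2" "1 \<le> k"
  shows "(\<Sum>i\<in>{Suc k..n}. real i powr (- 2 * \<alpha>)) \<le> real k powr (1 - 2 * \<alpha>) / (2 * \<alpha> - 1)"
proof -
  have "(\<Sum>i\<in>{Suc k..n}. real i powr (- 2 * \<alpha>)) \<le>
    (real k powr (1 - 2 * \<alpha>) - real n powr (1 - 2 * \<alpha>)) / (2 * \<alpha> - 1)" if "k \<le> n" for n
    using that
  proof (induction n rule: dec_induct)
    case (step n)
    have "(\<Sum>i\<in>{Suc k..Suc n}. real i powr (- 2 * \<alpha>)) =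
      (\<Sum>i\<in>{Suc k..n}. real i powr (- 2 * \<alpha>)) + real (Suc n) powr (- 2 * \<alpha>)"
      using step.hyps by simp
    also have "\<dots> \<le> (real k powr (1 - 2 * \<alpha>) - real n powr (1 - 2 * \<alpha>)) / (2 * \<alpha> - 1) +
       (real n powr (1 - 2 * \<alpha>) - real (Suc n) powr (1 - 2 * \<alpha>)) / (2 * \<alpha> - 1)"
      using step powr_tail_step[OF assms(1), of "Suc n"] assms(2) by (intro add_mono) auto
    also have "\<dots> = (real k powr (1 - 2 * \<alpha>) - real (Suc n) powr (1 - 2 * \<alpha>)) / (2 * \<alpha> - 1)"
      by (simp add: diff_divide_distrib)
    finally show ?case .
  qed simp
  moreover have "(real k powr (1 - 2 * \<alpha>) - real n powr (1 - 2 * \<alpha>)) / (2 * \<alpha> - 1) \<le>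
     real k powr (1 - 2 * \<alpha>) / (2 * \<alpha> - 1)"
    using assms by (intro divide_right_mono) auto
  ultimately show ?thesis using assms by (cases "k \<le> n") (force, simp)
qed

lemma sum_Diff_split:
  fixes f :: "'a \<Rightarrow> real"
  assumes "finite A" "V \<subseteq> A"
  shows "sum f (A - T) = sum f (A - T - V) + sum f (V - T)"
proof -
  have "A - T = (A - T - V) \<union> (V - T)" using assms(2) by auto
  also have "sum f \<dots> = sum f (A - T - V) + sum f (V - T)"
    using assms finite_subset by (intro sum.union_disjoint) auto
  finally show ?thesis .
qed

text \<open>Covers vectors with fewer than \<open>k\<close> nonzero entries, including the case of
  \<open>k\<close> above the dimension, on the same footing as the regular one: then
  \<open>T\<close> contains all nonzero entries and \<theta> is a positive level not above any of
  their magnitudes. Positivity of \<theta> is what allows it to serve as the scale for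
  thresholds.\<close>

definition top_set :: "nat \<Rightarrow> real vec \<Rightarrow> nat set \<Rightarrow> real \<Rightarrow> bool" where
  "top_set k x T \<theta> \<longleftrightarrow> T \<subseteq> {..<dim_vec x} \<and> card T \<le> k \<and> 0 < \<theta> \<and> (\<forall>i\<in>T. \<theta> \<le> \<bar>x $ i\<bar>) \<and>
     (\<forall>i\<in>{..<dim_vec x} - T. \<bar>x $ i\<bar> \<le> \<theta>) \<and>
     (card T = k \<or> (\<forall>i\<in>{..<dim_vec x} - T. x $ i = 0))"

text \<open>The lower bound at rank \<open>k\<close> gives f(k) \<le> \<theta> k^\<alpha> / a. As f
  is non-increasing, the upper bound at a later rank i becomes (b/a) \<theta> (k/i)^\<alpha>.
  Squaring and summing leaves k \<theta>^2 times a constant of the class.\<close>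

lemma sub_zipfian_top_set:
  assumes z: "sub_zipfian a b k \<alpha> x" and k: "1 \<le> k" and ab: "0 < a" "a \<le> b" and \<alpha>: "\<alpha> > 1/2"
  obtains T \<theta> where "top_set k x T \<theta>"
    "(\<Sum>i\<in>{..<dim_vec x} - T. (x $ i)\<^sup>2) \<le> (b / a)\<^sup>2 / (2 * \<alpha> - 1) * real k * \<theta>\<^sup>2"
proof -
  define n where "n = dim_vec x"
  obtain r and f :: "nat \<Rightarrow> real" where rk: "magnitude_ranking x r" and f: "antimono f"
    and lo: "\<And>i. i \<in> {1..n} \<Longrightarrow> k \<le> i \<Longrightarrow> a * (f i * real i powr (- \<alpha>)) \<le> \<bar>x $ r i\<bar>"
    and hi: "\<And>i. i \<in> {1..n} \<Longrightarrow> k \<le> i \<Longrightarrow> \<bar>x $ r i\<bar> \<le> b * (f i * real i powr (- \<alpha>))"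
    using z unfolding sub_zipfian_def n_def by blast
  have bij: "bij_betw r {1..n} {0..<n}"
    and mono: "\<And>i j. i \<in> {1..n} \<Longrightarrow> j \<in> {1..n} \<Longrightarrow> i \<le> j \<Longrightarrow> \<bar>x $ r j\<bar> \<le> \<bar>x $ r i\<bar>"
    using rk by (auto simp: magnitude_ranking_def n_def)
  have inj: "inj_on r {1..n}" and im: "r ` {1..n} = {..<n}"
    using bij by (auto simp: bij_betw_def lessThan_atLeast0)
  show thesis
  proof (cases "k \<le> n \<and> x $ r k \<noteq> 0")
    case True
    define \<theta> where "\<theta> = \<bar>x $ r k\<bar>"
    define T where "T = r ` {1..k}"
    have \<theta>: "0 < \<theta>" using True by (simp add: \<theta>_def)
    have kn: "k \<in> {1..n}" using True k by simp
    have "r ` {1..k} \<subseteq> r ` {1..n}" using True by (intro image_mono) auto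
    then have Tn: "T \<subseteq> {..<n}" using im by (simp add: T_def)
    have cT: "card T = k"
      unfolding T_def using card_image[OF inj_on_subset[OF inj, of "{1..k}"]] True by auto
    have out: "{..<n} - T = r ` {Suc k..n}"
    proof -
      have "r ` {1..n} - r ` {1..k} = r ` ({1..n} - {1..k})"
        using inj True by (intro inj_on_image_set_diff[symmetric, of r "{1..n}"]) auto
      moreover have "{1..n} - {1..k} = {Suc k..n}" using k by auto
      ultimately show ?thesis using im by (simp add: T_def)
    qed
    have ts: "top_set k x T \<theta>"
      unfolding top_set_def n_def[symmetric] out
      using Tn cT \<theta> mono kn by (auto simp: \<theta>_def T_def)
    have "f k \<le> \<theta> * real k powr \<alpha> / a"
    proof -
      have "a * (f k * real k powr (- \<alpha>)) \<le> \<theta>" using lo[OF kn] by (simp add: \<theta>_def)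
      then have "f k * real k powr (- \<alpha>) \<le> \<theta> / a" using ab by (simp add: pos_le_divide_eq mult.commute)
      then have "f k * real k powr (- \<alpha>) * real k powr \<alpha> \<le> \<theta> / a * real k powr \<alpha>"
        by (rule mult_right_mono) simp
      moreover have "real k powr (- \<alpha>) * real k powr \<alpha> = 1"
        using k by (simp add: powr_add[symmetric])
      ultimately show ?thesis by (simp add: mult.assoc)
    qed
    note fk = this
    have up: "\<bar>x $ r i\<bar> \<le> b / a * \<theta> * real k powr \<alpha> * real i powr (- \<alpha>)" if i: "i \<in> {Suc k..n}" for i
    proof -
      have "\<bar>x $ r i\<bar> \<le> b * (f i * real i powr (- \<alpha>))" using hi[of i] i by simp
      also have "\<dots> \<le> b * ((\<theta> * real k powr \<alpha> / a) * real i powr (- \<alpha>))"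
      proof -
        have "f i \<le> f k" using f i by (auto simp: antimono_def)
        then show ?thesis using fk ab by (intro mult_left_mono mult_right_mono) auto
      qed
      finally show ?thesis by (simp add: field_simps)
    qed
    have "(\<Sum>i\<in>{..<n} - T. (x $ i)\<^sup>2) = (\<Sum>i\<in>{Suc k..n}. (x $ r i)\<^sup>2)"
      unfolding out using inj_on_subset[OF inj, of "{Suc k..n}"] k by (subst sum.reindex) (auto simp: o_def)
    also have "\<dots> \<le> (\<Sum>i\<in>{Suc k..n}. (b / a * \<theta> * real k powr \<alpha>)\<^sup>2 * real i powr (- 2 * \<alpha>))"
    proof (rule sum_mono)
      fix i assume i: "i \<in> {Suc k..n}"
      have "(x $ r i)\<^sup>2 = \<bar>x $ r i\<bar>\<^sup>2" by simp
      also have "\<dots> \<le> (b / a * \<theta> * real k powr \<alpha> * real i powr (- \<alpha>))\<^sup>2"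
        using up[OF i] by (intro power_mono) auto
      also have "\<dots> = (b / a * \<theta> * real k powr \<alpha>)\<^sup>2 * real i powr (- 2 * \<alpha>)"
      proof -
        have "(real i powr (- \<alpha>))\<^sup>2 = real i powr (- 2 * \<alpha>)"
          using i by (simp add: powr_power mult.commute)
        then show ?thesis unfolding power_mult_distrib[of _ "real i powr (- \<alpha>)"] by simp
      qed
      finally show "(x $ r i)\<^sup>2 \<le> (b / a * \<theta> * real k powr \<alpha>)\<^sup>2 * real i powr (- 2 * \<alpha>)" .
    qed
    also have "\<dots> \<le> (b / a * \<theta> * real k powr \<alpha>)\<^sup>2 * (real k powr (1 - 2 * \<alpha>) / (2 * \<alpha> - 1))"
      unfolding sum_distrib_left[symmetric] using powr_tail_sum[OF \<alpha> k] by (intro mult_left_mono) auto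
    also have "\<dots> = (b / a)\<^sup>2 / (2 * \<alpha> - 1) * real k * \<theta>\<^sup>2"
    proof -
      have "(real k powr \<alpha>)\<^sup>2 * real k powr (1 - 2 * \<alpha>) = real k"
        using k by (simp add: powr_power powr_add[symmetric])
      then show ?thesis by (simp add: power_mult_distrib) (simp add: field_simps)
    qed
    finally show thesis using that[OF ts] by (simp add: n_def)
  next
    case False
    \<comment> \<open>Degenerate case: either the dimension or the number of nonzero entries is
      below \<open>k\<close>, and the tail vanishes. The 1 in the minimum keeps it defined and
      positive for the zero vector.\<close>
    define T where "T = {i \<in> {..<n}. x $ i \<noteq> 0}"
    define \<theta> where "\<theta> = Min (insert 1 ((\<lambda>i. \<bar>x $ i\<bar>) ` T))"
    have fin: "finite T" by (simp add: T_def)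
    have \<theta>: "0 < \<theta>" using fin by (auto simp: \<theta>_def T_def)
    have \<theta>T: "\<forall>i\<in>T. \<theta> \<le> \<bar>x $ i\<bar>" using fin by (auto simp: \<theta>_def intro!: Min_le)
    have cT: "card T \<le> k"
    proof (cases "k \<le> n")
      case True
      then have z: "x $ r k = 0" using False by simp
      have "T \<subseteq> r ` {1..k}"
      proof
        fix i assume "i \<in> T"
        then have "i \<in> r ` {1..n}" "x $ i \<noteq> 0" unfolding im by (auto simp: T_def)
        then obtain j where j: "j \<in> {1..n}" "i = r j" "x $ i \<noteq> 0" by blast
        have "\<not> k \<le> j" using mono[of k j] j True k z by auto
        then show "i \<in> r ` {1..k}" using j by auto
      qed
      then have "card T \<le> card (r ` {1..k})" by (intro card_mono) auto
      also have "\<dots> \<le> k" using card_image_le[of "{1..k}" r] by simp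
      finally show ?thesis .
    next
      case False
      moreover have "T \<subseteq> {..<n}" by (auto simp: T_def)
      ultimately show ?thesis using card_mono[of "{..<n}" T] by simp
    qed
    have z0: "\<forall>i\<in>{..<n} - T. x $ i = 0" by (auto simp: T_def)
    have "top_set k x T \<theta>"
      unfolding top_set_def n_def[symmetric]
    proof (intro conjI)
      show "T \<subseteq> {..<n}" by (auto simp: T_def)
      show "\<forall>i\<in>{..<n} - T. \<bar>x $ i\<bar> \<le> \<theta>" using z0 \<theta> by simp
      show "card T = k \<or> (\<forall>i\<in>{..<n} - T. x $ i = 0)" using z0 by blast
    qed (rule cT \<theta> \<theta>T)+
    moreover have "(\<Sum>i\<in>{..<n} - T. (x $ i)\<^sup>2) = 0" using z0 by (intro sum.neutral) auto
    moreover have "0 \<le> (b / a)\<^sup>2 / (2 * \<alpha> - 1) * real k * \<theta>\<^sup>2" using \<alpha> by simp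
    ultimately show thesis using that by (simp add: n_def)
  qed
qed

section \<open>Best sparse approximation, and the effect of truncating estimates\<close>

lemma l2_norm_eq: "l2_norm v = L2_set (\<lambda>i. v $ i) {..<dim_vec v}"
  by (simp add: l2_norm_def lessThan_atLeast0)

text \<open>Exchange argument. A competitor with support \<open>Z\<close> misses all the energy
  outside \<open>Z\<close>. Since \<open>T\<close> has at least as many elements unless the tail is
  zero, exchanging \<open>Z - T\<close> for \<open>T - Z\<close> trades entries of magnitude at most
  \<theta> for entries of magnitude at least \<theta>.\<close>

lemma Err2_ge_top_set:
  assumes T: "top_set k x T \<theta>"
  shows "sqrt (\<Sum>i\<in>{..<dim_vec x} - T. (x $ i)\<^sup>2) \<le> Err2 k x"
proof -
  define n where "n = dim_vec x"
  have Tn: "T \<subseteq> {..<n}" and fT: "finite T" and \<theta>: "0 < \<theta>"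
    using T finite_subset[of T "{..<n}"] by (auto simp: top_set_def n_def)
  show ?thesis
    unfolding Err2_def n_def[symmetric]
  proof (rule cINF_greatest)
    have "{i. i < n \<and> 0\<^sub>v n $ i \<noteq> (0::real)} = {}" by auto
    then have "k_sparse k (0\<^sub>v n)" unfolding k_sparse_def index_zero_vec by (simp only: card.empty)
    then have "0\<^sub>v n \<in> {z \<in> carrier_vec n. k_sparse k z}" by simp
    then show "{z \<in> carrier_vec n. k_sparse k z} \<noteq> {}" by blast
    fix z assume "z \<in> {z \<in> carrier_vec n. k_sparse k z}"
    then have z: "z \<in> carrier_vec n" "k_sparse k z" by auto
    define Z where "Z = {i. i < n \<and> z $ i \<noteq> 0}"
    have Zn: "Z \<subseteq> {..<n}" and fZ: "finite Z" by (auto simp: Z_def)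
    have cZ: "card Z \<le> k" using z by (simp add: k_sparse_def Z_def)
    have le: "(\<Sum>i\<in>{..<n} - T. (x $ i)\<^sup>2) \<le> (\<Sum>i\<in>{..<n} - Z. (x $ i)\<^sup>2)"
    proof (cases "\<forall>i\<in>{..<n} - T. x $ i = 0")
      case True
      then have "(\<Sum>i\<in>{..<n} - T. (x $ i)\<^sup>2) = 0" by (intro sum.neutral) auto
      then show ?thesis by (simp add: sum_nonneg)
    next
      case False
      then have cT: "card T = k" using T by (auto simp: top_set_def n_def)
      have c: "card (Z - T) \<le> card (T - Z)"
      proof -
        have "card (Z - T) + card (Z \<inter> T) = card Z" "card (T - Z) + card (Z \<inter> T) = card T"
          using fZ fT card_Int_Diff[of Z T] card_Int_Diff[of T Z] by (auto simp: Int_commute)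
        then show ?thesis using cZ cT by linarith
      qed
      have "(\<Sum>i\<in>Z - T. (x $ i)\<^sup>2) \<le> (\<Sum>i\<in>Z - T. \<theta>\<^sup>2)"
      proof (rule sum_mono)
        fix i assume "i \<in> Z - T"
        then have "\<bar>x $ i\<bar> \<le> \<theta>" using T Zn by (auto simp: top_set_def n_def)
        then show "(x $ i)\<^sup>2 \<le> \<theta>\<^sup>2" by (meson abs_le_square_iff abs_of_pos \<theta> order_trans abs_ge_self le_less)
      qed
      also have "\<dots> \<le> (\<Sum>i\<in>T - Z. \<theta>\<^sup>2)" using c by (simp add: mult_right_mono)
      also have "\<dots> \<le> (\<Sum>i\<in>T - Z. (x $ i)\<^sup>2)"
      proof (rule sum_mono)
        fix i assume "i \<in> T - Z"
        then have "\<theta> \<le> \<bar>x $ i\<bar>" using T by (auto simp: top_set_def)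
        then have "\<theta>\<^sup>2 \<le> \<bar>x $ i\<bar>\<^sup>2" using \<theta> by (intro power_mono) auto
        then show "\<theta>\<^sup>2 \<le> (x $ i)\<^sup>2" by simp
      qed
      finally have ex: "(\<Sum>i\<in>Z - T. (x $ i)\<^sup>2) \<le> (\<Sum>i\<in>T - Z. (x $ i)\<^sup>2)" .
      have "(\<Sum>i\<in>{..<n} - T. (x $ i)\<^sup>2) = (\<Sum>i\<in>{..<n} - T - Z. (x $ i)\<^sup>2) + (\<Sum>i\<in>Z - T. (x $ i)\<^sup>2)"
        using sum_Diff_split[OF finite_lessThan Zn] .
      also have "{..<n} - T - Z = {..<n} - Z - T" by auto
      also have "(\<Sum>i\<in>{..<n} - Z - T. (x $ i)\<^sup>2) + (\<Sum>i\<in>Z - T. (x $ i)\<^sup>2) \<le>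
         (\<Sum>i\<in>{..<n} - Z - T. (x $ i)\<^sup>2) + (\<Sum>i\<in>T - Z. (x $ i)\<^sup>2)" using ex by simp
      also have "\<dots> = (\<Sum>i\<in>{..<n} - Z. (x $ i)\<^sup>2)"
        using sum_Diff_split[OF finite_lessThan Tn, of _ Z] by simp
      finally show ?thesis .
    qed
    have "(\<Sum>i\<in>{..<n} - Z. (x $ i)\<^sup>2) = (\<Sum>i\<in>{..<n} - Z. ((z - x) $ i)\<^sup>2)"
      using z by (intro sum.cong) (auto simp: Z_def n_def)
    also have "\<dots> \<le> (\<Sum>i\<in>{..<n}. ((z - x) $ i)\<^sup>2)" by (intro sum_mono2) auto
    finally have "sqrt (\<Sum>i\<in>{..<n} - T. (x $ i)\<^sup>2) \<le> sqrt (\<Sum>i\<in>{..<n}. ((z - x) $ i)\<^sup>2)"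
      using le by (intro real_sqrt_le_mono) simp
    also have "\<dots> = l2_norm (z - x)" by (simp add: l2_norm_eq L2_set_def n_def)
    finally show "sqrt (\<Sum>i\<in>{..<n} - T. (x $ i)\<^sup>2) \<le> l2_norm (z - x)" .
  qed
qed

text \<open>Keeping the \<open>k\<close> largest estimates costs the estimation error at most twice: once for the kept
  estimates themselves, once for the entries that they displace.\<close>

lemma top_estimates_error:
  fixes x xh :: "nat \<Rightarrow> real"
  assumes T: "T \<subseteq> {..<n}" "card T = min n k" and best: "\<forall>i\<in>T. \<forall>l\<in>{..<n} - T. (xh l)\<^sup>2 \<le> (xh i)\<^sup>2"
    and S: "S \<subseteq> {..<n}" "\<And>i. i \<notin> S \<Longrightarrow> xh i = 0" and U: "U \<subseteq> S" "card U \<le> k"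
    and d: "sqrt (\<Sum>i\<in>S. (xh i - x i)\<^sup>2) \<le> d"
  shows "L2_set (\<lambda>i. (if i \<in> T then xh i else 0) - x i) {..<n} \<le> sqrt (\<Sum>i\<in>{..<n} - U. (x i)\<^sup>2) + 2 * d"
proof -
  have fin: "finite S" "finite T" "finite U" "U \<subseteq> {..<n}"
    using S T U finite_subset[of _ "{..<n}"] by auto
  have cU: "card U \<le> card T" using T U card_mono[of "{..<n}" U] fin by simp
  have sumT: "(\<Sum>i\<in>{..<n} - T. (xh i)\<^sup>2) \<le> (\<Sum>i\<in>{..<n} - U. (xh i)\<^sup>2)"
  proof -
    have "card (U - T) \<le> card (T - U)"
    proof -
      have "card (U - T) + card (U \<inter> T) = card U" "card (T - U) + card (U \<inter> T) = card T"
        using fin card_Int_Diff[of U T] card_Int_Diff[of T U] by (auto simp: Int_commute)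
      then show ?thesis using cU by linarith
    qed
    \<comment> \<open>Each displaced index of \<open>U\<close> is charged to a different kept index
      outside \<open>U\<close>, whose estimate is at least as large.\<close>
    then obtain g where g: "g ` (U - T) \<subseteq> T - U" "inj_on g (U - T)"
      using card_le_inj[of "U - T" "T - U"] fin by auto
    have "(\<Sum>i\<in>U - T. (xh i)\<^sup>2) \<le> (\<Sum>i\<in>U - T. (xh (g i))\<^sup>2)"
      using g(1) best fin by (intro sum_mono) blast
    also have "\<dots> = (\<Sum>i\<in>g ` (U - T). (xh i)\<^sup>2)" using g(2) by (simp add: sum.reindex)
    also have "\<dots> \<le> (\<Sum>i\<in>T - U. (xh i)\<^sup>2)" using g(1) fin by (intro sum_mono2) auto
    finally have ex: "(\<Sum>i\<in>U - T. (xh i)\<^sup>2) \<le> (\<Sum>i\<in>T - U. (xh i)\<^sup>2)" .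
    have "(\<Sum>i\<in>{..<n} - T. (xh i)\<^sup>2) = (\<Sum>i\<in>{..<n} - T - U. (xh i)\<^sup>2) + (\<Sum>i\<in>U - T. (xh i)\<^sup>2)"
      using sum_Diff_split[OF finite_lessThan fin(4)] .
    also have "{..<n} - T - U = {..<n} - U - T" by auto
    also have "(\<Sum>i\<in>{..<n} - U - T. (xh i)\<^sup>2) + (\<Sum>i\<in>U - T. (xh i)\<^sup>2) \<le>
       (\<Sum>i\<in>{..<n} - U - T. (xh i)\<^sup>2) + (\<Sum>i\<in>T - U. (xh i)\<^sup>2)" using ex by simp
    also have "\<dots> = (\<Sum>i\<in>{..<n} - U. (xh i)\<^sup>2)"
      using sum_Diff_split[OF finite_lessThan T(1), of _ U] by simp
    finally show ?thesis .
  qed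
  \<comment> \<open>\<open>xh\<close> vanishes off \<open>S\<close>, so the two summands have
    disjoint supports and the energies add. The set \<open>V\<close> influences only the first term,
    which lets \<open>T\<close> be compared with \<open>U\<close>.\<close>
  have split: "(\<Sum>i<n. ((if i \<in> V then 0 else xh i) + (if i \<in> S then 0 else x i))\<^sup>2) =
     (\<Sum>i\<in>{..<n} - V. (xh i)\<^sup>2) + (\<Sum>i\<in>{..<n} - S. (x i)\<^sup>2)" for V
  proof -
    have "(\<Sum>i<n. ((if i \<in> V then 0 else xh i) + (if i \<in> S then 0 else x i))\<^sup>2) =
      (\<Sum>i<n. (if i \<in> {..<n} - V then (xh i)\<^sup>2 else 0) + (if i \<in> {..<n} - S then (x i)\<^sup>2 else 0))"
      using S(2) by (intro sum.cong) auto
    also have "\<dots> = (\<Sum>i\<in>{..<n} - V. (xh i)\<^sup>2) + (\<Sum>i\<in>{..<n} - S. (x i)\<^sup>2)"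
      by (simp add: sum.distrib sum.If_cases Diff_eq Int_absorb1 Collect_neg_eq Int_assoc[symmetric])
    finally show ?thesis .
  qed
  let ?e = "\<lambda>i. if i \<in> S then xh i - x i else 0"
  have de: "L2_set ?e {..<n} \<le> d"
  proof -
    have "(\<Sum>i<n. (?e i)\<^sup>2) = (\<Sum>i<n. if i \<in> S then (xh i - x i)\<^sup>2 else 0)" by (intro sum.cong) auto
    also have "\<dots> = (\<Sum>i\<in>S. (xh i - x i)\<^sup>2)" using S(1) by (simp add: sum.If_cases Int_absorb1)
    finally show ?thesis using d by (simp add: L2_set_def)
  qed
  \<comment> \<open>With e the error on \<open>S\<close>, the output error is e minus the sum of
    \<open>xh\<close> off \<open>T\<close> and \<open>x\<close> off \<open>S\<close>. Replacing
    \<open>T\<close> by \<open>U\<close> can only enlarge the norm of that sum, which then equals e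
    + x off \<open>U\<close>. So the tail enters with coefficient exactly one and only e is
    doubled.\<close>
  have "L2_set (\<lambda>i. (if i \<in> T then xh i else 0) - x i) {..<n} =
     L2_set (\<lambda>i. ?e i + - ((if i \<in> T then 0 else xh i) + (if i \<in> S then 0 else x i))) {..<n}"
    using S(2) by (intro L2_set_cong) auto
  also have "\<dots> \<le> L2_set ?e {..<n} + L2_set (\<lambda>i. - ((if i \<in> T then 0 else xh i) + (if i \<in> S then 0 else x i))) {..<n}"
    by (rule L2_set_triangle_ineq)
  also have "L2_set (\<lambda>i. - ((if i \<in> T then 0 else xh i) + (if i \<in> S then 0 else x i))) {..<n} \<le>
     L2_set (\<lambda>i. (if i \<in> U then 0 else xh i) + (if i \<in> S then 0 else x i)) {..<n}"
    unfolding L2_set_def power2_minus split using sumT by (intro real_sqrt_le_mono) simp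
  also have "\<dots> = L2_set (\<lambda>i. (if i \<in> U then 0 else ?e i) + (if i \<in> U then 0 else x i)) {..<n}"
    using S(2) U(1) by (intro L2_set_cong) auto
  also have "\<dots> \<le> L2_set (\<lambda>i. if i \<in> U then 0 else ?e i) {..<n} + L2_set (\<lambda>i. if i \<in> U then 0 else x i) {..<n}"
    by (rule L2_set_triangle_ineq)
  also have "L2_set (\<lambda>i. if i \<in> U then 0 else ?e i) {..<n} \<le> L2_set ?e {..<n}"
    unfolding L2_set_def by (intro real_sqrt_le_mono sum_mono) auto
  also have "L2_set (\<lambda>i. if i \<in> U then 0 else x i) {..<n} = sqrt (\<Sum>i\<in>{..<n} - U. (x i)\<^sup>2)"
  proof -
    have "(\<Sum>i<n. (if i \<in> U then 0 else x i)\<^sup>2) = (\<Sum>i<n. if i \<in> {..<n} - U then (x i)\<^sup>2 else 0)"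
      by (intro sum.cong) auto
    also have "\<dots> = (\<Sum>i\<in>{..<n} - U. (x i)\<^sup>2)" by (simp add: sum.If_cases set_diff_eq Int_def)
    finally show ?thesis by (simp add: L2_set_def)
  qed
  finally show ?thesis using de by linarith
qed

section \<open>Random signs and random hash functions\<close>

lemma finite_set_Pi_pmf:
  "finite A \<Longrightarrow> (\<And>x. x \<in> A \<Longrightarrow> finite (set_pmf (p x))) \<Longrightarrow> finite (set_pmf (Pi_pmf A d p))"
  by (simp add: set_Pi_pmf finite_PiE_dflt)

text \<open>All distributions here have finite support, so this is an exchange of finite
  sums.\<close>

lemma expectation_pair_pmf:
  fixes f :: "'a \<times> 'b \<Rightarrow> real"
  assumes "finite (set_pmf p)" "finite (set_pmf q)"
  shows "measure_pmf.expectation (pair_pmf p q) f =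
      measure_pmf.expectation p (\<lambda>a. measure_pmf.expectation q (\<lambda>b. f (a, b)))"
    "measure_pmf.expectation (pair_pmf p q) f =
      measure_pmf.expectation q (\<lambda>b. measure_pmf.expectation p (\<lambda>a. f (a, b)))"
proof -
  have 1: "measure_pmf.expectation (pair_pmf p q) f =
     (\<Sum>z\<in>set_pmf p \<times> set_pmf q. f z * pmf (pair_pmf p q) z)"
    using assms by (intro integral_measure_pmf_real) auto
  also have "\<dots> = (\<Sum>a\<in>set_pmf p. (\<Sum>b\<in>set_pmf q. f (a, b) * pmf q b) * pmf p a)"
  proof -
    have "(\<Sum>a\<in>set_pmf p. (\<Sum>b\<in>set_pmf q. f (a, b) * pmf q b) * pmf p a) =
      (\<Sum>a\<in>set_pmf p. \<Sum>b\<in>set_pmf q. f (a, b) * pmf (pair_pmf p q) (a, b))"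
      unfolding sum_distrib_right by (simp add: pmf_pair mult_ac)
    also have "\<dots> = (\<Sum>z\<in>set_pmf p \<times> set_pmf q. f z * pmf (pair_pmf p q) z)"
      unfolding sum.cartesian_product by (intro sum.cong) auto
    finally show ?thesis ..
  qed
  finally have 2: "measure_pmf.expectation (pair_pmf p q) f =
      (\<Sum>a\<in>set_pmf p. (\<Sum>b\<in>set_pmf q. f (a, b) * pmf q b) * pmf p a)" .
  show "measure_pmf.expectation (pair_pmf p q) f =
      measure_pmf.expectation p (\<lambda>a. measure_pmf.expectation q (\<lambda>b. f (a, b)))"
    using assms by (simp add: 2 integral_measure_pmf_real[of "set_pmf p"] integral_measure_pmf_real[of "set_pmf q"])
  have "(\<Sum>a\<in>set_pmf p. (\<Sum>b\<in>set_pmf q. f (a, b) * pmf q b) * pmf p a) =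
     (\<Sum>b\<in>set_pmf q. (\<Sum>a\<in>set_pmf p. f (a, b) * pmf p a) * pmf q b)"
    unfolding sum_distrib_right by (subst sum.swap) (simp add: mult_ac)
  then show "measure_pmf.expectation (pair_pmf p q) f =
      measure_pmf.expectation q (\<lambda>b. measure_pmf.expectation p (\<lambda>a. f (a, b)))"
    using assms by (simp add: 2 integral_measure_pmf_real[of "set_pmf p"] integral_measure_pmf_real[of "set_pmf q"])
qed

lemma expectation_mono_pmf:
  fixes f g :: "'a \<Rightarrow> real"
  assumes "finite (set_pmf p)" "\<And>w. w \<in> set_pmf p \<Longrightarrow> f w \<le> g w"
  shows "measure_pmf.expectation p f \<le> measure_pmf.expectation p g"
  using assms by (intro integral_mono_AE integrable_measure_pmf_finite AE_pmfI) auto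

lemma expectation_cong_pmf:
  fixes f g :: "'a \<Rightarrow> real"
  assumes "\<And>w. w \<in> set_pmf p \<Longrightarrow> f w = g w"
  shows "measure_pmf.expectation p f = measure_pmf.expectation p g"
  using assms by (intro integral_cong_AE AE_pmfI) auto

lemma prob_le_expectation:
  fixes f :: "'a \<Rightarrow> real"
  assumes "finite (set_pmf p)" "\<And>w. w \<in> set_pmf p \<Longrightarrow> 0 \<le> f w" "\<And>w. w \<in> set_pmf p \<Longrightarrow> P w \<Longrightarrow> 1 \<le> f w"
  shows "measure_pmf.prob p {w. P w} \<le> measure_pmf.expectation p f"
proof -
  have "measure_pmf.prob p {w. P w} = measure_pmf.expectation p (indicator {w. P w})" by simp
  also have "\<dots> \<le> measure_pmf.expectation p f"
    using assms by (intro expectation_mono_pmf) (auto simp: indicator_def)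
  finally show ?thesis .
qed

text \<open>Conditioning on the first component: \<open>F\<close> has to be unlikely only where
  \<open>G\<close> holds. It is applied to freeze the first half, then the hashes of the second
  half, then the signs belonging to the selected columns.\<close>

lemma prob_pair_le:
  assumes "finite (set_pmf p)" "finite (set_pmf q)"
    and "\<And>a. a \<in> set_pmf p \<Longrightarrow> G a \<Longrightarrow> measure_pmf.prob q {b. F a b} \<le> \<epsilon>" "0 \<le> \<epsilon>"
  shows "measure_pmf.prob (pair_pmf p q) {z. \<not> G (fst z) \<or> F (fst z) (snd z)} \<le>
     measure_pmf.prob p {a. \<not> G a} + \<epsilon>"
proof -
  have "measure_pmf.prob (pair_pmf p q) {z. \<not> G (fst z) \<or> F (fst z) (snd z)} =
     measure_pmf.expectation (pair_pmf p q) (indicator {z. \<not> G (fst z) \<or> F (fst z) (snd z)})" by simp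
  also have "\<dots> = measure_pmf.expectation p (\<lambda>a. measure_pmf.expectation q
     (\<lambda>b. indicator {z. \<not> G (fst z) \<or> F (fst z) (snd z)} (a, b)))"
    by (rule expectation_pair_pmf[OF assms(1,2)])
  also have "\<dots> \<le> measure_pmf.expectation p (\<lambda>a. indicator {a. \<not> G a} a + \<epsilon>)"
  proof (rule expectation_mono_pmf[OF assms(1)])
    fix a assume a: "a \<in> set_pmf p"
    show "measure_pmf.expectation q (\<lambda>b. indicator {z. \<not> G (fst z) \<or> F (fst z) (snd z)} (a, b)) \<le>
       indicator {a. \<not> G a} a + \<epsilon>"
    proof (cases "G a")
      case True
      then have "(\<lambda>b. indicator {z. \<not> G (fst z) \<or> F (fst z) (snd z)} (a, b) :: real) = indicator {b. F a b}"
        by (auto simp: indicator_def fun_eq_iff)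
      then show ?thesis using assms(3)[OF a True] True by simp
    next
      case False
      then have "(\<lambda>b. indicator {z. \<not> G (fst z) \<or> F (fst z) (snd z)} (a, b) :: real) = (\<lambda>_. 1)"
        by (auto simp: indicator_def fun_eq_iff)
      then show ?thesis using False assms(4) by simp
    qed
  qed
  also have "\<dots> = measure_pmf.prob p {a. \<not> G a} + \<epsilon>"
    using integrable_measure_pmf_finite[OF assms(1)] by (subst Bochner_Integration.integral_add) auto
  finally show ?thesis .
qed

section \<open>Random signs: moments of weighted sums\<close>

definition sign_pmf :: "real pmf" where
  "sign_pmf = pmf_of_set {-1, 1}"

lemma sign_pmf: "set_pmf sign_pmf = {-1, 1}" "measure_pmf.expectation sign_pmf f = (f (-1) + f 1) / 2" for f :: "real \<Rightarrow> real"
  by (simp_all add: sign_pmf_def integral_pmf_of_set)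

lemma finite_signs: "finite A \<Longrightarrow> finite (set_pmf (Pi_pmf A d (\<lambda>_. sign_pmf)))"
  by (intro finite_set_Pi_pmf) (auto simp: sign_pmf)

lemma expectation_signs_insert:
  fixes f :: "('a \<Rightarrow> real) \<Rightarrow> real"
  assumes "finite A" "x \<notin> A"
  shows "measure_pmf.expectation (Pi_pmf (insert x A) d (\<lambda>_. sign_pmf)) f =
    (measure_pmf.expectation (Pi_pmf A d (\<lambda>_. sign_pmf)) (\<lambda>s. f (s(x := -1))) +
     measure_pmf.expectation (Pi_pmf A d (\<lambda>_. sign_pmf)) (\<lambda>s. f (s(x := 1)))) / 2"
  unfolding Pi_pmf_insert[OF assms] integral_map_pmf
  by (subst expectation_pair_pmf(1)) (use finite_signs[OF assms(1)] in \<open>auto simp: sign_pmf\<close>)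

lemma sum_signs_upd:
  "finite A \<Longrightarrow> x \<notin> A \<Longrightarrow> (\<Sum>l\<in>insert x A. a l * (s(x := v)) l) = a x * v + (\<Sum>l\<in>A. a l * s l)"
  for a s :: "'a \<Rightarrow> real"
  by (auto intro!: sum.cong)

lemma signs_second_moment:
  fixes a :: "'a \<Rightarrow> real"
  assumes "finite A"
  shows "measure_pmf.expectation (Pi_pmf A d (\<lambda>_. sign_pmf)) (\<lambda>s. (z + (\<Sum>l\<in>A. a l * s l))\<^sup>2) =
    z\<^sup>2 + (\<Sum>l\<in>A. (a l)\<^sup>2)"
  using assms
proof (induction A arbitrary: z rule: finite_induct)
  case (insert x A)
  have "measure_pmf.expectation (Pi_pmf A d (\<lambda>_. sign_pmf))
      (\<lambda>s. (z + (\<Sum>l\<in>insert x A. a l * (s(x := v)) l))\<^sup>2) = (z + a x * v)\<^sup>2 + (\<Sum>l\<in>A. (a l)\<^sup>2)" for v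
    using insert.IH[of "z + a x * v"] unfolding sum_signs_upd[OF insert.hyps] by (simp add: add.assoc)
  note step = this
  show ?case unfolding expectation_signs_insert[OF insert.hyps] step
    using insert.hyps by (simp add: power2_eq_square algebra_simps)
qed simp

text \<open>Hoeffding's lemma for a fair sign: probability 1/2 and an interval of length
  \<open>2 * w\<close>, shifted by \<open>w\<close>.\<close>

lemma cosh_le_exp_half_square: "(exp w + exp (- w)) / 2 \<le> exp (w\<^sup>2 / 2)" for w :: real
proof -
  have *: "(exp w + exp (- w)) / 2 \<le> exp (w\<^sup>2 / 2)" if "0 \<le> w" for w :: real
  proof -
    have "- (2 * w) * (1 / 2) + ln (1 + (1 / 2) * (exp (2 * w) - 1)) \<le> (2 * w)\<^sup>2 / 8"
      using that by (intro Hoeffdings_lemma_aux) auto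
    then have "ln ((1 + exp (2 * w)) / 2) \<le> w + w\<^sup>2 / 2"
      by (simp add: power2_eq_square field_simps)
    moreover have "0 < (1 + exp (2 * w)) / 2" by (simp add: add_pos_pos)
    ultimately have "(1 + exp (2 * w)) / 2 \<le> exp (w + w\<^sup>2 / 2)"
      by (metis exp_le_cancel_iff exp_ln)
    then have "exp (- w) * ((1 + exp (2 * w)) / 2) \<le> exp (- w) * exp (w + w\<^sup>2 / 2)"
      by (intro mult_left_mono) auto
    then show ?thesis by (simp add: mult_exp_exp distrib_left flip: exp_add)
  qed
  show ?thesis using *[of w] *[of "- w"] by (cases "0 \<le> w") (auto simp: add.commute)
qed

text \<open>Averages out one sign of weight \<open>a\<close>, where \<open>V\<close> is the energy
  of the signs averaged before. The smallness condition keeps the coefficient \<open>u\<close> below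
  \<open>2 * t\<close>, so the cosh bound for the cross term costs at most 8 t^2 a^2 z^2; this is
  exactly the growth of the coefficient when \<open>V\<close> becomes V + a^2.\<close>

lemma sign_step:
  fixes u z a t V :: real
  assumes t: "0 \<le> t" and V: "0 \<le> V" "8 * t * (V + a\<^sup>2) \<le> 1"
  defines "u \<equiv> t + 8 * t\<^sup>2 * V"
  shows "(exp (u * (z - a)\<^sup>2) + exp (u * (z + a)\<^sup>2)) / 2 \<le>
    exp ((t + 8 * t\<^sup>2 * (V + a\<^sup>2)) * z\<^sup>2 + 2 * t * a\<^sup>2)"
proof -
  have "8 * t * V \<le> 1" using V t mult_left_mono[of V "V + a\<^sup>2" "8 * t"] by simp
  then have "t * (8 * t * V) \<le> t * 1" using t by (intro mult_left_mono)
  then have u: "0 \<le> u" "u \<le> 2 * t" using t V by (auto simp: u_def power2_eq_square algebra_simps)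
  have "(exp (u * (z - a)\<^sup>2) + exp (u * (z + a)\<^sup>2)) / 2 =
     exp (u * z\<^sup>2 + u * a\<^sup>2) * ((exp (2 * u * z * a) + exp (- (2 * u * z * a))) / 2)"
  proof -
    have "u * (z - a)\<^sup>2 = (u * z\<^sup>2 + u * a\<^sup>2) + - (2 * u * z * a)"
      "u * (z + a)\<^sup>2 = (u * z\<^sup>2 + u * a\<^sup>2) + 2 * u * z * a"
      by (simp_all add: power2_eq_square algebra_simps)
    then show ?thesis by (simp only: exp_add) (simp add: algebra_simps add_divide_distrib)
  qed
  also have "\<dots> \<le> exp (u * z\<^sup>2 + u * a\<^sup>2) * exp ((2 * u * z * a)\<^sup>2 / 2)"
    by (intro mult_left_mono cosh_le_exp_half_square) auto
  also have "\<dots> = exp (u * z\<^sup>2 + u * a\<^sup>2 + 2 * u\<^sup>2 * a\<^sup>2 * z\<^sup>2)"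
    by (simp add: mult_exp_exp power2_eq_square algebra_simps)
  also have "\<dots> \<le> exp ((t + 8 * t\<^sup>2 * (V + a\<^sup>2)) * z\<^sup>2 + 2 * t * a\<^sup>2)"
  proof -
    have "u * a\<^sup>2 \<le> 2 * t * a\<^sup>2" using u by (intro mult_right_mono) auto
    moreover have "u\<^sup>2 \<le> (2 * t)\<^sup>2" using u by (intro power_mono) auto
    then have "u\<^sup>2 * (2 * a\<^sup>2 * z\<^sup>2) \<le> (2 * t)\<^sup>2 * (2 * a\<^sup>2 * z\<^sup>2)" by (intro mult_right_mono) auto
    moreover have "(t + 8 * t\<^sup>2 * (V + a\<^sup>2)) * z\<^sup>2 = u * z\<^sup>2 + (2 * t)\<^sup>2 * (2 * a\<^sup>2 * z\<^sup>2)"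
      by (simp add: u_def algebra_simps)
    moreover have "2 * u\<^sup>2 * a\<^sup>2 * z\<^sup>2 = u\<^sup>2 * (2 * a\<^sup>2 * z\<^sup>2)" by simp
    ultimately show ?thesis unfolding exp_le_cancel_iff by linarith
  qed
  finally show ?thesis .
qed

text \<open>The condition on \<open>t\<close> is imposed on each group separately, while the
  exponent on the right adds up the groups. So \<open>t\<close> may be as large as the inverse of
  eight times the largest group energy, however many groups there are. The offsets \<open>z\<close>
  serve the induction: removing one sign shifts the offset of its own group only.\<close>

lemma signs_square_mgf:
  fixes a :: "'a \<Rightarrow> real" and g :: "'a \<Rightarrow> 'b" and z :: "'b \<Rightarrow> real"
  assumes A: "finite A" and I: "finite I" and t: "0 \<le> t"
    and gA: "g ` A \<subseteq> I" and V: "\<And>i. i \<in> I \<Longrightarrow> 8 * t * (\<Sum>l | l \<in> A \<and> g l = i. (a l)\<^sup>2) \<le> 1"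
  shows "measure_pmf.expectation (Pi_pmf A d (\<lambda>_. sign_pmf))
      (\<lambda>s. exp (t * (\<Sum>i\<in>I. (z i + (\<Sum>l | l \<in> A \<and> g l = i. a l * s l))\<^sup>2))) \<le>
    exp (\<Sum>i\<in>I. (t + 8 * t\<^sup>2 * (\<Sum>l | l \<in> A \<and> g l = i. (a l)\<^sup>2)) * (z i)\<^sup>2 + 2 * t * (\<Sum>l | l \<in> A \<and> g l = i. (a l)\<^sup>2))"
  using A gA V
proof (induction A arbitrary: z rule: finite_induct)
  case empty
  then show ?case by (simp add: sum_distrib_left)
next
  case (insert x A)
  define W where "W i = (\<Sum>l | l \<in> A \<and> g l = i. (a l)\<^sup>2)" for i
  have gx: "g x \<in> I" and gA: "g ` A \<subseteq> I" using insert.prems by auto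
  have cl: "{l. l \<in> insert x A \<and> g l = i} = (if i = g x then insert x {l. l \<in> A \<and> g l = i} else {l. l \<in> A \<and> g l = i})" for i
    by auto
  have fin: "finite {l. l \<in> A \<and> g l = i}" for i using insert.hyps by simp
  have Wx: "(\<Sum>l | l \<in> insert x A \<and> g l = i. (a l)\<^sup>2) = (if i = g x then W i + (a x)\<^sup>2 else W i)" for i
    unfolding cl using insert.hyps fin by (auto simp: W_def)
  have W0: "0 \<le> W i" for i by (simp add: W_def sum_nonneg)
  have V: "8 * t * W i \<le> 1" if "i \<in> I" for i
  proof -
    have "8 * t * W i \<le> 8 * t * (if i = g x then W i + (a x)\<^sup>2 else W i)" using t by (intro mult_left_mono) auto
    then show ?thesis using insert.prems(2)[OF that] unfolding Wx by linarith
  qed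
  \<comment> \<open>The part of the exponent that does not depend on the sign being
    averaged.\<close>
  define R where "R = (\<Sum>i\<in>I - {g x}. (t + 8 * t\<^sup>2 * W i) * (z i)\<^sup>2 + 2 * t * W i) + 2 * t * W (g x)"
  have IH: "measure_pmf.expectation (Pi_pmf A d (\<lambda>_. sign_pmf))
      (\<lambda>s. exp (t * (\<Sum>i\<in>I. (z i + (\<Sum>l | l \<in> insert x A \<and> g l = i. a l * (s(x := v)) l))\<^sup>2))) \<le>
      exp ((t + 8 * t\<^sup>2 * W (g x)) * (z (g x) + a x * v)\<^sup>2) * exp R" for v
  proof -
    define z' where "z' = z(g x := z (g x) + a x * v)"
    have "z i + (\<Sum>l | l \<in> insert x A \<and> g l = i. a l * (s(x := v)) l) = z' i + (\<Sum>l | l \<in> A \<and> g l = i. a l * s l)" for i s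
    proof -
      have "(\<Sum>l | l \<in> A \<and> g l = i. a l * (s(x := v)) l) = (\<Sum>l | l \<in> A \<and> g l = i. a l * s l)"
        using insert.hyps by (intro sum.cong) auto
      then show ?thesis unfolding cl using insert.hyps fin by (auto simp: z'_def)
    qed
    then have "measure_pmf.expectation (Pi_pmf A d (\<lambda>_. sign_pmf))
      (\<lambda>s. exp (t * (\<Sum>i\<in>I. (z i + (\<Sum>l | l \<in> insert x A \<and> g l = i. a l * (s(x := v)) l))\<^sup>2))) =
      measure_pmf.expectation (Pi_pmf A d (\<lambda>_. sign_pmf))
      (\<lambda>s. exp (t * (\<Sum>i\<in>I. (z' i + (\<Sum>l | l \<in> A \<and> g l = i. a l * s l))\<^sup>2)))" by simp
    also have "\<dots> \<le> exp (\<Sum>i\<in>I. (t + 8 * t\<^sup>2 * W i) * (z' i)\<^sup>2 + 2 * t * W i)"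
      unfolding W_def by (rule insert.IH[OF gA]) (use V in \<open>simp add: W_def\<close>)
    also have "(\<Sum>i\<in>I. (t + 8 * t\<^sup>2 * W i) * (z' i)\<^sup>2 + 2 * t * W i) =
       (t + 8 * t\<^sup>2 * W (g x)) * (z (g x) + a x * v)\<^sup>2 + R"
      unfolding R_def sum.remove[OF I gx] by (simp add: z'_def)
    finally show ?thesis by (simp add: exp_add)
  qed
  have "measure_pmf.expectation (Pi_pmf (insert x A) d (\<lambda>_. sign_pmf))
      (\<lambda>s. exp (t * (\<Sum>i\<in>I. (z i + (\<Sum>l | l \<in> insert x A \<and> g l = i. a l * s l))\<^sup>2))) \<le>
    (exp ((t + 8 * t\<^sup>2 * W (g x)) * (z (g x) + a x * (-1))\<^sup>2) * exp R +
     exp ((t + 8 * t\<^sup>2 * W (g x)) * (z (g x) + a x * 1)\<^sup>2) * exp R) / 2"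
    unfolding expectation_signs_insert[OF insert.hyps]
    by (intro divide_right_mono add_mono IH) auto
  also have "\<dots> = ((exp ((t + 8 * t\<^sup>2 * W (g x)) * (z (g x) - a x)\<^sup>2) +
     exp ((t + 8 * t\<^sup>2 * W (g x)) * (z (g x) + a x)\<^sup>2)) / 2) * exp R"
    by (simp add: algebra_simps add_divide_distrib)
  also have "\<dots> \<le> exp ((t + 8 * t\<^sup>2 * (W (g x) + (a x)\<^sup>2)) * (z (g x))\<^sup>2 + 2 * t * (a x)\<^sup>2) * exp R"
    using insert.prems(2)[OF gx] unfolding Wx by (intro mult_right_mono sign_step t W0) auto
  also have "\<dots> = exp (\<Sum>i\<in>I. (t + 8 * t\<^sup>2 * (if i = g x then W i + (a x)\<^sup>2 else W i)) * (z i)\<^sup>2 +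
     2 * t * (if i = g x then W i + (a x)\<^sup>2 else W i))"
  proof -
    have "(\<Sum>i\<in>I - {g x}. (t + 8 * t\<^sup>2 * (if i = g x then W i + (a x)\<^sup>2 else W i)) * (z i)\<^sup>2 +
     2 * t * (if i = g x then W i + (a x)\<^sup>2 else W i)) = (\<Sum>i\<in>I - {g x}. (t + 8 * t\<^sup>2 * W i) * (z i)\<^sup>2 + 2 * t * W i)"
      by (intro sum.cong) auto
    then show ?thesis unfolding sum.remove[OF I gx] R_def by (simp add: mult_exp_exp algebra_simps)
  qed
  finally show ?case unfolding Wx .
qed

section \<open>Uniform hash functions\<close>

definition hash_pmf :: "nat \<Rightarrow> nat \<Rightarrow> (nat \<Rightarrow> nat) pmf" where
  "hash_pmf n B = Pi_pmf {..<n} 0 (\<lambda>_. pmf_of_set {..<B})"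

lemma set_hash_pmf:
  assumes "0 < B"
  shows "finite (set_pmf (hash_pmf n B))" "h \<in> set_pmf (hash_pmf n B) \<Longrightarrow> i < n \<Longrightarrow> h i < B"
proof -
  have s: "set_pmf (pmf_of_set {..<B}) = {..<B}" using assms by (intro set_pmf_of_set) auto
  show "finite (set_pmf (hash_pmf n B))" unfolding hash_pmf_def using s by (intro finite_set_Pi_pmf) auto
  show "h \<in> set_pmf (hash_pmf n B) \<Longrightarrow> i < n \<Longrightarrow> h i < B"
    using s by (auto simp: hash_pmf_def set_Pi_pmf PiE_dflt_def)
qed

text \<open>Given all other hash values, the bucket of \<open>l\<close> is still uniform and hits
  the bucket of \<open>i\<close> with probability 1/B.\<close>

lemma hash_collision:
  assumes B: "0 < B" and il: "i < n" "l < n" "i \<noteq> l"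
  shows "measure_pmf.expectation (hash_pmf n B) (\<lambda>h. if h l = h i then c else 0) = c / real B"
proof -
  let ?u = "\<lambda>_::nat. pmf_of_set {..<B}"
  have s: "set_pmf (pmf_of_set {..<B}) = {..<B}" using B by (intro set_pmf_of_set) auto
  have fin: "finite (set_pmf (pmf_of_set {..<B}))" "finite (set_pmf (Pi_pmf ({..<n} - {l}) 0 ?u))"
    using s finite_set_Pi_pmf[of "{..<n} - {l}" ?u 0] by simp_all
  have hp: "hash_pmf n B = map_pmf (\<lambda>(y, f). f(l := y)) (pair_pmf (pmf_of_set {..<B}) (Pi_pmf ({..<n} - {l}) 0 ?u))"
    unfolding hash_pmf_def using Pi_pmf_insert[of "{..<n} - {l}" l 0 ?u] il by (simp add: insert_absorb)
  have "measure_pmf.expectation (hash_pmf n B) (\<lambda>h. if h l = h i then c else 0) =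
    measure_pmf.expectation (pair_pmf (pmf_of_set {..<B}) (Pi_pmf ({..<n} - {l}) 0 ?u))
      (\<lambda>z. if fst z = snd z i then c else 0)"
    unfolding hp integral_map_pmf using il by (simp add: case_prod_beta)
  also have "\<dots> = measure_pmf.expectation (Pi_pmf ({..<n} - {l}) 0 ?u)
     (\<lambda>h. measure_pmf.expectation (pmf_of_set {..<B}) (\<lambda>v. if v = h i then c else 0))"
    unfolding expectation_pair_pmf(2)[OF fin] fst_conv snd_conv ..
  also have "\<dots> = measure_pmf.expectation (Pi_pmf ({..<n} - {l}) 0 ?u) (\<lambda>_. c / real B)"
  proof (rule expectation_cong_pmf)
    fix h assume "h \<in> set_pmf (Pi_pmf ({..<n} - {l}) 0 ?u)"
    then have "h i < B" using s il by (auto simp: set_Pi_pmf PiE_dflt_def)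
    then show "measure_pmf.expectation (pmf_of_set {..<B}) (\<lambda>v. if v = h i then c else 0) = c / real B"
      using B by (subst integral_pmf_of_set) auto
  qed
  finally show ?thesis by simp
qed

lemma hash_collision_sum:
  assumes B: "0 < B" and i: "i < n" and U: "U \<subseteq> {..<n}" "i \<notin> U"
  shows "measure_pmf.expectation (hash_pmf n B) (\<lambda>h. \<Sum>l\<in>U. if h l = h i then c l else 0) = sum c U / real B"
proof -
  have "measure_pmf.expectation (hash_pmf n B) (\<lambda>h. \<Sum>l\<in>U. if h l = h i then c l else 0) =
    (\<Sum>l\<in>U. measure_pmf.expectation (hash_pmf n B) (\<lambda>h. if h l = h i then c l else 0))"
    by (rule Bochner_Integration.integral_sum) (rule integrable_measure_pmf_finite[OF set_hash_pmf(1)[OF B]])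
  also have "\<dots> = (\<Sum>l\<in>U. c l / real B)"
    using U by (intro sum.cong hash_collision B i) auto
  finally show ?thesis by (simp add: sum_divide_distrib)
qed

section \<open>Independent blocks: majority and load bounds\<close>

lemma iid_product_moment:
  fixes f :: "'a \<Rightarrow> real"
  assumes "finite (set_pmf q)" "\<And>w. w \<in> set_pmf q \<Longrightarrow> 0 \<le> f w"
  shows "measure_pmf.expectation (Pi_pmf {..<L::nat} d (\<lambda>_. q)) (\<lambda>w. \<Prod>j<L. f (w j)) =
    measure_pmf.expectation q f ^ L"
  using assms by (subst expectation_prod_Pi_pmf) (auto intro: integrable_measure_pmf_finite)

text \<open>Weighting a bad outcome by 16 gives mean at most 1 + 15/16 per copy, whereas a bad half
  among \<open>L\<close> copies gives a product of at least 16^(L/2) = 4^L. Markov's inequality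
  leaves (2/4)^L.\<close>

lemma iid_majority_bound:
  assumes q: "finite (set_pmf q)" and p: "measure_pmf.prob q {w. P w} \<le> 1 / 16"
  shows "measure_pmf.prob (Pi_pmf {..<L::nat} d (\<lambda>_. q)) {w. L \<le> 2 * card {j. j < L \<and> P (w j)}} \<le> (1/2) ^ L"
proof -
  define f where "f w = (if P w then 16 else 1 :: real)" for w
  have Ef: "measure_pmf.expectation q f \<le> 2"
  proof -
    have "measure_pmf.expectation q f = measure_pmf.expectation q (\<lambda>w. 1 + 15 * indicator {w. P w} w)"
      by (intro expectation_cong_pmf) (auto simp: f_def)
    also have "\<dots> = 1 + 15 * measure_pmf.prob q {w. P w}"
      using integrable_measure_pmf_finite[OF q] by (subst Bochner_Integration.integral_add) auto
    finally show ?thesis using p by simp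
  qed
  have E0: "0 \<le> measure_pmf.expectation q f" by (intro integral_nonneg_AE AE_pmfI) (simp add: f_def)
  let ?P = "Pi_pmf {..<L} d (\<lambda>_. q)"
  have fin: "finite (set_pmf ?P)" using q by (intro finite_set_Pi_pmf) auto
  have prod: "(\<Prod>j<L. f (w j)) = 16 ^ card {j. j < L \<and> P (w j)}" for w
  proof -
    have "(\<Prod>j<L. f (w j)) = (\<Prod>j\<in>{..<L} \<inter> {j. P (w j)}. 16)" unfolding f_def by (simp add: prod.If_cases)
    also have "{..<L} \<inter> {j. P (w j)} = {j. j < L \<and> P (w j)}" by auto
    finally show ?thesis by simp
  qed
  have "measure_pmf.prob ?P {w. L \<le> 2 * card {j. j < L \<and> P (w j)}} \<le>
     measure_pmf.expectation ?P (\<lambda>w. (1/4) ^ L * (\<Prod>j<L. f (w j)))"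
  proof (rule prob_le_expectation[OF fin])
    show "0 \<le> (1/4) ^ L * (\<Prod>j<L. f (w j))" for w by (simp add: prod)
    fix w assume "L \<le> 2 * card {j. j < L \<and> P (w j)}"
    then have "(4::real) ^ L \<le> 4 ^ (2 * card {j. j < L \<and> P (w j)})" by (intro power_increasing) auto
    also have "\<dots> = (\<Prod>j<L. f (w j))" by (simp add: prod power_mult)
    finally show "1 \<le> (1/4) ^ L * (\<Prod>j<L. f (w j))" by (simp add: power_divide field_simps)
  qed
  also have "\<dots> = (1/4) ^ L * measure_pmf.expectation q f ^ L"
    using iid_product_moment[OF q, of f] by (simp add: f_def)
  also have "\<dots> \<le> (1/4) ^ L * 2 ^ L" using Ef E0 by (intro mult_left_mono power_mono) auto
  also have "\<dots> = (1/2) ^ L" by (simp flip: power_mult_distrib)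
  finally show ?thesis .
qed

text \<open>The mean load is at most L E / B, but only L E / ln k is claimed, and a large deviation
  bound at rate ln k / E suffices. The chord of the exponential on the interval from 0 to 1 bounds
  one factor by 1 + (k - 1) / B \<le> 17/16, while the threshold is worth a factor e per
  copy.\<close>

lemma iid_load_bound:
  fixes W :: "'a \<Rightarrow> real"
  assumes q: "finite (set_pmf q)" and E: "0 < E" and W: "\<And>w. w \<in> set_pmf q \<Longrightarrow> 0 \<le> W w \<and> W w \<le> E"
    and EW: "measure_pmf.expectation q W \<le> E / B" and k: "1 < k" "16 * k \<le> B"
  shows "measure_pmf.prob (Pi_pmf {..<L::nat} d (\<lambda>_. q)) {w. real L * E / ln k \<le> (\<Sum>j<L. W (w j))} \<le> (1/2) ^ L"
proof -
  define f where "f w = exp (ln k * (W w / E))" for w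
  have lnk: "0 < ln k" using k by simp
  have Ef: "measure_pmf.expectation q f \<le> 17 / 16"
  proof -
    have "measure_pmf.expectation q f \<le> measure_pmf.expectation q (\<lambda>w. 1 + (k - 1) / E * W w)"
    proof (rule expectation_mono_pmf[OF q])
      fix w assume "w \<in> set_pmf q"
      then have v: "0 \<le> W w / E" "W w / E \<le> 1" using W[of w] E by auto
      have "exp ((1 - W w / E) * 0 + W w / E * ln k) \<le> (1 - W w / E) * exp 0 + W w / E * exp (ln k)"
        using convex_onD[OF exp_convex, of "W w / E" 0 "ln k"] v by simp
      then show "f w \<le> 1 + (k - 1) / E * W w" using k by (simp add: f_def algebra_simps diff_divide_distrib)
    qed
    also have "\<dots> = 1 + (k - 1) / E * measure_pmf.expectation q W"
      using integrable_measure_pmf_finite[OF q] by (subst Bochner_Integration.integral_add) auto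
    also have "\<dots> \<le> 1 + (k - 1) / E * (E / B)" using EW k E by (intro add_left_mono mult_left_mono) auto
    also have "\<dots> = 1 + (k - 1) / B" using E by simp
    also have "\<dots> \<le> 17 / 16" using k by (simp add: field_simps)
    finally show ?thesis .
  qed
  have E0: "0 \<le> measure_pmf.expectation q f" by (intro integral_nonneg_AE AE_pmfI) (simp add: f_def)
  let ?P = "Pi_pmf {..<L} d (\<lambda>_. q)"
  have fin: "finite (set_pmf ?P)" using q by (intro finite_set_Pi_pmf) auto
  have prod: "(\<Prod>j<L. f (w j)) = exp (ln k / E * (\<Sum>j<L. W (w j)))" for w
    by (simp add: f_def exp_sum[symmetric] sum_distrib_left)
  have "measure_pmf.prob ?P {w. real L * E / ln k \<le> (\<Sum>j<L. W (w j))} \<le>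
     measure_pmf.expectation ?P (\<lambda>w. exp (- real L) * (\<Prod>j<L. f (w j)))"
  proof (rule prob_le_expectation[OF fin])
    show "0 \<le> exp (- real L) * (\<Prod>j<L. f (w j))" for w by (simp add: prod)
    fix w assume "real L * E / ln k \<le> (\<Sum>j<L. W (w j))"
    then have "ln k / E * (real L * E / ln k) \<le> ln k / E * (\<Sum>j<L. W (w j))"
      using lnk E by (intro mult_left_mono) auto
    then have "real L \<le> ln k / E * (\<Sum>j<L. W (w j))" using lnk E by simp
    then show "1 \<le> exp (- real L) * (\<Prod>j<L. f (w j))" by (simp add: prod mult_exp_exp)
  qed
  also have "\<dots> = exp (- real L) * measure_pmf.expectation q f ^ L"
    using iid_product_moment[OF q, of f] by (simp add: f_def)
  also have "\<dots> \<le> exp (- real L) * (17 / 16) ^ L" using Ef E0 by (intro mult_left_mono power_mono) auto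
  also have "\<dots> = (exp (-1) * (17 / 16)) ^ L"
    using exp_of_nat_mult[of L "-1 :: real"] by (simp add: power_mult_distrib power_divide)
  also have "\<dots> \<le> (1/2) ^ L"
  proof (rule power_mono)
    have "(17 / 8 :: real) \<le> exp 1" using exp_lower_Taylor_quadratic[of 1] by simp
    then show "exp (-1) * (17 / 16) \<le> (1/2 :: real)" by (simp add: exp_minus field_simps)
  qed simp
  finally show ?thesis .
qed

section \<open>Failure probabilities of the two halves\<close>

definition crowded :: "nat \<Rightarrow> (nat \<Rightarrow> real) \<Rightarrow> real \<Rightarrow> nat \<Rightarrow> (nat \<Rightarrow> nat) \<Rightarrow> (nat \<Rightarrow> real) \<Rightarrow> bool" where
  "crowded n x \<theta> i h s \<longleftrightarrow> \<theta> / 4 < \<bar>\<Sum>l\<in>{..<n} - {i}. if h l = h i then s l * x l else 0\<bar>"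

definition row_pmf :: "nat \<Rightarrow> nat \<Rightarrow> ((nat \<Rightarrow> nat) \<times> (nat \<Rightarrow> real)) pmf" where
  "row_pmf n B = pair_pmf (hash_pmf n B) (Pi_pmf {..<n} 1 (\<lambda>_. sign_pmf))"

lemma finite_row_pmf: "0 < B \<Longrightarrow> finite (set_pmf (row_pmf n B))"
  unfolding row_pmf_def by (simp add: set_hash_pmf finite_signs)

text \<open>Two causes are added up in \<open>f\<close>: another member of \<open>T\<close> in the
  bucket, with probability at most k/B, and noise from the tail, where Chebyshev's inequality at
  \<theta>/4 gives at most 16 K / B. The size of \<open>B\<close> makes the sum at most
  1/16.\<close>

lemma crowded_prob:
  fixes x :: "nat \<Rightarrow> real"
  assumes B: "0 < B" and i: "i < n" and T: "T \<subseteq> {..<n}" "card T \<le> k" and \<theta>: "0 < \<theta>"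
    and tail: "(\<Sum>l\<in>{..<n} - T. (x l)\<^sup>2) \<le> K * \<theta>\<^sup>2" and BK: "16 * (real k + 16 * K) \<le> real B"
  shows "measure_pmf.prob (row_pmf n B) {w. crowded n x \<theta> i (fst w) (snd w)} \<le> 1 / 16"
proof -
  define U where "U = {..<n} - T - {i}"
  have fT: "finite T" using T finite_subset by blast
  define a where "a h l = (if l \<in> U \<and> h l = h i then x l else 0)" for h :: "nat \<Rightarrow> nat" and l
  define c1 where "c1 h = (\<Sum>l\<in>T - {i}. if h l = h i then 1 else (0::real))" for h :: "nat \<Rightarrow> nat"
  define f where "f w = c1 (fst w) + 16 / \<theta>\<^sup>2 * (0 + (\<Sum>l<n. a (fst w) l * snd w l))\<^sup>2" for w
  have c10: "0 \<le> c1 h" for h by (simp add: c1_def sum_nonneg)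
  have "measure_pmf.prob (row_pmf n B) {w. crowded n x \<theta> i (fst w) (snd w)} \<le> measure_pmf.expectation (row_pmf n B) f"
  proof (rule prob_le_expectation[OF finite_row_pmf[OF B]])
    show "0 \<le> f w" for w using c10 by (simp add: f_def)
    fix w assume cw: "crowded n x \<theta> i (fst w) (snd w)"
    obtain h s where w: "w = (h, s)" by fastforce
    show "1 \<le> f w"
    proof (cases "\<exists>l\<in>T - {i}. h l = h i")
      case True
      then obtain l where l: "l \<in> T - {i}" "h l = h i" by blast
      have "(if h l = h i then 1 else (0::real)) \<le> c1 h"
        unfolding c1_def using l fT by (intro member_le_sum) auto
      then show ?thesis using l by (simp add: f_def w add_increasing2)
    next
      case False
      have "(\<Sum>l<n. a h l * s l) = (\<Sum>l\<in>{..<n} - {i}. if h l = h i then s l * x l else 0)"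
      proof (rule sum.mono_neutral_cong_right)
        show "\<forall>l\<in>{..<n} - ({..<n} - {i}). a h l * s l = 0" by (auto simp: a_def U_def)
        fix l assume "l \<in> {..<n} - {i}"
        then show "a h l * s l = (if h l = h i then s l * x l else 0)"
          using False by (auto simp: a_def U_def)
      qed auto
      then have "\<theta> / 4 < \<bar>\<Sum>l<n. a h l * s l\<bar>" using cw by (simp add: crowded_def w)
      then have "(\<theta> / 4)\<^sup>2 < \<bar>\<Sum>l<n. a h l * s l\<bar>\<^sup>2" using \<theta> by (intro power_strict_mono) auto
      then have "1 \<le> 16 / \<theta>\<^sup>2 * (\<Sum>l<n. a h l * s l)\<^sup>2" using \<theta> by (simp add: power_divide field_simps)
      then show ?thesis using c10[of h] by (simp add: f_def w)
    qed
  qed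
  also have "measure_pmf.expectation (row_pmf n B) f =
     measure_pmf.expectation (hash_pmf n B) (\<lambda>h. c1 h + 16 / \<theta>\<^sup>2 * (\<Sum>l\<in>U. if h l = h i then (x l)\<^sup>2 else 0))"
    unfolding row_pmf_def
  proof (subst expectation_pair_pmf(1)[OF set_hash_pmf(1)[OF B] finite_signs[OF finite_lessThan]], rule expectation_cong_pmf)
    fix h
    let ?S = "Pi_pmf {..<n} 1 (\<lambda>_. sign_pmf)"
    have "measure_pmf.expectation ?S (\<lambda>s. f (h, s)) =
       c1 h + 16 / \<theta>\<^sup>2 * measure_pmf.expectation ?S (\<lambda>s. (0 + (\<Sum>l<n. a h l * s l))\<^sup>2)"
      unfolding f_def fst_conv snd_conv
      using integrable_measure_pmf_finite[OF finite_signs[OF finite_lessThan[of n], of 1]]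
      by (subst Bochner_Integration.integral_add) auto
    also have "measure_pmf.expectation ?S (\<lambda>s. (0 + (\<Sum>l<n. a h l * s l))\<^sup>2) = (\<Sum>l<n. (a h l)\<^sup>2)"
      by (subst signs_second_moment) auto
    also have "(\<Sum>l<n. (a h l)\<^sup>2) = (\<Sum>l\<in>U. if h l = h i then (x l)\<^sup>2 else 0)"
      by (rule sum.mono_neutral_cong_right) (auto simp: a_def U_def)
    finally show "measure_pmf.expectation ?S (\<lambda>s. f (h, s)) =
       c1 h + 16 / \<theta>\<^sup>2 * (\<Sum>l\<in>U. if h l = h i then (x l)\<^sup>2 else 0)" .
  qed
  also have "\<dots> = measure_pmf.expectation (hash_pmf n B) c1 +
     16 / \<theta>\<^sup>2 * measure_pmf.expectation (hash_pmf n B) (\<lambda>h. \<Sum>l\<in>U. if h l = h i then (x l)\<^sup>2 else 0)"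
    using integrable_measure_pmf_finite[OF set_hash_pmf(1)[OF B]]
    by (subst Bochner_Integration.integral_add) auto
  also have "measure_pmf.expectation (hash_pmf n B) c1 = (\<Sum>l\<in>T - {i}. 1) / real B"
    unfolding c1_def using T by (intro hash_collision_sum B i) auto
  also have "measure_pmf.expectation (hash_pmf n B) (\<lambda>h. \<Sum>l\<in>U. if h l = h i then (x l)\<^sup>2 else 0) =
      (\<Sum>l\<in>U. (x l)\<^sup>2) / real B"
    by (intro hash_collision_sum B i) (auto simp: U_def)
  also have "(\<Sum>l\<in>T - {i}. 1) / real B + 16 / \<theta>\<^sup>2 * ((\<Sum>l\<in>U. (x l)\<^sup>2) / real B) \<le>
     real k / real B + 16 / \<theta>\<^sup>2 * (K * \<theta>\<^sup>2 / real B)"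
  proof (intro add_mono mult_left_mono divide_right_mono)
    have "card (T - {i}) \<le> card T" using fT by (intro card_mono) auto
    then show "(\<Sum>l\<in>T - {i}. 1) \<le> real k" using T by simp
    have "(\<Sum>l\<in>U. (x l)\<^sup>2) \<le> (\<Sum>l\<in>{..<n} - T. (x l)\<^sup>2)" by (intro sum_mono2) (auto simp: U_def)
    then show "(\<Sum>l\<in>U. (x l)\<^sup>2) \<le> K * \<theta>\<^sup>2" using tail by linarith
  qed auto
  also have "\<dots> = (real k + 16 * K) / real B" using \<theta> by (simp add: add_divide_distrib)
  also have "\<dots> \<le> 1 / 16" using BK B by (simp add: field_simps)
  finally show ?thesis .
qed

lemma prob_UN_le:
  assumes "finite I" "\<And>i. i \<in> I \<Longrightarrow> measure_pmf.prob p {w. P i w} \<le> \<epsilon>"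
  shows "measure_pmf.prob p {w. \<exists>i\<in>I. P i w} \<le> real (card I) * \<epsilon>"
proof -
  have "{w. \<exists>i\<in>I. P i w} = (\<Union>i\<in>I. {w. P i w})" by auto
  then have "measure_pmf.prob p {w. \<exists>i\<in>I. P i w} \<le> (\<Sum>i\<in>I. measure_pmf.prob p {w. P i w})"
    using measure_pmf.finite_measure_subadditive_finite[OF assms(1), of "\<lambda>i. {w. P i w}" p] by auto
  also have "\<dots> \<le> (\<Sum>i\<in>I. \<epsilon>)" using assms(2) by (intro sum_mono)
  finally show ?thesis by simp
qed

section \<open>Second half: concentration of the total noise\<close>

text \<open>Disjoint sets of cells become a grouping map. Cells in none of the sets get coefficient
  0 and may be sent to any group.\<close>

lemma signs_square_mgf_disjoint:
  fixes b :: "'b \<Rightarrow> 'a \<Rightarrow> real"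
  assumes P: "finite P" and I: "finite I" and t: "0 \<le> t"
    and A: "\<And>i. i \<in> I \<Longrightarrow> A i \<subseteq> P" and dis: "disjoint_family_on A I"
    and V: "\<And>i. i \<in> I \<Longrightarrow> 8 * t * (\<Sum>l\<in>A i. (b i l)\<^sup>2) \<le> 1"
  shows "measure_pmf.expectation (Pi_pmf P d (\<lambda>_. sign_pmf))
      (\<lambda>s. exp (t * (\<Sum>i\<in>I. (\<Sum>l\<in>A i. b i l * s l)\<^sup>2))) \<le>
    exp (2 * t * (\<Sum>i\<in>I. \<Sum>l\<in>A i. (b i l)\<^sup>2))"
proof (cases "I = {}")
  case False
  then obtain i0 where i0: "i0 \<in> I" by blast
  define g where "g l = (if \<exists>i\<in>I. l \<in> A i then (SOME i. i \<in> I \<and> l \<in> A i) else i0)" for l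
  define a where "a l = (if \<exists>i\<in>I. l \<in> A i then b (g l) l else 0)" for l
  have g1: "g l \<in> I \<and> l \<in> A (g l)" if "\<exists>i\<in>I. l \<in> A i" for l
    using that someI_ex[of "\<lambda>i. i \<in> I \<and> l \<in> A i"] by (auto simp: g_def)
  have gI: "g l \<in> I" for l using g1[of l] i0 by (cases "\<exists>i\<in>I. l \<in> A i") (auto simp: g_def)
  have g2: "g l = i" if "i \<in> I" "l \<in> A i" for i l
    using g1[of l] that dis by (auto simp: disjoint_family_on_def)
  have sm: "(\<Sum>l | l \<in> P \<and> g l = i. F l (a l)) = (\<Sum>l\<in>A i. F l (b i l))"
    if i: "i \<in> I" and F: "\<And>l. F l 0 = 0" for i and F :: "'a \<Rightarrow> real \<Rightarrow> real"
  proof (rule sum.mono_neutral_cong_right)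
    show "finite {l. l \<in> P \<and> g l = i}" using P by simp
    show "A i \<subseteq> {l. l \<in> P \<and> g l = i}" using A[OF i] g2[OF i] by auto
    show "\<forall>l\<in>{l. l \<in> P \<and> g l = i} - A i. F l (a l) = 0" using g1 F by (auto simp: a_def)
    fix l assume "l \<in> A i"
    then show "F l (a l) = F l (b i l)" using i g2[OF i] by (auto simp: a_def)
  qed
  have s1: "(\<Sum>l | l \<in> P \<and> g l = i. a l * s l) = (\<Sum>l\<in>A i. b i l * s l)" if "i \<in> I" for i s
    by (rule sm[OF that, of "\<lambda>l v. v * s l"]) simp
  have s2: "(\<Sum>l | l \<in> P \<and> g l = i. (a l)\<^sup>2) = (\<Sum>l\<in>A i. (b i l)\<^sup>2)" if "i \<in> I" for i
    by (rule sm[OF that, of "\<lambda>l v. v\<^sup>2"]) simp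
  have "measure_pmf.expectation (Pi_pmf P d (\<lambda>_. sign_pmf))
      (\<lambda>s. exp (t * (\<Sum>i\<in>I. (\<Sum>l\<in>A i. b i l * s l)\<^sup>2))) =
    measure_pmf.expectation (Pi_pmf P d (\<lambda>_. sign_pmf))
      (\<lambda>s. exp (t * (\<Sum>i\<in>I. (0 + (\<Sum>l | l \<in> P \<and> g l = i. a l * s l))\<^sup>2)))"
    by (simp add: s1 cong: sum.cong)
  also have "\<dots> \<le> exp (\<Sum>i\<in>I. (t + 8 * t\<^sup>2 * (\<Sum>l | l \<in> P \<and> g l = i. (a l)\<^sup>2)) * 0\<^sup>2 +
       2 * t * (\<Sum>l | l \<in> P \<and> g l = i. (a l)\<^sup>2))"
    by (rule signs_square_mgf[OF P I t]) (use gI V s2 in auto)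
  also have "\<dots> = exp (2 * t * (\<Sum>i\<in>I. \<Sum>l\<in>A i. (b i l)\<^sup>2))"
    by (simp add: s2 sum_distrib_left cong: sum.cong)
  finally show ?thesis .
qed simp

definition free_rows :: "nat set \<Rightarrow> nat \<Rightarrow> (nat \<Rightarrow> nat \<Rightarrow> nat) \<Rightarrow> nat \<Rightarrow> nat set" where
  "free_rows S L h i = {j. j < L \<and> (\<forall>l\<in>S. h j l = h j i \<longrightarrow> l = i)}"

definition noise_cells :: "nat \<Rightarrow> nat set \<Rightarrow> nat \<Rightarrow> (nat \<Rightarrow> nat \<Rightarrow> nat) \<Rightarrow> nat \<Rightarrow> (nat \<times> nat) set" where
  "noise_cells n S L h i = (SIGMA j:free_rows S L h i. {l \<in> {..<n} - S. h j l = h j i})"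

text \<open>The error of the estimate of \<open>i\<close> before division by the number of free
  blocks: multiplying a measurement by the column's own sign leaves the entry itself plus these
  products of two signs.\<close>

definition noise :: "nat \<Rightarrow> nat set \<Rightarrow> nat \<Rightarrow> (nat \<Rightarrow> nat \<Rightarrow> nat) \<Rightarrow> (nat \<times> nat \<Rightarrow> real) \<Rightarrow> (nat \<Rightarrow> real) \<Rightarrow> nat \<Rightarrow> real" where
  "noise n S L h s x i = (\<Sum>z\<in>noise_cells n S L h i. s (fst z, i) * x (snd z) * s z)"

text \<open>The load is summed over all blocks, free or not. That makes it a sum of independent
  identically distributed terms, and it still dominates the energy of the noise cells.\<close>

definition hashes_ok :: "nat \<Rightarrow> nat set \<Rightarrow> nat \<Rightarrow> (nat \<Rightarrow> real) \<Rightarrow> real \<Rightarrow> (nat \<Rightarrow> nat \<Rightarrow> nat) \<Rightarrow> bool" where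
  "hashes_ok n S L x V h \<longleftrightarrow> (\<forall>i\<in>S. L < 2 * card (free_rows S L h i) \<and>
     (\<Sum>j<L. \<Sum>l\<in>{..<n} - S. if h j l = h j i then (x l)\<^sup>2 else 0) \<le> V)"

lemma finite_free_rows: "finite (free_rows S L h i)"
  by (simp add: free_rows_def)

text \<open>A union bound over \<open>S\<close> of the majority bound, where a block is bad for
  \<open>i\<close> with probability at most card S / B \<le> 1/16, and of the load bound. Each
  contributes at most n 2^(-L).\<close>

lemma hashes_ok_prob:
  fixes x :: "nat \<Rightarrow> real"
  assumes B: "0 < B" and S: "S \<subseteq> {..<n}" "16 * card S \<le> B" and k: "2 \<le> k" "16 * k \<le> B"
    and E: "0 < E" "(\<Sum>l\<in>{..<n} - S. (x l)\<^sup>2) \<le> E"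
  shows "measure_pmf.prob (Pi_pmf {..<L} d (\<lambda>_. hash_pmf n B))
     {h. \<not> hashes_ok n S L x (real L * E / ln (real k)) h} \<le> 2 * real n * (1/2) ^ L"
proof -
  let ?q = "hash_pmf n B" and ?P = "Pi_pmf {..<L} d (\<lambda>_. hash_pmf n B)"
  have fq: "finite (set_pmf ?q)" by (rule set_hash_pmf(1)[OF B])
  have fS: "finite S" using S finite_subset by blast
  define P1 where "P1 i h \<longleftrightarrow> (\<exists>l\<in>S - {i}. h l = h i)" for i :: nat and h :: "nat \<Rightarrow> nat"
  define W where "W i h = (\<Sum>l\<in>{..<n} - S. if h l = h i then (x l)\<^sup>2 else 0)" for i and h :: "nat \<Rightarrow> nat"
  have 1: "measure_pmf.prob ?P {w. L \<le> 2 * card {j. j < L \<and> P1 i (w j)}} \<le> (1/2) ^ L" if i: "i \<in> S" for i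
  proof (rule iid_majority_bound[OF fq])
    have "measure_pmf.prob ?q {w. P1 i w} \<le> measure_pmf.expectation ?q (\<lambda>h. \<Sum>l\<in>S - {i}. if h l = h i then 1 else 0)"
    proof (rule prob_le_expectation[OF fq])
      show "0 \<le> (\<Sum>l\<in>S - {i}. if w l = w i then 1 else (0::real))" for w :: "nat \<Rightarrow> nat" by (simp add: sum_nonneg)
      fix w assume "P1 i w"
      then obtain l where l: "l \<in> S - {i}" "w l = w i" by (auto simp: P1_def)
      have "(if w l = w i then 1 else (0::real)) \<le> (\<Sum>l\<in>S - {i}. if w l = w i then 1 else 0)"
        using l fS by (intro member_le_sum) auto
      then show "1 \<le> (\<Sum>l\<in>S - {i}. if w l = w i then 1 else (0::real))" using l by simp
    qed
    also have "\<dots> = (\<Sum>l\<in>S - {i}. 1) / real B" using S i by (intro hash_collision_sum B) auto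
    also have "\<dots> \<le> real (card S) / real B"
      using card_mono[OF fS, of "S - {i}"] by (intro divide_right_mono) auto
    also have "\<dots> \<le> 1 / 16" using S(2) B by (simp add: field_simps)
    finally show "measure_pmf.prob ?q {w. P1 i w} \<le> 1 / 16" .
  qed
  have 2: "measure_pmf.prob ?P {w. real L * E / ln (real k) \<le> (\<Sum>j<L. W i (w j))} \<le> (1/2) ^ L" if i: "i \<in> S" for i
  proof (rule iid_load_bound[OF fq E(1), of _ "real B"])
    fix w
    have "W i w \<le> (\<Sum>l\<in>{..<n} - S. (x l)\<^sup>2)" unfolding W_def by (intro sum_mono) auto
    then show "0 \<le> W i w \<and> W i w \<le> E" using E(2) by (auto simp: W_def intro!: sum_nonneg)
    have "measure_pmf.expectation ?q (W i) = (\<Sum>l\<in>{..<n} - S. (x l)\<^sup>2) / real B"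
      unfolding W_def using i S by (intro hash_collision_sum B) auto
    also have "\<dots> \<le> E / real B" using E(2) by (intro divide_right_mono) auto
    finally show "measure_pmf.expectation ?q (W i) \<le> E / real B" .
  qed (use k in auto)
  have sub: "{h. \<not> hashes_ok n S L x (real L * E / ln (real k)) h} \<subseteq>
    {w. \<exists>i\<in>S. L \<le> 2 * card {j. j < L \<and> P1 i (w j)}} \<union> {w. \<exists>i\<in>S. real L * E / ln (real k) \<le> (\<Sum>j<L. W i (w j))}"
  proof
    fix h assume "h \<in> {h. \<not> hashes_ok n S L x (real L * E / ln (real k)) h}"
    then obtain i where i: "i \<in> S" "2 * card (free_rows S L h i) \<le> L \<or> real L * E / ln (real k) \<le> (\<Sum>j<L. W i (h j))"
      by (auto simp: hashes_ok_def W_def not_less not_le)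
    have "L \<le> 2 * card {j. j < L \<and> P1 i (h j)}" if "2 * card (free_rows S L h i) \<le> L"
    proof -
      have "{j. j < L \<and> P1 i (h j)} = {..<L} - free_rows S L h i" by (auto simp: free_rows_def P1_def)
      moreover have "free_rows S L h i \<subseteq> {..<L}" by (auto simp: free_rows_def)
      ultimately have "card {j. j < L \<and> P1 i (h j)} = L - card (free_rows S L h i)"
        using card_Diff_subset[OF finite_free_rows] by simp
      then show ?thesis using that by simp
    qed
    then show "h \<in> {w. \<exists>i\<in>S. L \<le> 2 * card {j. j < L \<and> P1 i (w j)}} \<union>
       {w. \<exists>i\<in>S. real L * E / ln (real k) \<le> (\<Sum>j<L. W i (w j))}" using i by blast
  qed
  have "measure_pmf.prob ?P {h. \<not> hashes_ok n S L x (real L * E / ln (real k)) h} \<le>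
     measure_pmf.prob ?P {w. \<exists>i\<in>S. L \<le> 2 * card {j. j < L \<and> P1 i (w j)}} +
     measure_pmf.prob ?P {w. \<exists>i\<in>S. real L * E / ln (real k) \<le> (\<Sum>j<L. W i (w j))}"
    by (rule order_trans[OF measure_pmf.finite_measure_mono[OF sub] measure_Un_le]) simp_all
  also have "\<dots> \<le> real (card S) * (1/2) ^ L + real (card S) * (1/2) ^ L"
    by (intro add_mono prob_UN_le fS 1 2)
  also have "\<dots> \<le> real n * (1/2) ^ L + real n * (1/2) ^ L"
    using card_mono[of "{..<n}" S] S(1) by (intro add_mono mult_right_mono) auto
  finally show ?thesis by simp
qed

text \<open>The signs of columns in \<open>S\<close> are frozen first. Given them, the noises are
  linear forms with coefficients of magnitude \<open>\<bar>x $ l\<bar>\<close> in disjoint families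
  of independent signs. The rate t = ln k / (8 L E) is the largest that the load bound admits. The
  total energy is at most L E, which costs a factor k^(1/4), while the threshold gains
  k^(c+3).\<close>

lemma noise_prob:
  fixes x :: "nat \<Rightarrow> real"
  assumes S: "S \<subseteq> {..<n}" and k: "2 \<le> k" and L: "1 \<le> L" and c: "0 < c"
    and E: "0 < E" "(\<Sum>l\<in>{..<n} - S. (x l)\<^sup>2) \<le> E"
    and ok: "hashes_ok n S L x (real L * E / ln (real k)) h"
  shows "measure_pmf.prob (Pi_pmf ({..<L} \<times> {..<n}) 1 (\<lambda>_. sign_pmf))
     {s. 8 * (c + 3) * real L * E \<le> (\<Sum>i\<in>S. (noise n S L h s x i)\<^sup>2)} \<le> real k powr (- (c + 2))"
proof -
  have fS: "finite S" using S finite_subset by blast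
  define P where "P = {..<L} \<times> ({..<n} - S)"
  define R where "R = {..<L} \<times> S"
  let ?p = "Pi_pmf R 1 (\<lambda>_. sign_pmf)" and ?q = "Pi_pmf P 1 (\<lambda>_. sign_pmf)"
  have fin: "finite P" "finite R" using fS by (auto simp: P_def R_def)
  have RP: "R \<union> P = {..<L} \<times> {..<n}" "R \<inter> P = {}" using S by (auto simp: P_def R_def)
  have un: "Pi_pmf ({..<L} \<times> {..<n}) 1 (\<lambda>_. sign_pmf) =
      map_pmf (\<lambda>(f, g) z. if z \<in> R then f z else g z) (pair_pmf ?p ?q)"
    using Pi_pmf_union[OF fin(2,1) RP(2), of 1 "\<lambda>_. sign_pmf"] RP(1) by simp
  let ?A = "noise_cells n S L h"
  have AP: "?A i \<subseteq> P" for i by (auto simp: noise_cells_def free_rows_def P_def)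
  \<comment> \<open>If a cell of a block collided with two columns of \<open>S\<close>, these would
    collide with each other, and the block would not be free for them.\<close>
  have dis: "disjoint_family_on ?A S"
    by (auto simp: disjoint_family_on_def noise_cells_def free_rows_def)
  define b where "b f i z = f (fst z, i) * x (snd z)" for f :: "nat \<times> nat \<Rightarrow> real" and i z
  define t where "t = ln (real k) / (8 * real L * E)"
  have lnk: "0 < ln (real k)" using k by simp
  have t: "0 < t" using lnk L E by (simp add: t_def)
  have bsq: "(b f i z)\<^sup>2 = (x (snd z))\<^sup>2" if "f \<in> set_pmf ?p" "i \<in> S" "z \<in> ?A i" for f i z
  proof -
    have "(fst z, i) \<in> R" using that by (auto simp: R_def noise_cells_def free_rows_def)
    then have "f (fst z, i) \<in> {-1, 1}" using that(1) by (auto simp: set_Pi_pmf[OF fin(2)] PiE_dflt_def sign_pmf)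
    then show ?thesis by (auto simp: b_def power_mult_distrib)
  qed
  have Vi: "(\<Sum>z\<in>?A i. (x (snd z))\<^sup>2) \<le> real L * E / ln (real k)" if i: "i \<in> S" for i
  proof -
    have "(\<Sum>z\<in>?A i. (x (snd z))\<^sup>2) = (\<Sum>j\<in>free_rows S L h i. \<Sum>l\<in>{l \<in> {..<n} - S. h j l = h j i}. (x l)\<^sup>2)"
      unfolding noise_cells_def by (subst sum.Sigma) (auto simp: finite_free_rows case_prod_beta)
    also have "\<dots> = (\<Sum>j\<in>free_rows S L h i. \<Sum>l\<in>{..<n} - S. if h j l = h j i then (x l)\<^sup>2 else 0)"
      by (intro sum.cong refl sum.inter_filter) auto
    also have "\<dots> \<le> (\<Sum>j<L. \<Sum>l\<in>{..<n} - S. if h j l = h j i then (x l)\<^sup>2 else 0)"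
      by (intro sum_mono2) (auto simp: free_rows_def intro!: sum_nonneg)
    finally show ?thesis using ok i by (fastforce simp: hashes_ok_def)
  qed
  \<comment> \<open>By disjointness every pair of a block and an outside column is counted at most
    once, so the sum does not grow with the size of \<open>S\<close>.\<close>
  have Vs: "(\<Sum>i\<in>S. \<Sum>z\<in>?A i. (x (snd z))\<^sup>2) \<le> real L * E"
  proof -
    have fA: "finite (?A i)" for i using AP fin finite_subset by blast
    have "(\<Sum>i\<in>S. \<Sum>z\<in>?A i. (x (snd z))\<^sup>2) = (\<Sum>z\<in>(\<Union>i\<in>S. ?A i). (x (snd z))\<^sup>2)"
      by (rule sum.UNION_disjoint[symmetric]) (use fS fA dis in \<open>auto simp: disjoint_family_on_def\<close>)
    also have "\<dots> \<le> (\<Sum>z\<in>P. (x (snd z))\<^sup>2)" using AP fin by (intro sum_mono2) auto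
    also have "\<dots> = (\<Sum>j<L. \<Sum>l\<in>{..<n} - S. (x l)\<^sup>2)"
      unfolding P_def by (subst sum.cartesian_product) (simp add: case_prod_beta)
    also have "\<dots> \<le> real L * E" using E(2) by (simp add: mult_left_mono)
    finally show ?thesis .
  qed
  have cond: "measure_pmf.prob ?q {g. 8 * (c + 3) * real L * E \<le> (\<Sum>i\<in>S. (\<Sum>z\<in>?A i. b f i z * g z)\<^sup>2)} \<le>
      real k powr (- (c + 2))" if f: "f \<in> set_pmf ?p" for f
  proof -
    have "measure_pmf.prob ?q {g. 8 * (c + 3) * real L * E \<le> (\<Sum>i\<in>S. (\<Sum>z\<in>?A i. b f i z * g z)\<^sup>2)} \<le>
      measure_pmf.expectation ?q (\<lambda>g. exp (- (t * (8 * (c + 3) * real L * E))) *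
         exp (t * (\<Sum>i\<in>S. (\<Sum>z\<in>?A i. b f i z * g z)\<^sup>2)))"
    proof (rule prob_le_expectation[OF finite_signs[OF fin(1)]])
      fix g assume "8 * (c + 3) * real L * E \<le> (\<Sum>i\<in>S. (\<Sum>z\<in>?A i. b f i z * g z)\<^sup>2)"
      then have "t * (8 * (c + 3) * real L * E) \<le> t * (\<Sum>i\<in>S. (\<Sum>z\<in>?A i. b f i z * g z)\<^sup>2)"
        using t by (intro mult_left_mono) auto
      then show "1 \<le> exp (- (t * (8 * (c + 3) * real L * E))) * exp (t * (\<Sum>i\<in>S. (\<Sum>z\<in>?A i. b f i z * g z)\<^sup>2))"
        by (simp add: mult_exp_exp)
    qed simp
    also have "\<dots> = exp (- (t * (8 * (c + 3) * real L * E))) *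
       measure_pmf.expectation ?q (\<lambda>g. exp (t * (\<Sum>i\<in>S. (\<Sum>z\<in>?A i. b f i z * g z)\<^sup>2)))" by simp
    also have "\<dots> \<le> exp (- (t * (8 * (c + 3) * real L * E))) * exp (2 * t * (\<Sum>i\<in>S. \<Sum>z\<in>?A i. (b f i z)\<^sup>2))"
    proof (intro mult_left_mono signs_square_mgf_disjoint fin fS dis)
      fix i assume i: "i \<in> S"
      have "8 * t * (\<Sum>z\<in>?A i. (b f i z)\<^sup>2) = 8 * t * (\<Sum>z\<in>?A i. (x (snd z))\<^sup>2)"
        using bsq[OF f i] by (simp cong: sum.cong)
      also have "\<dots> \<le> 8 * t * (real L * E / ln (real k))" using Vi[OF i] t by (intro mult_left_mono) auto
      also have "\<dots> = 1" using lnk L E by (simp add: t_def)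
      finally show "8 * t * (\<Sum>z\<in>?A i. (b f i z)\<^sup>2) \<le> 1" .
    qed (use t AP in auto)
    also have "(\<Sum>i\<in>S. \<Sum>z\<in>?A i. (b f i z)\<^sup>2) = (\<Sum>i\<in>S. \<Sum>z\<in>?A i. (x (snd z))\<^sup>2)"
      using bsq[OF f] by (simp cong: sum.cong)
    also have "exp (- (t * (8 * (c + 3) * real L * E))) * exp (2 * t * \<dots>) \<le>
       exp (- (t * (8 * (c + 3) * real L * E))) * exp (2 * t * (real L * E))"
      using Vs t by (intro mult_left_mono) auto
    also have "\<dots> = exp (- ((c + 3) * ln (real k)) + ln (real k) / 4)"
      using L E by (simp add: mult_exp_exp t_def field_simps)
    also have "\<dots> \<le> exp (- (c + 2) * ln (real k))" using lnk by (simp add: algebra_simps)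
    also have "\<dots> = real k powr (- (c + 2))" using k by (simp add: powr_def)
    finally show ?thesis .
  qed
  have eq: "noise n S L h (\<lambda>z. if z \<in> R then f z else g z) x i = (\<Sum>z\<in>?A i. b f i z * g z)" if "i \<in> S" for f g i
    unfolding noise_def b_def using that
    by (intro sum.cong refl) (auto simp: noise_cells_def free_rows_def R_def)
  have "measure_pmf.prob (Pi_pmf ({..<L} \<times> {..<n}) 1 (\<lambda>_. sign_pmf))
     {s. 8 * (c + 3) * real L * E \<le> (\<Sum>i\<in>S. (noise n S L h s x i)\<^sup>2)} =
     measure_pmf.prob (pair_pmf ?p ?q) {z. \<not> True \<or>
       8 * (c + 3) * real L * E \<le> (\<Sum>i\<in>S. (\<Sum>y\<in>?A i. b (fst z) i y * snd z y)\<^sup>2)}"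
    unfolding un measure_map_pmf vimage_def by (simp add: case_prod_beta eq cong: sum.cong)
  also have "\<dots> \<le> measure_pmf.prob ?p {a. \<not> True} + real k powr (- (c + 2))"
    by (rule prob_pair_le[OF finite_signs[OF fin(2)] finite_signs[OF fin(1)]]) (use cond in auto)
  finally show ?thesis by simp
qed


section \<open>Recovery from a hashing matrix\<close>

lemma (in hashing) measure_A_split:
  assumes x: "x \<in> carrier_vec n" and j: "j < D" and i: "i < n"
  shows "(A *\<^sub>v x) $ (j * B + H j i) =
    sg j i * x $ i + (\<Sum>l\<in>{..<n} - {i}. if H j l = H j i then sg j l * x $ l else 0)"
  unfolding measure_A[OF x j H[OF j i]] using i by (subst sum.remove[of _ i]) auto

text \<open>The deterministic part: \<open>C1\<close> is the good event of the first half and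
  \<open>C2\<close> that of the second. Everything random is in these two hypotheses.\<close>

lemma decode_error:
  fixes C k :: nat
  assumes hs: "hashing n (2 * L) B H sg" and L: "1 \<le> L" and B: "1 \<le> B" and n: "1 \<le> n"
    and x: "x \<in> carrier_vec n" and top: "top_set k x T \<theta>"
    and tail: "(\<Sum>l\<in>{..<n} - T. (x $ l)\<^sup>2) \<le> K * \<theta>\<^sup>2" and CK: "real k + 16 * K \<le> real (C * k)"
    and C1: "\<And>i. i < n \<Longrightarrow> 2 * card {j. j < L \<and> crowded n (\<lambda>l. x $ l) \<theta> i (H j) (sg j)} < L"
  defines "A \<equiv> hash_matrix n (2 * L) B H sg"
  defines "S \<equiv> picked (C * k) n L B H (\<lambda>r. (A *\<^sub>v x) $ r)"
  assumes C2: "sqrt (\<Sum>i\<in>S. (alone_mean S L B H sg (\<lambda>r. (A *\<^sub>v x) $ r) i - x $ i)\<^sup>2) \<le>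
      \<delta> * sqrt (\<Sum>l\<in>{..<n} - S. (x $ l)\<^sup>2)" and \<delta>: "0 \<le> \<delta>"
  shows "k_sparse k (decode (main_prog C) k A (A *\<^sub>v x))"
    "l2_norm (decode (main_prog C) k A (A *\<^sub>v x) - x) \<le> (1 + 2 * \<delta>) * Err2 k x"
proof -
  interpret hashing n "2 * L" B H sg by fact
  define y where "y = A *\<^sub>v x"
  have y: "y \<in> carrier_vec (2 * L * B)" by (simp add: y_def A_def carrier_vecI)
  have dx: "dim_vec x = n" using x by simp
  have Tn: "T \<subseteq> {..<n}" and cT: "card T \<le> k" and \<theta>: "0 < \<theta>" and big: "\<And>i. i \<in> T \<Longrightarrow> \<theta> \<le> \<bar>x $ i\<bar>"
    using top by (auto simp: top_set_def dx)
  have fT: "finite T" using Tn finite_subset by blast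
  note dec = decode_hash_matrix[OF hs L B n y, where C = C and k = k, folded A_def]
  let ?cr = "\<lambda>i j. crowded n (\<lambda>l. x $ l) \<theta> i (H j) (sg j)"
  have near: "\<bar>\<bar>y $ (j * B + H j i)\<bar> - \<bar>x $ i\<bar>\<bar> \<le> \<theta> / 4" if "j < L" "i < n" "\<not> ?cr i j" for i j
  proof -
    have "\<bar>sg j i\<bar> = 1" using sg[of j i] that by auto
    then have "\<bar>sg j i * x $ i\<bar> = \<bar>x $ i\<bar>" by (simp add: abs_mult)
    moreover have "y $ (j * B + H j i) =
      sg j i * x $ i + (\<Sum>l\<in>{..<n} - {i}. if H j l = H j i then sg j l * x $ l else 0)"
      using measure_A_split[OF x, of j i] that(1,2) unfolding y_def A_def by simp
    ultimately show ?thesis using that(3) unfolding crowded_def by linarith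
  qed
  \<comment> \<open>The level \<theta>/2 separates two cases under an error of \<theta>/4: entries
    of \<open>T\<close> appear with magnitude at least 3 \<theta>/4, and whatever appears above
    \<theta>/2 in a good block has magnitude above \<theta>/4. By the tail energy at most 16 K
    entries outside \<open>T\<close> are that large, so the heavy set fits into the cut.\<close>
  define Z where "Z = {i. i < n \<and> L \<le> 2 * card {j. j < L \<and> (\<theta> / 2)\<^sup>2 < (y $ (j * B + H j i))\<^sup>2}}"
  have sq: "(\<theta> / 2)\<^sup>2 < v\<^sup>2 \<longleftrightarrow> \<theta> / 2 < \<bar>v\<bar>" for v :: real
    using \<theta> abs_less_iff[of "\<theta> / 2"] by (metis abs_le_square_iff abs_of_pos half_gt_zero linorder_not_less)
  have TZ: "T \<subseteq> Z"
  proof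
    fix i assume i: "i \<in> T"
    then have iN: "i < n" using Tn by auto
    have "{..<L} - {j. j < L \<and> ?cr i j} \<subseteq> {j. j < L \<and> (\<theta> / 2)\<^sup>2 < (y $ (j * B + H j i))\<^sup>2}"
    proof
      fix j assume "j \<in> {..<L} - {j. j < L \<and> ?cr i j}"
      then have j: "j < L" "\<not> ?cr i j" by auto
      show "j \<in> {j. j < L \<and> (\<theta> / 2)\<^sup>2 < (y $ (j * B + H j i))\<^sup>2}"
        using near[OF j(1) iN j(2)] big[OF i] \<theta> j(1) unfolding mem_Collect_eq sq by linarith
    qed
    then have "card ({..<L} - {j. j < L \<and> ?cr i j}) \<le> card {j. j < L \<and> (\<theta> / 2)\<^sup>2 < (y $ (j * B + H j i))\<^sup>2}"
      by (intro card_mono) auto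
    moreover have "card ({..<L} - {j. j < L \<and> ?cr i j}) = L - card {j. j < L \<and> ?cr i j}"
      by (subst card_Diff_subset) auto
    ultimately show "i \<in> Z" using C1[OF iN] iN by (simp add: Z_def)
  qed
  define U where "U = {i \<in> {..<n} - T. \<theta> / 4 < \<bar>x $ i\<bar>}"
  have ZU: "Z \<subseteq> T \<union> U"
  proof
    fix i assume "i \<in> Z"
    then have i: "i < n" "L \<le> 2 * card {j. j < L \<and> (\<theta> / 2)\<^sup>2 < (y $ (j * B + H j i))\<^sup>2}" by (auto simp: Z_def)
    have "\<not> {j. j < L \<and> (\<theta> / 2)\<^sup>2 < (y $ (j * B + H j i))\<^sup>2} \<subseteq> {j. j < L \<and> ?cr i j}"
    proof
      assume "{j. j < L \<and> (\<theta> / 2)\<^sup>2 < (y $ (j * B + H j i))\<^sup>2} \<subseteq> {j. j < L \<and> ?cr i j}"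
      then have "card {j. j < L \<and> (\<theta> / 2)\<^sup>2 < (y $ (j * B + H j i))\<^sup>2} \<le> card {j. j < L \<and> ?cr i j}"
        by (intro card_mono) auto
      then show False using C1[OF i(1)] i(2) by linarith
    qed
    then obtain j where j: "j < L" "(\<theta> / 2)\<^sup>2 < (y $ (j * B + H j i))\<^sup>2" "\<not> ?cr i j" by blast
    have "\<theta> / 4 < \<bar>x $ i\<bar>" using near[OF j(1) i(1) j(3)] j(2) unfolding sq by linarith
    then show "i \<in> T \<union> U" using i by (auto simp: U_def)
  qed
  have cU: "real (card U) \<le> 16 * K"
  proof -
    have "real (card U) * (\<theta> / 4)\<^sup>2 = (\<Sum>i\<in>U. (\<theta> / 4)\<^sup>2)" by simp
    also have "\<dots> \<le> (\<Sum>i\<in>U. (x $ i)\<^sup>2)"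
    proof (rule sum_mono)
      fix i assume "i \<in> U"
      then have "(\<theta> / 4)\<^sup>2 \<le> \<bar>x $ i\<bar>\<^sup>2" using \<theta> by (intro power_mono) (auto simp: U_def)
      then show "(\<theta> / 4)\<^sup>2 \<le> (x $ i)\<^sup>2" by simp
    qed
    also have "\<dots> \<le> (\<Sum>l\<in>{..<n} - T. (x $ l)\<^sup>2)" by (intro sum_mono2) (auto simp: U_def)
    also note tail
    finally show ?thesis using \<theta> by (simp add: power_divide)
  qed
  have "card Z \<le> card (T \<union> U)" using ZU fT by (intro card_mono) (auto simp: U_def)
  also have "\<dots> \<le> card T + card U" by (rule card_Un_le)
  finally have "real (card Z) \<le> real (C * k)" using cT cU CK by linarith
  then have "card Z \<le> C * k" by (simp only: of_nat_le_iff)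
  then have ZS: "Z \<subseteq> S" using dec(4)[where \<tau> = "(\<theta> / 2)\<^sup>2"] unfolding Z_def S_def y_def by blast
  then have TS: "T \<subseteq> S" using TZ by blast
  have Sn: "S \<subseteq> {..<n}" using dec(2) unfolding S_def y_def .
  define xh where "xh i = (if i \<in> S then alone_mean S L B H sg (\<lambda>r. y $ r) i else 0)" for i
  obtain T' where T': "T' \<subseteq> {..<n}" "card T' = min n k"
    and x': "decode (main_prog C) k A y = vec n (\<lambda>i. if i \<in> T' then xh i else 0)"
    and best: "\<forall>i\<in>T'. \<forall>l\<in>{..<n} - T'. (xh l)\<^sup>2 \<le> (xh i)\<^sup>2"
    using dec(5) unfolding xh_def S_def y_def by blast
  have "{i. i < n \<and> vec n (\<lambda>i. if i \<in> T' then xh i else 0) $ i \<noteq> 0} \<subseteq> T'" by (auto split: if_splits)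
  then have "card {i. i < n \<and> vec n (\<lambda>i. if i \<in> T' then xh i else 0) $ i \<noteq> 0} \<le> card T'"
    using finite_subset[OF T'(1)] by (intro card_mono) auto
  then show "k_sparse k (decode (main_prog C) k A (A *\<^sub>v x))"
    unfolding y_def[symmetric] x' k_sparse_def using T'(2) by simp
  define e where "e = sqrt (\<Sum>l\<in>{..<n} - S. (x $ l)\<^sup>2)"
  have "sqrt (\<Sum>i\<in>S. (xh i - x $ i)\<^sup>2) \<le> \<delta> * e"
    using C2 by (simp add: xh_def y_def e_def cong: sum.cong)
  then have "L2_set (\<lambda>i. (if i \<in> T' then xh i else 0) - x $ i) {..<n} \<le>
     sqrt (\<Sum>i\<in>{..<n} - T. (x $ i)\<^sup>2) + 2 * (\<delta> * e)"
    by (intro top_estimates_error[OF T' best Sn _ TS cT]) (simp add: xh_def)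
  also have "L2_set (\<lambda>i. (if i \<in> T' then xh i else 0) - x $ i) {..<n} =
     l2_norm (decode (main_prog C) k A (A *\<^sub>v x) - x)"
    unfolding y_def[symmetric] x' l2_norm_eq using x by (auto intro!: L2_set_cong)
  also have "sqrt (\<Sum>i\<in>{..<n} - T. (x $ i)\<^sup>2) + 2 * (\<delta> * e) \<le> (1 + 2 * \<delta>) * Err2 k x"
  proof -
    \<comment> \<open>\<open>S\<close> contains \<open>T\<close>, so the energy that disturbs the
      estimates is at most the energy outside \<open>T\<close>, hence bounded by the
      optimum.\<close>
    have "e \<le> sqrt (\<Sum>i\<in>{..<n} - T. (x $ i)\<^sup>2)"
      unfolding e_def using TS by (intro real_sqrt_le_mono sum_mono2) auto
    moreover have "sqrt (\<Sum>i\<in>{..<n} - T. (x $ i)\<^sup>2) \<le> Err2 k x" using Err2_ge_top_set[OF top] dx by simp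
    ultimately have "\<delta> * e \<le> \<delta> * Err2 k x" using \<delta> by (intro mult_left_mono) auto
    then show ?thesis using \<open>sqrt (\<Sum>i\<in>{..<n} - T. (x $ i)\<^sup>2) \<le> Err2 k x\<close> by (simp add: algebra_simps)
  qed
  finally show "l2_norm (decode (main_prog C) k A (A *\<^sub>v x) - x) \<le> (1 + 2 * \<delta>) * Err2 k x" .
qed

text \<open>In a free block the bucket of \<open>i\<close> holds no other selected column, and
  multiplying by the own sign of \<open>i\<close> cancels it; averaging leaves the entry plus the
  noise divided by the number of free blocks.\<close>

lemma alone_mean_noise:
  assumes hs: "hashing n (2 * L) B H sg" and x: "x \<in> carrier_vec n"
    and S: "S \<subseteq> {..<n}" and i: "i \<in> S"
    and h: "\<And>j. j < L \<Longrightarrow> H (L + j) = h j" and s: "\<And>j l. j < L \<Longrightarrow> sg (L + j) l = s (j, l)"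
    and ne: "free_rows S L h i \<noteq> {}"
  shows "alone_mean S L B H sg (\<lambda>r. (hash_matrix n (2 * L) B H sg *\<^sub>v x) $ r) i - x $ i =
    noise n S L h s (\<lambda>l. x $ l) i / real (card (free_rows S L h i))"
proof -
  interpret hashing n "2 * L" B H sg by fact
  let ?F = "free_rows S L h i"
  have iN: "i < n" using i S by auto
  have al: "alone S L H i = (\<lambda>j. L + j) ` ?F"
  proof (intro equalityI subsetI)
    fix j assume j: "j \<in> alone S L H i"
    then have "j = L + (j - L)" "j - L \<in> ?F" using h[of "j - L"] by (auto simp: alone_def free_rows_def)
    then show "j \<in> (\<lambda>j. L + j) ` ?F" by blast
  next
    fix j assume "j \<in> (\<lambda>j. L + j) ` ?F"
    then show "j \<in> alone S L H i" using h by (auto simp: alone_def free_rows_def)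
  qed
  have cell: "sg (L + j) i * (A *\<^sub>v x) $ ((L + j) * B + H (L + j) i) =
     x $ i + (\<Sum>l | l \<in> {..<n} - S \<and> h j l = h j i. s (j, i) * x $ l * s (j, l))" if j: "j \<in> ?F" for j
  proof -
    have jL: "j < L" using j by (simp add: free_rows_def)
    have sgj: "sg (L + j) = (\<lambda>l. s (j, l))" using s[OF jL] by auto
    have sq: "s (j, i) * s (j, i) = 1" using sg[of "L + j" i] jL iN s[OF jL, of i] by auto
    have "(\<Sum>l\<in>{..<n} - {i}. if h j l = h j i then s (j, l) * x $ l else 0) =
       (\<Sum>l | l \<in> {..<n} - S \<and> h j l = h j i. s (j, l) * x $ l)"
      by (rule sum.mono_neutral_cong_right) (use i j in \<open>auto simp: free_rows_def\<close>)
    then have "(A *\<^sub>v x) $ ((L + j) * B + H (L + j) i) =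
       s (j, i) * x $ i + (\<Sum>l | l \<in> {..<n} - S \<and> h j l = h j i. s (j, l) * x $ l)"
      using measure_A_split[OF x, of "L + j" i, unfolded sgj h[OF jL]] jL iN unfolding h[OF jL] by simp
    note eq = this
    have 1: "s (j, i) * (s (j, i) * x $ i) = x $ i" unfolding mult.assoc[symmetric] sq by simp
    have 2: "s (j, i) * (\<Sum>l | l \<in> {..<n} - S \<and> h j l = h j i. s (j, l) * x $ l) =
      (\<Sum>l | l \<in> {..<n} - S \<and> h j l = h j i. s (j, i) * x $ l * s (j, l))"
      unfolding sum_distrib_left by (intro sum.cong refl) (simp only: mult_ac)
    show ?thesis unfolding eq s[OF jL] distrib_left 1 2 ..
  qed
  have "(\<Sum>j\<in>alone S L H i. sg j i * (A *\<^sub>v x) $ (j * B + H j i)) =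
    (\<Sum>j\<in>?F. x $ i + (\<Sum>l | l \<in> {..<n} - S \<and> h j l = h j i. s (j, i) * x $ l * s (j, l)))"
    unfolding al by (subst sum.reindex) (auto simp: cell)
  also have "\<dots> = real (card ?F) * x $ i + noise n S L h s (\<lambda>l. x $ l) i"
  proof -
    have "(\<Sum>j\<in>?F. \<Sum>l | l \<in> {..<n} - S \<and> h j l = h j i. s (j, i) * x $ l * s (j, l)) =
      noise n S L h s (\<lambda>l. x $ l) i"
      unfolding noise_def noise_cells_def
      by (subst sum.Sigma) (auto simp: finite_free_rows intro!: sum.cong)
    then show ?thesis by (simp add: sum.distrib)
  qed
  finally have "alone_mean S L B H sg (\<lambda>r. (A *\<^sub>v x) $ r) i =
     (real (card ?F) * x $ i + noise n S L h s (\<lambda>l. x $ l) i) / real (card ?F)"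
    unfolding alone_mean_def by (simp add: al card_image)
  moreover have "card ?F \<noteq> 0" using ne finite_free_rows by (simp add: card_eq_0_iff)
  ultimately show ?thesis by (simp add: add_divide_distrib)
qed

text \<open>More than L/2 blocks are averaged, which gives the factor 4 / L^2. Then 4 / L^2 times 8
  M L E is 32 M E / L, and the lower bound on \<open>L\<close> makes this at most \<epsilon>^2 E /
  (4 l2). The square root is half of the tolerance because truncation doubles the error.\<close>

lemma alone_mean_error:
  assumes hs: "hashing n (2 * L) B H sg" and x: "x \<in> carrier_vec n" and S: "S \<subseteq> {..<n}" and L: "1 \<le> L"
    and h: "\<And>j. j < L \<Longrightarrow> H (L + j) = h j" and s: "\<And>j l. j < L \<Longrightarrow> sg (L + j) l = s (j, l)"
    and ok: "\<And>i. i \<in> S \<Longrightarrow> L < 2 * card (free_rows S L h i)"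
    and Q: "(\<Sum>i\<in>S. (noise n S L h s (\<lambda>l. x $ l) i)\<^sup>2) \<le> 8 * M * real L * E"
    and M: "128 * M * l2 \<le> \<epsilon>\<^sup>2 * real L" and l2: "0 < l2" and E: "0 \<le> E" and \<epsilon>: "0 < \<epsilon>"
  shows "sqrt (\<Sum>i\<in>S. (alone_mean S L B H sg (\<lambda>r. (hash_matrix n (2 * L) B H sg *\<^sub>v x) $ r) i - x $ i)\<^sup>2) \<le>
    \<epsilon> / (2 * sqrt l2) * sqrt E"
proof -
  have "(\<Sum>i\<in>S. (alone_mean S L B H sg (\<lambda>r. (hash_matrix n (2 * L) B H sg *\<^sub>v x) $ r) i - x $ i)\<^sup>2) \<le>
    (\<Sum>i\<in>S. 4 / (real L)\<^sup>2 * (noise n S L h s (\<lambda>l. x $ l) i)\<^sup>2)"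
  proof (rule sum_mono)
    fix i assume i: "i \<in> S"
    define c where "c = real (card (free_rows S L h i))"
    have c: "real L < 2 * c" using ok[OF i] by (simp add: c_def)
    then have "free_rows S L h i \<noteq> {}" using L by (auto simp: c_def)
    then have "alone_mean S L B H sg (\<lambda>r. (hash_matrix n (2 * L) B H sg *\<^sub>v x) $ r) i - x $ i =
       noise n S L h s (\<lambda>l. x $ l) i / c"
      unfolding c_def by (intro alone_mean_noise[OF hs x S i] h s)
    moreover have "(noise n S L h s (\<lambda>l. x $ l) i / c)\<^sup>2 \<le> 4 / (real L)\<^sup>2 * (noise n S L h s (\<lambda>l. x $ l) i)\<^sup>2"
    proof -
      have "(real L)\<^sup>2 \<le> (2 * c)\<^sup>2" using c by (intro power_mono) auto
      then have "1 / c\<^sup>2 \<le> 4 / (real L)\<^sup>2" using c L by (simp add: field_simps)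
      then have "1 / c\<^sup>2 * (noise n S L h s (\<lambda>l. x $ l) i)\<^sup>2 \<le> 4 / (real L)\<^sup>2 * (noise n S L h s (\<lambda>l. x $ l) i)\<^sup>2"
        by (rule mult_right_mono) simp
      then show ?thesis by (simp add: power_divide)
    qed
    ultimately show "(alone_mean S L B H sg (\<lambda>r. (hash_matrix n (2 * L) B H sg *\<^sub>v x) $ r) i - x $ i)\<^sup>2 \<le>
       4 / (real L)\<^sup>2 * (noise n S L h s (\<lambda>l. x $ l) i)\<^sup>2" by simp
  qed
  also have "\<dots> \<le> 4 / (real L)\<^sup>2 * (8 * M * real L * E)"
    unfolding sum_distrib_left[symmetric] using Q by (intro mult_left_mono) auto
  also have "\<dots> = (32 * M / real L) * E" using L by (simp add: power2_eq_square)
  also have "\<dots> \<le> (\<epsilon>\<^sup>2 / (4 * l2)) * E"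
    using M L l2 E by (intro mult_right_mono) (auto simp: field_simps)
  finally have "sqrt (\<Sum>i\<in>S. (alone_mean S L B H sg (\<lambda>r. (hash_matrix n (2 * L) B H sg *\<^sub>v x) $ r) i - x $ i)\<^sup>2) \<le>
    sqrt ((\<epsilon>\<^sup>2 / (4 * l2)) * E)" by (rule real_sqrt_le_mono)
  also have "\<dots> = \<epsilon> / (2 * sqrt l2) * sqrt E"
    using \<epsilon> by (simp add: real_sqrt_mult real_sqrt_divide)
  finally show ?thesis .
qed

text \<open>The independence statement in its usable form: altering the second half leaves the
  selected set unchanged.\<close>

lemma picked_cong:
  assumes "\<And>j i. j < L \<Longrightarrow> H j i = H' j i" "\<And>r. r < L * B \<Longrightarrow> y r = y' r"
  shows "picked M n L B H y = picked M n L B H' y'"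
proof -
  have "(\<lambda>r. if r < L * B then (y r)\<^sup>2 else 0) = (\<lambda>r. if r < L * B then (y' r)\<^sup>2 else 0)"
    using assms(2) by (auto simp: fun_eq_iff)
  moreover have "(\<lambda>x. if x < 2 * L * n \<and> x mod (2 * L) < L
        then (x mod (2 * L)) * B + H (x mod (2 * L)) (x div (2 * L)) else L * B) =
     (\<lambda>x. if x < 2 * L * n \<and> x mod (2 * L) < L
        then (x mod (2 * L)) * B + H' (x mod (2 * L)) (x div (2 * L)) else L * B)"
    using assms(1) by (auto simp: fun_eq_iff)
  ultimately show ?thesis unfolding picked_def by simp
qed


section \<open>The random matrix\<close>

text \<open>The nesting follows the order of conditioning: first half, then hashes, then signs of
  the second half. These last signs are indexed by pairs of block and column so that they can be
  split according to the selected columns.\<close>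

definition sketch_pmf ::
    "nat \<Rightarrow> nat \<Rightarrow> nat \<Rightarrow> ((nat \<Rightarrow> (nat \<Rightarrow> nat) \<times> (nat \<Rightarrow> real)) \<times> (nat \<Rightarrow> nat \<Rightarrow> nat) \<times> (nat \<times> nat \<Rightarrow> real)) pmf" where
  "sketch_pmf n L B = pair_pmf (Pi_pmf {..<L} (\<lambda>_. 0, \<lambda>_. 1) (\<lambda>_. row_pmf n B))
     (pair_pmf (Pi_pmf {..<L} (\<lambda>_. 0) (\<lambda>_. hash_pmf n B)) (Pi_pmf ({..<L} \<times> {..<n}) 1 (\<lambda>_. sign_pmf)))"

definition joint_hash :: "nat \<Rightarrow> (nat \<Rightarrow> (nat \<Rightarrow> nat) \<times> (nat \<Rightarrow> real)) \<Rightarrow> (nat \<Rightarrow> nat \<Rightarrow> nat) \<Rightarrow> nat \<Rightarrow> nat \<Rightarrow> nat" where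
  "joint_hash L w h j = (if j < L then fst (w j) else h (j - L))"

definition joint_sign :: "nat \<Rightarrow> (nat \<Rightarrow> (nat \<Rightarrow> nat) \<times> (nat \<Rightarrow> real)) \<Rightarrow> (nat \<times> nat \<Rightarrow> real) \<Rightarrow> nat \<Rightarrow> nat \<Rightarrow> real" where
  "joint_sign L w s j l = (if j < L then snd (w j) l else s (j - L, l))"

definition sketch_matrix where
  "sketch_matrix n L B z = hash_matrix n (2 * L) B
     (joint_hash L (fst z) (fst (snd z))) (joint_sign L (fst z) (snd (snd z)))"

lemma joint_simps:
  "j < L \<Longrightarrow> joint_hash L w h j = fst (w j)" "joint_hash L w h (L + j) = h j"
  "j < L \<Longrightarrow> joint_sign L w s j l = snd (w j) l" "joint_sign L w s (L + j) l = s (j, l)"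
  by (simp_all add: joint_hash_def joint_sign_def)

lemma hashing_joint:
  assumes B: "0 < B" and L: "1 \<le> L" and w: "w \<in> set_pmf (Pi_pmf {..<L} (\<lambda>_. 0, \<lambda>_. 1) (\<lambda>_. row_pmf n B))"
    and h: "\<And>j l. j < L \<Longrightarrow> l < n \<Longrightarrow> h j l < B" and s: "\<And>j l. j < L \<Longrightarrow> l < n \<Longrightarrow> s (j, l) \<in> {-1, 1}"
  shows "hashing n (2 * L) B (joint_hash L w h) (joint_sign L w s)"
proof
  fix j i assume j: "j < 2 * L" and i: "i < n"
  have w': "w j \<in> set_pmf (row_pmf n B)" if "j < L" using w that by (auto simp: set_Pi_pmf PiE_dflt_def)
  show "joint_hash L w h j i < B"
  proof (cases "j < L")
    case True
    then have "fst (w j) \<in> set_pmf (hash_pmf n B)" using w' by (auto simp: row_pmf_def)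
    then show ?thesis using True set_hash_pmf(2)[OF B _ i] by (simp add: joint_hash_def)
  qed (use h[of "j - L" i] j i in \<open>simp add: joint_hash_def\<close>)
  show "joint_sign L w s j i \<in> {-1, 1}"
  proof (cases "j < L")
    case True
    then have "snd (w j) \<in> set_pmf (Pi_pmf {..<n} 1 (\<lambda>_. sign_pmf))" using w' by (auto simp: row_pmf_def)
    then have "snd (w j) i \<in> {-1, 1}" using i by (auto simp: set_Pi_pmf PiE_dflt_def sign_pmf)
    then show ?thesis using True by (simp add: joint_sign_def)
  qed (use s[of "j - L" i] j i in \<open>simp add: joint_sign_def\<close>)
qed (use L in simp)

lemma hashing_sketch:
  assumes B: "0 < B" and L: "1 \<le> L" and z: "z \<in> set_pmf (sketch_pmf n L B)"
  shows "hashing n (2 * L) B (joint_hash L (fst z) (fst (snd z))) (joint_sign L (fst z) (snd (snd z)))"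
proof (rule hashing_joint[OF B L])
  have z': "fst z \<in> set_pmf (Pi_pmf {..<L} (\<lambda>_. 0, \<lambda>_. 1) (\<lambda>_. row_pmf n B))"
    "fst (snd z) \<in> set_pmf (Pi_pmf {..<L} (\<lambda>_. 0) (\<lambda>_. hash_pmf n B))"
    "snd (snd z) \<in> set_pmf (Pi_pmf ({..<L} \<times> {..<n}) 1 (\<lambda>_. sign_pmf))"
    using z by (auto simp: sketch_pmf_def)
  show "fst z \<in> set_pmf (Pi_pmf {..<L} (\<lambda>_. 0, \<lambda>_. 1) (\<lambda>_. row_pmf n B))" by fact
  fix j l assume jl: "j < L" "l < n"
  then have "fst (snd z) j \<in> set_pmf (hash_pmf n B)" using z'(2) by (auto simp: set_Pi_pmf PiE_dflt_def)
  then show "fst (snd z) j l < B" using set_hash_pmf(2)[OF B _ jl(2)] by blast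
  show "snd (snd z) (j, l) \<in> {-1, 1}" using z'(3) jl by (auto simp: set_Pi_pmf PiE_dflt_def sign_pmf)
qed

text \<open>The factor 3 is one union bound for the first half and two for the hashes of the second.
  \<open>B = 16 * C * k\<close> serves all of them: it makes crowding and collisions within
  \<open>S\<close> of probability at most 1/16, and it admits the load bound.\<close>

lemma sketch_success_prob:
  fixes C k :: nat and x :: "real vec"
  assumes L: "1 \<le> L" and n: "1 \<le> n" and k: "2 \<le> k" and c: "0 < c" and \<epsilon>: "0 < \<epsilon>"
    and x: "x \<in> carrier_vec n" and top: "top_set k x T \<theta>"
    and tail: "(\<Sum>l\<in>{..<n} - T. (x $ l)\<^sup>2) \<le> K * real k * \<theta>\<^sup>2" and K: "0 \<le> K" and C: "1 + 16 * K \<le> real C"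
    and LM: "128 * (c + 3) * l2 \<le> \<epsilon>\<^sup>2 * real L" and l2: "0 < l2"
  defines "B \<equiv> 16 * C * k"
  shows "1 - (3 * real n * (1/2) ^ L + real k powr (- (c + 2))) \<le>
    measure_pmf.prob (map_pmf (sketch_matrix n L B) (sketch_pmf n L B))
     {A. k_sparse k (decode (main_prog C) k A (A *\<^sub>v x)) \<and>
       l2_norm (decode (main_prog C) k A (A *\<^sub>v x) - x) \<le> (1 + \<epsilon> / sqrt l2) * Err2 k x}"
proof -
  define xf where "xf = (\<lambda>l. x $ l)"
  have C1: "1 \<le> C" using C K by simp
  have B: "0 < B" "1 \<le> B" "16 * k \<le> B" using C1 k by (auto simp: B_def)
  have dx: "dim_vec x = n" using x by simp
  have Tn: "T \<subseteq> {..<n}" and cT: "card T \<le> k" and \<theta>: "0 < \<theta>" using top by (auto simp: top_set_def dx)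
  let ?D1 = "Pi_pmf {..<L} (\<lambda>_. 0, \<lambda>_. 1) (\<lambda>_. row_pmf n B)"
  let ?DH = "Pi_pmf {..<L} (\<lambda>_. 0) (\<lambda>_. hash_pmf n B)"
  let ?DS = "Pi_pmf ({..<L} \<times> {..<n}) 1 (\<lambda>_. sign_pmf)"
  have fin: "finite (set_pmf ?D1)" "finite (set_pmf ?DH)" "finite (set_pmf ?DS)"
    using finite_row_pmf[OF B(1)] set_hash_pmf(1)[OF B(1)]
    by (auto intro!: finite_set_Pi_pmf simp: sign_pmf)
  \<comment> \<open>The measurements are written out as sums over the blocks of the first half, so
    that the set visibly depends on \<open>w\<close> alone.\<close>
  define S where "S w = picked (C * k) n L B (\<lambda>j. fst (w j))
     (\<lambda>r. \<Sum>l<n. if fst (w (r div B)) l = r mod B then snd (w (r div B)) l * x $ l else 0)"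
    for w :: "nat \<Rightarrow> (nat \<Rightarrow> nat) \<times> (nat \<Rightarrow> real)"
  have S_eq: "picked (C * k) n L B (joint_hash L w h)
      (\<lambda>r. (hash_matrix n (2 * L) B (joint_hash L w h) (joint_sign L w s) *\<^sub>v x) $ r) = S w"
    if "hashing n (2 * L) B (joint_hash L w h) (joint_sign L w s)" for w h s
    unfolding S_def
  proof (rule picked_cong)
    fix r assume r: "r < L * B"
    interpret hashing n "2 * L" B "joint_hash L w h" "joint_sign L w s" by fact
    have j: "r div B < L" using r by (simp add: less_mult_imp_div_less)
    have e: "joint_hash L w h (r div B) = fst (w (r div B))" "joint_sign L w s (r div B) = snd (w (r div B))"
      using j by (auto simp: joint_hash_def joint_sign_def fun_eq_iff)
    have "(A *\<^sub>v x) $ (r div B * B + r mod B) =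
       (\<Sum>l<n. if joint_hash L w h (r div B) l = r mod B then joint_sign L w s (r div B) l * x $ l else 0)"
      using j B by (intro measure_A[OF x]) auto
    then show "(A *\<^sub>v x) $ r = (\<Sum>l<n. if fst (w (r div B)) l = r mod B then snd (w (r div B)) l * x $ l else 0)"
      unfolding e by simp
  qed (simp add: joint_hash_def)
  have S_bd: "S w \<subseteq> {..<n}" "card (S w) \<le> C * k" if w: "w \<in> set_pmf ?D1" for w
  proof -
    \<comment> \<open>Properties of the set come from a run on a full matrix; an arbitrary second
      half completes \<open>w\<close> to one.\<close>
    have hs: "hashing n (2 * L) B (joint_hash L w (\<lambda>_ _. 0)) (joint_sign L w (\<lambda>_. 1))"
      using hashing_joint[OF B(1) L w] B by simp
    let ?A = "hash_matrix n (2 * L) B (joint_hash L w (\<lambda>_ _. 0)) (joint_sign L w (\<lambda>_. 1))"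
    have "?A *\<^sub>v x \<in> carrier_vec (2 * L * B)" by (simp add: hash_matrix_def carrier_vecI)
    from decode_hash_matrix(2,3)[OF hs L B(2) n this, where C = C and k = k, unfolded S_eq[OF hs]]
    show "S w \<subseteq> {..<n}" "card (S w) \<le> C * k" by auto
  qed
  define G where "G w \<longleftrightarrow> \<not> (\<exists>i\<in>{..<n}. L \<le> 2 * card {j. j < L \<and> crowded n xf \<theta> i (fst (w j)) (snd (w j))})"
    for w :: "nat \<Rightarrow> (nat \<Rightarrow> nat) \<times> (nat \<Rightarrow> real)"
  define E where "E w = (\<Sum>l\<in>{..<n} - S w. (xf l)\<^sup>2)" for w
  \<comment> \<open>The load and noise bounds ask for a positive energy. If nothing lies outside the
    set, 1 is substituted there, and the noise vanishes anyway.\<close>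
  define E' where "E' w = (if E w = 0 then 1 else E w)" for w
  have E0: "0 \<le> E w" and E': "0 < E' w" "E w \<le> E' w" for w
    using sum_nonneg[of "{..<n} - S w" "\<lambda>l. (xf l)\<^sup>2"] by (auto simp: E'_def E_def)
  define Fh where "Fh w = hashes_ok n (S w) L xf (real L * E' w / ln (real k))" for w
  define Fn where "Fn w h s \<longleftrightarrow> 8 * (c + 3) * real L * E' w \<le> (\<Sum>i\<in>S w. (noise n (S w) L h s xf i)\<^sup>2)" for w h s
  define \<eta> where "\<eta> = 2 * real n * (1/2) ^ L + real k powr (- (c + 2))"
  have \<eta>: "0 \<le> \<eta>" by (simp add: \<eta>_def)
  have p1: "measure_pmf.prob ?D1 {w. \<not> G w} \<le> real n * (1/2) ^ L"
  proof -
    have "measure_pmf.prob ?D1 {w. L \<le> 2 * card {j. j < L \<and> crowded n xf \<theta> i (fst (w j)) (snd (w j))}} \<le> (1/2) ^ L"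
      if i: "i \<in> {..<n}" for i
    proof (rule iid_majority_bound[OF finite_row_pmf[OF B(1)]])
      have "16 * (real k + 16 * (K * real k)) = 16 * (1 + 16 * K) * real k" by (simp add: algebra_simps)
      also have "\<dots> \<le> 16 * real C * real k" using C by (intro mult_right_mono mult_left_mono) auto
      finally have "16 * (real k + 16 * (K * real k)) \<le> real B" by (simp add: B_def)
      then show "measure_pmf.prob (row_pmf n B) {w. crowded n xf \<theta> i (fst w) (snd w)} \<le> 1 / 16"
        using i tail by (intro crowded_prob[OF B(1) _ Tn cT \<theta>]) (auto simp: xf_def)
    qed
    from prob_UN_le[OF finite_lessThan this] show ?thesis by (simp add: G_def)
  qed
  have p2: "measure_pmf.prob (pair_pmf ?DH ?DS) {z. \<not> Fh w (fst z) \<or> Fn w (fst z) (snd z)} \<le> \<eta>"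
    if w: "w \<in> set_pmf ?D1" for w
  proof -
    have "measure_pmf.prob (pair_pmf ?DH ?DS) {z. \<not> Fh w (fst z) \<or> Fn w (fst z) (snd z)} \<le>
       measure_pmf.prob ?DH {h. \<not> Fh w h} + real k powr (- (c + 2))"
    proof (rule prob_pair_le[OF fin(2,3)])
      fix h assume "Fh w h"
      then show "measure_pmf.prob ?DS {s. Fn w h s} \<le> real k powr (- (c + 2))"
        unfolding Fn_def Fh_def using noise_prob[OF S_bd(1)[OF w] k L c E'(1) E'(2)[unfolded E_def]] by blast
    qed simp
    also have "measure_pmf.prob ?DH {h. \<not> Fh w h} \<le> 2 * real n * (1/2) ^ L"
      unfolding Fh_def using S_bd[OF w] E' k B
      by (intro hashes_ok_prob) (auto simp: E_def B_def)
    finally show ?thesis by (simp add: \<eta>_def)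
  qed
  let ?bad = "{z. \<not> G (fst z) \<or> \<not> Fh (fst z) (fst (snd z)) \<or> Fn (fst z) (fst (snd z)) (snd (snd z))}"
  have bad: "measure_pmf.prob (sketch_pmf n L B) ?bad \<le> real n * (1/2) ^ L + \<eta>"
  proof -
    have "measure_pmf.prob (sketch_pmf n L B) {z. \<not> G (fst z) \<or>
        (\<not> Fh (fst z) (fst (snd z)) \<or> Fn (fst z) (fst (snd z)) (snd (snd z)))} \<le>
      measure_pmf.prob ?D1 {w. \<not> G w} + \<eta>"
      unfolding sketch_pmf_def
      by (rule prob_pair_le[OF fin(1), where F = "\<lambda>w z. \<not> Fh w (fst z) \<or> Fn w (fst z) (snd z)"])
        (use fin p2 \<eta> in auto)
    then show ?thesis using p1 by simp
  qed
  let ?good = "{A. k_sparse k (decode (main_prog C) k A (A *\<^sub>v x)) \<and>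
       l2_norm (decode (main_prog C) k A (A *\<^sub>v x) - x) \<le> (1 + \<epsilon> / sqrt l2) * Err2 k x}"
  have succ: "sketch_matrix n L B z \<in> ?good" if z: "z \<in> set_pmf (sketch_pmf n L B)" "z \<notin> ?bad" for z
  proof -
    obtain w h s where zw: "z = (w, h, s)" by (metis prod.exhaust)
    have hs: "hashing n (2 * L) B (joint_hash L w h) (joint_sign L w s)"
      using hashing_sketch[OF B(1) L z(1)] by (simp add: zw)
    have w: "w \<in> set_pmf ?D1" using z(1) by (auto simp: zw sketch_pmf_def)
    have ok: "G w" "Fh w h" "\<not> Fn w h s" using z(2) by (auto simp: zw)
    let ?H = "joint_hash L w h" and ?s = "joint_sign L w s"
    have sm: "sketch_matrix n L B z = hash_matrix n (2 * L) B ?H ?s" by (simp add: sketch_matrix_def zw)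
    have js: "joint_sign L w s j = snd (w j)" if "j < L" for j using that by (auto simp: joint_sign_def)
    have cr: "2 * card {j. j < L \<and> crowded n (\<lambda>l. x $ l) \<theta> i (?H j) (?s j)} < L" if "i < n" for i
    proof -
      have "{j. j < L \<and> crowded n (\<lambda>l. x $ l) \<theta> i (?H j) (?s j)} =
         {j. j < L \<and> crowded n xf \<theta> i (fst (w j)) (snd (w j))}"
        by (auto simp: joint_simps js xf_def)
      then show ?thesis using ok(1) that by (auto simp: G_def not_le)
    qed
    have fr: "L < 2 * card (free_rows (S w) L h i)" if "i \<in> S w" for i
      using ok(2) that by (auto simp: Fh_def hashes_ok_def)
    have Q: "(\<Sum>i\<in>S w. (noise n (S w) L h s (\<lambda>l. x $ l) i)\<^sup>2) \<le> 8 * (c + 3) * real L * E w"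
    proof (cases "E w = 0")
      case False
      then show ?thesis using ok(3) by (simp add: Fn_def E'_def xf_def)
    next
      case True
      then have "x $ l = 0" if "l \<in> {..<n} - S w" for l
        using that unfolding E_def by (subst (asm) sum_nonneg_eq_0_iff) (auto simp: xf_def)
      then have "noise n (S w) L h s (\<lambda>l. x $ l) i = 0" for i
        unfolding noise_def noise_cells_def by (intro sum.neutral) auto
      then show ?thesis using True by simp
    qed
    have e: "sqrt (\<Sum>i\<in>S w. (alone_mean (S w) L B ?H ?s (\<lambda>r. (hash_matrix n (2 * L) B ?H ?s *\<^sub>v x) $ r) i - x $ i)\<^sup>2) \<le>
        \<epsilon> / (2 * sqrt l2) * sqrt (E w)"
      by (rule alone_mean_error[OF hs x S_bd(1)[OF w] L _ _ fr Q LM l2 E0 \<epsilon>]) (simp_all add: joint_simps)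
    have "16 * K * real k + real k \<le> real C * real k"
      using mult_right_mono[OF C, of "real k"] by (simp add: algebra_simps)
    then have CK: "real k + 16 * (K * real k) \<le> real (C * k)" by simp
    note de = decode_error[OF hs L B(2) n x top tail CK cr, unfolded S_eq[OF hs], of "\<epsilon> / (2 * sqrt l2)"]
    have "(1 + 2 * (\<epsilon> / (2 * sqrt l2))) = 1 + \<epsilon> / sqrt l2" by simp
    then show ?thesis unfolding sm using de e \<epsilon> l2 by (simp add: E_def xf_def)
  qed
  have "1 - (3 * real n * (1/2) ^ L + real k powr (- (c + 2))) \<le> 1 - measure_pmf.prob (sketch_pmf n L B) ?bad"
    using bad by (simp add: \<eta>_def)
  also have "\<dots> = measure_pmf.prob (sketch_pmf n L B) (- ?bad)"
    using measure_pmf.prob_compl[of ?bad "sketch_pmf n L B"] by (simp add: Compl_eq_Diff_UNIV)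
  also have "\<dots> \<le> measure_pmf.prob (sketch_pmf n L B) (sketch_matrix n L B -` ?good)"
    by (rule measure_pmf.finite_measure_mono_AE) (use succ in \<open>auto intro!: AE_pmfI simp del: mem_Collect_eq\<close>)
  finally show ?thesis by (simp add: measure_map_pmf)
qed


section \<open>Choice of the parameters\<close>

lemma recovers_within_mono: "recovers_within p k A y \<tau> x' \<Longrightarrow> \<tau> \<le> \<tau>' \<Longrightarrow> recovers_within p k A y \<tau>' x'"
  unfolding recovers_within_def using order_trans by blast

text \<open>Sorting the \<open>h\<close> rows is affordable because h \<le> n; the passes over the 2
  L n matrix entries account for the term with \<open>G\<close>. Since the logarithm is at least 1,
  the remaining parts are at most 44, 33, 45 and 42 times n log n, which 200 covers.\<close>

lemma running_time_bound:
  fixes n h L :: nat and G :: real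
  assumes n: "2 \<le> n" and h: "1 \<le> h" "h \<le> n" and L: "real L \<le> G * log 2 (real n)"
  shows "real (h * (5 * floor_log (2 * h) + 34) + n * (5 * floor_log (2 * n) + 23) + (n + 2 * L * n) * 45 + 42) \<le>
    (200 + 90 * G) * (real n * log 2 (real n))"
proof -
  define lg where "lg = log 2 (real n)"
  have lg: "1 \<le> lg" using n by (simp add: lg_def le_log_iff)
  have "real (floor_log (2 * n)) \<le> log 2 (real (2 * n))"
    using n by (simp add: floor_log_altdef)
  also have "\<dots> = 1 + lg" using n by (simp add: log_mult lg_def)
  finally have fl: "real (floor_log (2 * n)) \<le> 1 + lg" .
  have "real (floor_log (2 * h)) \<le> real (floor_log (2 * n))" using h by (simp add: floor_log_le_iff)
  then have flh: "real (floor_log (2 * h)) \<le> 1 + lg" using fl by linarith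
  define X where "X = real n * lg"
  define Y where "Y = real L * real n"
  define U where "U = real h * (5 * real (floor_log (2 * h)) + 34)"
  define V where "V = real n * (5 * real (floor_log (2 * n)) + 23)"
  have "U \<le> real n * (44 * lg)"
    unfolding U_def using h flh lg by (intro mult_mono) auto
  moreover have "V \<le> real n * (33 * lg)"
    unfolding V_def using fl lg by (intro mult_left_mono) auto
  moreover have "real n * 1 \<le> real n * lg" using lg by (intro mult_left_mono) auto
  moreover have "Y \<le> G * lg * real n" unfolding Y_def using L by (intro mult_right_mono) (auto simp: lg_def)
  moreover have "1 \<le> X" unfolding X_def using mult_mono[of 1 "real n" 1 lg] n lg by simp
  ultimately have "U + V + (real n + 2 * Y) * 45 + 42 \<le> 200 * X + 90 * (G * X)"
    by (simp add: X_def mult_ac)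
  then show ?thesis by (simp add: U_def V_def X_def Y_def lg_def algebra_simps)
qed

text \<open>The identity matrix is a block with \<open>n\<close> buckets in which every column has
  its own, so one block per half gives neither crowding nor noise, and the general error lemma
  applies with the same program.\<close>

lemma identity_recovers:
  fixes C k :: nat
  assumes n: "1 \<le> n" and x: "x \<in> carrier_vec n" and top: "top_set k x T \<theta>"
    and tail: "(\<Sum>l\<in>{..<n} - T. (x $ l)\<^sup>2) \<le> K * \<theta>\<^sup>2" and CK: "real k + 16 * K \<le> real (C * k)" and \<delta>: "0 \<le> \<delta>"
  defines "A \<equiv> hash_matrix n (2 * 1) n (\<lambda>_ i. i) (\<lambda>_ _. 1)"
  shows "k_sparse k (decode (main_prog C) k A (A *\<^sub>v x))"
    "l2_norm (decode (main_prog C) k A (A *\<^sub>v x) - x) \<le> (1 + 2 * \<delta>) * Err2 k x"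
proof -
  have hs: "hashing n (2 * 1) n (\<lambda>_ i. i) (\<lambda>_ _. 1)" by unfold_locales auto
  have \<theta>: "0 < \<theta>" using top by (simp add: top_set_def)
  have cr: "2 * card {j. j < 1 \<and> crowded n (\<lambda>l. x $ l) \<theta> i (\<lambda>i. i) (\<lambda>_. 1)} < (1::nat)" for i
  proof -
    have "(\<Sum>l\<in>{..<n} - {i}. if l = i then 1 * x $ l else 0) = 0" by (intro sum.neutral) auto
    then have "\<not> crowded n (\<lambda>l. x $ l) \<theta> i (\<lambda>i. i) (\<lambda>_. 1)" using \<theta> unfolding crowded_def by simp
    then show ?thesis by simp
  qed
  define S where "S = picked (C * k) n 1 n (\<lambda>_ i. i) (\<lambda>r. (A *\<^sub>v x) $ r)"
  have "A *\<^sub>v x \<in> carrier_vec (2 * 1 * n)" by (simp add: A_def hash_matrix_def carrier_vecI)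
  from decode_hash_matrix(2)[OF hs _ n n this, where C = C and k = k] have Sn: "S \<subseteq> {..<n}" by (simp add: S_def)
  have "alone_mean S 1 n (\<lambda>_ i. i) (\<lambda>_ _. 1) (\<lambda>r. (A *\<^sub>v x) $ r) i - x $ i = 0" if i: "i \<in> S" for i
  proof -
    have "0 \<in> free_rows S 1 (\<lambda>_ i. i) i" by (simp add: free_rows_def)
    then have "alone_mean S 1 n (\<lambda>_ i. i) (\<lambda>_ _. 1) (\<lambda>r. (A *\<^sub>v x) $ r) i - x $ i =
      noise n S 1 (\<lambda>_ i. i) (\<lambda>_. 1) (\<lambda>l. x $ l) i / real (card (free_rows S 1 (\<lambda>_ i. i) i))"
      unfolding A_def by (intro alone_mean_noise[OF hs x Sn i]) auto
    moreover have "noise_cells n S 1 (\<lambda>_ i. i) i = {}" using i by (auto simp: noise_cells_def)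
    ultimately show ?thesis by (simp add: noise_def)
  qed
  then have "(\<Sum>i\<in>S. (alone_mean S 1 n (\<lambda>_ i. i) (\<lambda>_ _. 1) (\<lambda>r. (A *\<^sub>v x) $ r) i - x $ i)\<^sup>2) = 0"
    by (intro sum.neutral) auto
  then have "sqrt (\<Sum>i\<in>S. (alone_mean S 1 n (\<lambda>_ i. i) (\<lambda>_ _. 1) (\<lambda>r. (A *\<^sub>v x) $ r) i - x $ i)\<^sup>2) \<le>
      \<delta> * sqrt (\<Sum>l\<in>{..<n} - S. (x $ l)\<^sup>2)"
    using \<delta> by (simp add: sum_nonneg)
  from decode_error[OF hs order_refl n n x top tail CK cr this[unfolded S_def A_def] \<delta>, folded A_def]
  show "k_sparse k (decode (main_prog C) k A (A *\<^sub>v x))"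
    "l2_norm (decode (main_prog C) k A (A *\<^sub>v x) - x) \<le> (1 + 2 * \<delta>) * Err2 k x" by auto
qed

text \<open>The choice of \<open>L\<close> gives n 2^(-L) \<le> n^(-(c+2)), which is at most
  k^(-(c+2)) because k \<le> n. The four resulting terms are absorbed by k^2 \<ge> 4.\<close>

lemma failure_bound:
  fixes c :: real
  assumes k: "2 \<le> k" "k \<le> n" and c: "0 < c" and L: "(c + 3) * log 2 (real n) \<le> real L"
  shows "3 * real n * (1/2) ^ L + real k powr (- (c + 2)) \<le> 1 / real k powr c"
proof -
  have n: "0 < real n" "0 < real k" using k by auto
  have k2: "real k powr (- (c + 2)) = real k powr (- c) / (real k)\<^sup>2"
  proof -
    have "real k powr (- (c + 2)) = real k powr (- c + - 2)" by simp
    also have "\<dots> = real k powr (- c) * real k powr (- 2)" by (rule powr_add)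
    also have "real k powr (- 2) = 1 / (real k)\<^sup>2" using n by (simp add: powr_minus_divide)
    finally show ?thesis by simp
  qed
  have "(1/2 :: real) ^ L = 2 powr (- real L)" by (simp add: powr_minus powr_realpow power_divide field_simps)
  also have "\<dots> \<le> 2 powr (- (c + 3) * log 2 (real n))" using L by (intro powr_mono) (auto simp: algebra_simps)
  also have "\<dots> = (2 powr (log 2 (real n))) powr (- (c + 3))" by (simp add: powr_powr mult.commute)
  also have "2 powr (log 2 (real n)) = real n" using n by simp
  finally have "3 * real n * (1/2) ^ L \<le> 3 * (real n powr 1 * real n powr (- (c + 3)))"
    using n by (simp add: mult_left_mono)
  also have "real n powr 1 * real n powr (- (c + 3)) = real n powr (- (c + 2))"
    unfolding powr_add[symmetric] by (simp add: algebra_simps)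
  also have "\<dots> \<le> real k powr (- (c + 2))" using k c by (intro powr_mono2') auto
  finally have "3 * real n * (1/2) ^ L + real k powr (- (c + 2)) \<le> 4 * real k powr (- (c + 2))" by simp
  also have "4 * real k powr (- (c + 2)) \<le> real k powr (- c)"
  proof -
    have "4 \<le> (real k)\<^sup>2" using power_mono[of 2 "real k" 2] k by simp
    then have "4 * real k powr (- c) \<le> (real k)\<^sup>2 * real k powr (- c)" by (intro mult_right_mono) auto
    then show ?thesis unfolding k2 using n by (simp add: field_simps)
  qed
  finally show ?thesis by (simp add: powr_minus_divide)
qed

theorem theorem4p4:
  fixes \<alpha> a b c0 \<epsilon>0 :: real
  assumes "\<alpha> > 1/2"
    and "0 < a" and "a \<le> b"
    and "0 < c0" and "0 < \<epsilon>0"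
  shows "\<exists>C>0. \<forall>c \<epsilon>. c0 \<le> c \<and> 0 < \<epsilon> \<and> \<epsilon> \<le> \<epsilon>0 \<longrightarrow>
    (\<exists>T>0. \<exists>p. \<forall>n\<ge>2. \<forall>k\<ge>1.
      \<exists>(m :: nat) (D :: real mat pmf) (R :: real mat \<Rightarrow> real vec \<Rightarrow> real vec).
        real m \<le> C * (c / \<epsilon>\<^sup>2 * real k * log 2 (real n)) \<and>
        set_pmf D \<subseteq> carrier_mat m n \<and>
        (\<forall>A\<in>set_pmf D. \<forall>y\<in>carrier_vec m.
           recovers_within p k A y (T * (real n * log 2 (real n))) (R A y)) \<and>
        (\<forall>x\<in>carrier_vec n. sub_zipfian a b k \<alpha> x \<longrightarrow>
           measure_pmf.prob D
             {A. k_sparse k (R A (A *\<^sub>v x)) \<and>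
                 l2_norm (R A (A *\<^sub>v x) - x) \<le> (1 + \<epsilon> / sqrt (log 2 (real n))) * Err2 k x}
           \<ge> 1 - 1 / real k powr c))"
proof -
  define K where "K = (b / a)\<^sup>2 / (2 * \<alpha> - 1)"
  have K: "0 \<le> K" using assms(1) by (simp add: K_def)
  \<comment> \<open>There are at most k + 16 K k heavy columns, so this multiple of \<open>k\<close>
    is a safe length for the candidate list.\<close>
  define C3 where "C3 = nat \<lceil>1 + 16 * K\<rceil>"
  have C3: "1 + 16 * K \<le> real C3" by (simp add: C3_def real_nat_ceiling_ge)
  then have C3_1: "1 \<le> C3" using K by simp
  \<comment> \<open>64 is 2 for the halves, times 16 from the number of buckets, times 2 for
    rounding \<open>L\<close> up. The other factor turns (c + 3) (1 + 128 / \<epsilon>^2) into a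
    multiple of c / \<epsilon>^2; this is where the bounds \<open>c0\<close> and
    \<open>\<epsilon>0\<close> enter.\<close>
  define Cc where "Cc = 64 * real C3 * ((1 + 3 / c0) * (\<epsilon>0\<^sup>2 + 128))"
  have "0 < Cc" using C3_1 assms(4) by (auto simp: Cc_def intro!: mult_pos_pos add_pos_nonneg add_nonneg_pos)
  moreover have "\<exists>T>0. \<exists>p. \<forall>n\<ge>2. \<forall>k\<ge>1.
      \<exists>(m :: nat) (D :: real mat pmf) (R :: real mat \<Rightarrow> real vec \<Rightarrow> real vec).
        real m \<le> Cc * (c / \<epsilon>\<^sup>2 * real k * log 2 (real n)) \<and>
        set_pmf D \<subseteq> carrier_mat m n \<and>
        (\<forall>A\<in>set_pmf D. \<forall>y\<in>carrier_vec m.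
           recovers_within p k A y (T * (real n * log 2 (real n))) (R A y)) \<and>
        (\<forall>x\<in>carrier_vec n. sub_zipfian a b k \<alpha> x \<longrightarrow>
           measure_pmf.prob D
             {A. k_sparse k (R A (A *\<^sub>v x)) \<and>
                 l2_norm (R A (A *\<^sub>v x) - x) \<le> (1 + \<epsilon> / sqrt (log 2 (real n))) * Err2 k x}
           \<ge> 1 - 1 / real k powr c)"
    if c: "c0 \<le> c" and \<epsilon>: "0 < \<epsilon>" "\<epsilon> \<le> \<epsilon>0" for c \<epsilon>
  proof -
    have c0: "0 < c" using c assms(4) by simp
    \<comment> \<open>The two summands meet the two demands on \<open>L\<close>: (c + 3) log n for
      the union bounds, and 128 (c + 3) log n / \<epsilon>^2 for the precision.\<close>
    define g where "g = (c + 3) * (1 + 128 / \<epsilon>\<^sup>2)"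
    have g: "3 \<le> g"
    proof -
      have "3 * 1 \<le> (c + 3) * (1 + 128 / \<epsilon>\<^sup>2)" using c0 by (intro mult_mono) auto
      then show ?thesis by (simp add: g_def)
    qed
    have gle: "g \<le> (1 + 3 / c0) * (\<epsilon>0\<^sup>2 + 128) * (c / \<epsilon>\<^sup>2)"
    proof -
      have "c + 3 \<le> (1 + 3 / c0) * c" using c assms(4) by (simp add: field_simps)
      moreover have "1 + 128 / \<epsilon>\<^sup>2 \<le> (\<epsilon>0\<^sup>2 + 128) / \<epsilon>\<^sup>2"
      proof -
        have "\<epsilon>\<^sup>2 \<le> \<epsilon>0\<^sup>2" using \<epsilon> by (intro power_mono) auto
        then have "1 \<le> \<epsilon>0\<^sup>2 / \<epsilon>\<^sup>2" using \<epsilon> by simp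
        then show ?thesis by (simp add: add_divide_distrib)
      qed
      ultimately have "g \<le> ((1 + 3 / c0) * c) * ((\<epsilon>0\<^sup>2 + 128) / \<epsilon>\<^sup>2)"
        unfolding g_def using c0 assms(4) by (intro mult_mono) auto
      then show ?thesis by (simp add: mult_ac)
    qed
    let ?p = "main_prog C3"
    have main: "\<exists>(m :: nat) (D :: real mat pmf) (R :: real mat \<Rightarrow> real vec \<Rightarrow> real vec).
        real m \<le> Cc * (c / \<epsilon>\<^sup>2 * real k * log 2 (real n)) \<and>
        set_pmf D \<subseteq> carrier_mat m n \<and>
        (\<forall>A\<in>set_pmf D. \<forall>y\<in>carrier_vec m.
           recovers_within ?p k A y ((200 + 90 * (2 * g)) * (real n * log 2 (real n))) (R A y)) \<and>
        (\<forall>x\<in>carrier_vec n. sub_zipfian a b k \<alpha> x \<longrightarrow>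
           measure_pmf.prob D
             {A. k_sparse k (R A (A *\<^sub>v x)) \<and>
                 l2_norm (R A (A *\<^sub>v x) - x) \<le> (1 + \<epsilon> / sqrt (log 2 (real n))) * Err2 k x}
           \<ge> 1 - 1 / real k powr c)" if n: "2 \<le> n" and k: "1 \<le> k" for n k
    proof -
      define lg where "lg = log 2 (real n)"
      have lg: "1 \<le> lg" using n by (simp add: lg_def le_log_iff)
      define L where "L = nat \<lceil>g * lg\<rceil>"
      define B where "B = 16 * C3 * k"
      have "1 * 1 \<le> g * lg" using g lg by (intro mult_mono) auto
      then have gl: "1 \<le> g * lg" by simp
      have Lge: "g * lg \<le> real L" by (simp add: L_def real_nat_ceiling_ge)
      have "real L < g * lg + 1" unfolding L_def using gl by linarith
      then have Lle: "real L \<le> (2 * g) * lg" using gl by linarith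
      have n1: "1 \<le> n" using n by simp
      have L1: "1 \<le> L" using Lge gl by linarith
      have B1: "1 \<le> B" using C3_1 k by (simp add: B_def)
      have mle: "real (2 * L * B) \<le> Cc * (c / \<epsilon>\<^sup>2 * real k * lg)"
      proof -
        have "real (2 * L * B) = 32 * real C3 * real k * real L" by (simp add: B_def)
        also have "\<dots> \<le> 32 * real C3 * real k * ((2 * g) * lg)" using Lle by (intro mult_left_mono) auto
        also have "\<dots> = (64 * real C3 * real k * lg) * g" by simp
        also have "\<dots> \<le> (64 * real C3 * real k * lg) * ((1 + 3 / c0) * (\<epsilon>0\<^sup>2 + 128) * (c / \<epsilon>\<^sup>2))"
          using gle lg by (intro mult_left_mono) auto
        also have "\<dots> = Cc * (c / \<epsilon>\<^sup>2 * real k * lg)" unfolding Cc_def by (simp only: mult_ac)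
        finally show ?thesis .
      qed
      have CK: "real k + 16 * (K * real k) \<le> real (C3 * k)"
        using mult_right_mono[OF C3, of "real k"] by (simp add: algebra_simps)
      have zipf: "\<exists>T \<theta>. top_set k x T \<theta> \<and> (\<Sum>l\<in>{..<n} - T. (x $ l)\<^sup>2) \<le> K * real k * \<theta>\<^sup>2"
        if "x \<in> carrier_vec n" "sub_zipfian a b k \<alpha> x" for x
        using sub_zipfian_top_set[OF that(2) k assms(2,3,1)] that(1) unfolding K_def by (metis carrier_vecD)
      show ?thesis
      \<comment> \<open>Otherwise sorting the rows could exceed n log n, but then the identity pair
        with its 2 n rows is within the allowed number of rows.\<close>
      proof (cases "L * B < n")
        case True
        let ?D = "map_pmf (sketch_matrix n L B) (sketch_pmf n L B)"
        have time: "recovers_within ?p k A y ((200 + 90 * (2 * g)) * (real n * lg)) (decode ?p k A y)"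
          if A: "A \<in> set_pmf ?D" and y: "y \<in> carrier_vec (2 * L * B)" for A y
        proof -
          obtain z where z: "z \<in> set_pmf (sketch_pmf n L B)" "A = sketch_matrix n L B z" using A by auto
          have hs: "hashing n (2 * L) B (joint_hash L (fst z) (fst (snd z))) (joint_sign L (fst z) (snd (snd z)))"
            using hashing_sketch[OF _ L1 z(1)] B1 by simp
          have "1 \<le> L * B" using L1 B1 by simp
          then have t: "real (L * B * (5 * floor_log (2 * (L * B)) + 34) + n * (5 * floor_log (2 * n) + 23) +
            (n + 2 * L * n) * 45 + 42) \<le> (200 + 90 * (2 * g)) * (real n * lg)"
            unfolding lg_def using True n Lle by (intro running_time_bound) (auto simp: lg_def)
          show ?thesis unfolding z(2) sketch_matrix_def
            by (rule recovers_within_mono[OF decode_hash_matrix(1)[OF hs L1 B1 n1 y] t])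
        qed
        have car: "set_pmf ?D \<subseteq> carrier_mat (2 * L * B) n"
          by (auto simp: sketch_matrix_def hash_matrix_def)
        have prob: "1 - 1 / real k powr c \<le> measure_pmf.prob ?D
             {A. k_sparse k (decode ?p k A (A *\<^sub>v x)) \<and>
                 l2_norm (decode ?p k A (A *\<^sub>v x) - x) \<le> (1 + \<epsilon> / sqrt lg) * Err2 k x}"
          if x: "x \<in> carrier_vec n" "sub_zipfian a b k \<alpha> x" for x
        proof (cases "k = 1")
          \<comment> \<open>For k = 1 the required probability is 0. From k = 2 on, ln k is
            positive, as the load bound demands.\<close>
          case False
          then have k2: "2 \<le> k" using k by simp
          obtain T \<theta> where T: "top_set k x T \<theta>" "(\<Sum>l\<in>{..<n} - T. (x $ l)\<^sup>2) \<le> K * real k * \<theta>\<^sup>2"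
            using zipf[OF x] by blast
          have kn: "k \<le> n"
          proof -
            have "k * 1 \<le> B * L" unfolding B_def using C3_1 L1 by (intro mult_mono) auto
            then show ?thesis using True by (simp add: mult.commute)
          qed
          have gl1: "(c + 3) * lg \<le> real L" "128 * (c + 3) * lg \<le> \<epsilon>\<^sup>2 * real L"
          proof -
            have e: "g * lg = (c + 3) * lg + (c + 3) * (128 / \<epsilon>\<^sup>2) * lg" by (simp add: g_def algebra_simps)
            have "0 \<le> (c + 3) * (128 / \<epsilon>\<^sup>2) * lg" "0 \<le> (c + 3) * lg" using c0 lg by auto
            then show "(c + 3) * lg \<le> real L" using e Lge by linarith
            have "(c + 3) * (128 / \<epsilon>\<^sup>2) * lg \<le> real L" using e Lge \<open>0 \<le> (c + 3) * lg\<close> by linarith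
            then have "\<epsilon>\<^sup>2 * ((c + 3) * (128 / \<epsilon>\<^sup>2) * lg) \<le> \<epsilon>\<^sup>2 * real L" by (intro mult_left_mono) auto
            moreover have "\<epsilon>\<^sup>2 * ((c + 3) * (128 / \<epsilon>\<^sup>2) * lg) = 128 * (c + 3) * lg" using \<epsilon> by simp
            ultimately show "128 * (c + 3) * lg \<le> \<epsilon>\<^sup>2 * real L" by linarith
          qed
          have "1 - 1 / real k powr c \<le> 1 - (3 * real n * (1/2) ^ L + real k powr (- (c + 2)))"
            using failure_bound[OF k2 kn c0 gl1(1)[unfolded lg_def]] by linarith
          also have "\<dots> \<le> measure_pmf.prob ?D
             {A. k_sparse k (decode ?p k A (A *\<^sub>v x)) \<and>
                 l2_norm (decode ?p k A (A *\<^sub>v x) - x) \<le> (1 + \<epsilon> / sqrt lg) * Err2 k x}"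
            unfolding B_def using n lg
            by (intro sketch_success_prob[OF L1 _ k2 c0 \<epsilon>(1) x(1) T K C3 gl1(2)]) auto
          finally show ?thesis .
        qed simp
        show ?thesis
          by (rule exI[of _ "2 * L * B"], rule exI[of _ ?D], rule exI[of _ "decode ?p k"])
            (use mle car time prob in \<open>simp add: lg_def\<close>)
      next
        case False
        let ?A = "hash_matrix n (2 * 1) n (\<lambda>_ i. i) (\<lambda>_ _. 1)"
        have hs: "hashing n (2 * 1) n (\<lambda>_ i. i) (\<lambda>_ _. 1)" by unfold_locales auto
        have "real (2 * n) \<le> real (2 * L * B)" using False by (simp only: of_nat_le_iff)
        then have m: "real (2 * n) \<le> Cc * (c / \<epsilon>\<^sup>2 * real k * lg)" using mle by linarith
        have time: "recovers_within ?p k ?A y ((200 + 90 * (2 * g)) * (real n * lg)) (decode ?p k ?A y)"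
          if y: "y \<in> carrier_vec (2 * n)" for y
        proof -
          have y': "y \<in> carrier_vec (2 * 1 * n)" using y by simp
          have "real 1 \<le> (2 * g) * lg" using gl by linarith
          then have t: "real (1 * n * (5 * floor_log (2 * (1 * n)) + 34) + n * (5 * floor_log (2 * n) + 23) +
            (n + 2 * 1 * n) * 45 + 42) \<le> (200 + 90 * (2 * g)) * (real n * lg)"
            unfolding lg_def using n by (intro running_time_bound) auto
          show ?thesis
            by (rule recovers_within_mono[OF decode_hash_matrix(1)[OF hs order_refl n1 n1 y'] t])
        qed
        have good: "k_sparse k (decode ?p k ?A (?A *\<^sub>v x)) \<and>
            l2_norm (decode ?p k ?A (?A *\<^sub>v x) - x) \<le> (1 + \<epsilon> / sqrt lg) * Err2 k x"
          if x: "x \<in> carrier_vec n" "sub_zipfian a b k \<alpha> x" for x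
        proof -
          obtain T \<theta> where T: "top_set k x T \<theta>" "(\<Sum>l\<in>{..<n} - T. (x $ l)\<^sup>2) \<le> K * real k * \<theta>\<^sup>2"
            using zipf[OF x] by blast
          have "0 \<le> \<epsilon> / (2 * sqrt lg)" using \<epsilon> lg by simp
          from identity_recovers[OF _ x(1) T CK this] n show ?thesis by simp
        qed
        have car: "?A \<in> carrier_mat (2 * n) n" by (simp add: hash_matrix_def)
        have k0: "0 \<le> 1 / real k powr c" by simp
        show ?thesis
          by (rule exI[of _ "2 * n"], rule exI[of _ "return_pmf ?A"], rule exI[of _ "decode ?p k"])
            (use m car time good k0 in \<open>simp add: lg_def measure_return_pmf\<close>)
      qed
    qed
    have "0 < 200 + 90 * (2 * g)" using g by simp
    then show ?thesis using main by blast
  qed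
  ultimately show ?thesis by blast
qed

end
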